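(* Let $\Omega$ be an infinite procyclic group and $T:\Omega\to\Omega$ a minimal translation. There is a dense $G_\delta$ set of $f\in C(\Omega,\mathbb{R})$ such that for every $\lambda\in\mathbb{R}\setminus\{0\}$: the set $\Sigma(\lambda f)$ has zero Lebesgue measure; for every $\omega\in\Omega$ the operator $(H_\omega\psi)(n)=\psi(n+1)+\psi(n-1)+\lambda f(T^n\omega)\psi(n)$ on $\ell^2(\mathbb{Z})$ has purely singular continuous spectrum; and $L(E,T,\lambda f)=0$ for every $E\in\Sigma(\lambda f)$.
   Context: A procyclic group is a compact Hausdorff topological group that is an inverse limit of finite cyclic (discrete) groups. A translation of $\Omega$ is a map $T(\omega)=\omega\cdot\omega_0$ for some fixed $\omega_0\in\Omega$; it is minimal if every orbit $\{T^n\omega:n\in\mathbb{Z}\}$ is dense in $\Omega$. $C(\Omega,\mathbb{R})$ carries the sup norm. For $g\in C(\Omega,\mathbb{R})$, the spectrum of the operator $(H\psi)(n)=\psi(n+1)+\psi(n-1)+g(T^n\omega)\psi(n)$ on $\ell^2(\mathbb{Z})$ does not depend on $\omega\in\Omega$ (by minimality) and is denoted $\Sigma(g)$. With $\mu$ the normalized Haar measure on $\Omega$, the Lyapunov exponent is $$L(E,T,g)=\lim_{n\to\infty}\frac1n\int_\Omega\log\|A_n^{(E,T,g)}(\omega)\|\,d\mu(\omega),$$ where $A_n^{(E,T,g)}(\omega)=S_n\cdots S_1$ and $S_i=\begin{pmatrix}E-g(T^i\omega)&-1\\1&0\end{pmatrix}$. Purely singular continuous spectrum means that all spectral measures are continuous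 (no atoms) and singular with respect to Lebesgue measure. *)

theory Defs
  imports
    "HOL-Analysis.Analysis"
    "HOL-Algebra.Product_Groups"
    "HOL-Algebra.Elementary_Groups"
begin

subsection \<open>Procyclic groups\<close>

text \<open>A topological group is a type of class \<open>topological_group_add\<close>, the library's class of
  topological groups. It is written additively, but the class does not assume commutativity.\<close>

definition additive_group :: "'a::group_add monoid" where
  "additive_group = \<lparr>carrier = UNIV, mult = (+), one = 0\<rparr>"

text \<open>\<open>p i j\<close> is the transition map from \<open>G j\<close> to \<open>G i\<close>, for \<open>below i j\<close>.\<close>

definition inverse_system ::
  "'i set \<Rightarrow> ('i \<Rightarrow> 'i \<Rightarrow> bool) \<Rightarrow> ('i \<Rightarrow> 'g monoid) \<Rightarrow> ('i \<Rightarrow> 'i \<Rightarrow> 'g \<Rightarrow> 'g) \<Rightarrow> bool" where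
  "inverse_system I below G p \<longleftrightarrow>
     I \<noteq> {} \<and>
     (\<forall>i\<in>I. below i i) \<and>
     (\<forall>i\<in>I. \<forall>j\<in>I. \<forall>k\<in>I. below i j \<longrightarrow> below j k \<longrightarrow> below i k) \<and>
     (\<forall>i\<in>I. \<forall>j\<in>I. \<exists>k\<in>I. below i k \<and> below j k) \<and>
     (\<forall>i\<in>I. group (G i)) \<and>
     (\<forall>i\<in>I. \<forall>j\<in>I. below i j \<longrightarrow> p i j \<in> hom (G j) (G i)) \<and>
     (\<forall>i\<in>I. \<forall>x\<in>carrier (G i). p i i x = x) \<and>
     (\<forall>i\<in>I. \<forall>j\<in>I. \<forall>k\<in>I. below i j \<longrightarrow> below j k \<longrightarrow>
        (\<forall>x\<in>carrier (G k). p i j (p j k x) = p i k x))"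

definition inverse_limit_carrier ::
  "'i set \<Rightarrow> ('i \<Rightarrow> 'i \<Rightarrow> bool) \<Rightarrow> ('i \<Rightarrow> 'g monoid) \<Rightarrow> ('i \<Rightarrow> 'i \<Rightarrow> 'g \<Rightarrow> 'g) \<Rightarrow> ('i \<Rightarrow> 'g) set" where
  "inverse_limit_carrier I below G p =
     {x \<in> carrier (product_group I G). \<forall>i\<in>I. \<forall>j\<in>I. below i j \<longrightarrow> p i j (x j) = x i}"

definition inverse_limit_group ::
  "'i set \<Rightarrow> ('i \<Rightarrow> 'i \<Rightarrow> bool) \<Rightarrow> ('i \<Rightarrow> 'g monoid) \<Rightarrow> ('i \<Rightarrow> 'i \<Rightarrow> 'g \<Rightarrow> 'g) \<Rightarrow> ('i \<Rightarrow> 'g) monoid" where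
  "inverse_limit_group I below G p =
     (product_group I G)\<lparr>carrier := inverse_limit_carrier I below G p\<rparr>"

definition inverse_limit_topology ::
  "'i set \<Rightarrow> ('i \<Rightarrow> 'i \<Rightarrow> bool) \<Rightarrow> ('i \<Rightarrow> 'g monoid) \<Rightarrow> ('i \<Rightarrow> 'i \<Rightarrow> 'g \<Rightarrow> 'g) \<Rightarrow> ('i \<Rightarrow> 'g) topology" where
  "inverse_limit_topology I below G p =
     subtopology (product_topology (\<lambda>i. discrete_topology (carrier (G i))) I)
       (inverse_limit_carrier I below G p)"

text \<open>HOL has no quantification over types, so the types in which the index set and the finite
  groups live are parameters. A theorem that assumes procyclicity with these two types as free type
  variables covers every inverse system.\<close>

definition procyclic ::
  "'a::{topological_group_add, t2_space} itself \<Rightarrow> 'i itself \<Rightarrow> 'g itself \<Rightarrow> bool" where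
  "procyclic _ _ _ \<longleftrightarrow>
     compact (UNIV :: 'a set) \<and>
     (\<exists>(I :: 'i set) below (G :: 'i \<Rightarrow> 'g monoid) p (h :: 'a \<Rightarrow> 'i \<Rightarrow> 'g).
        inverse_system I below G p \<and>
        (\<forall>i\<in>I. finite (carrier (G i)) \<and> cyclic_group (G i)) \<and>
        h \<in> iso additive_group (inverse_limit_group I below G p) \<and>
        homeomorphic_map euclidean (inverse_limit_topology I below G p) h)"


subsection \<open>Minimal translations\<close>

definition translation :: "('a::plus \<Rightarrow> 'a) \<Rightarrow> bool" where
  "translation T \<longleftrightarrow> (\<exists>\<omega>\<^sub>0. \<forall>\<omega>. T \<omega> = \<omega> + \<omega>\<^sub>0)"

definition int_iter :: "('a \<Rightarrow> 'a) \<Rightarrow> int \<Rightarrow> 'a \<Rightarrow> 'a" where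
  "int_iter T n = (if 0 \<le> n then T ^^ nat n else (inv_into UNIV T) ^^ nat (- n))"

definition minimal :: "('a::topological_space \<Rightarrow> 'a) \<Rightarrow> bool" where
  "minimal T \<longleftrightarrow> (\<forall>\<omega>. closure (range (\<lambda>n. int_iter T n \<omega>)) = UNIV)"


subsection \<open>Operators on the Hilbert space of square-summable bi-infinite sequences\<close>

definition ell2 :: "(int \<Rightarrow> complex) set" where
  "ell2 = {\<psi>. (\<lambda>n. (cmod (\<psi> n))\<^sup>2) summable_on UNIV}"

definition ell2_norm :: "(int \<Rightarrow> complex) \<Rightarrow> real" where
  "ell2_norm \<psi> = sqrt (\<Sum>\<^sub>\<infinity>n. (cmod (\<psi> n))\<^sup>2)"

definition ell2_inner :: "(int \<Rightarrow> complex) \<Rightarrow> (int \<Rightarrow> complex) \<Rightarrow> complex" where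
  "ell2_inner \<phi> \<psi> = (\<Sum>\<^sub>\<infinity>n. cnj (\<phi> n) * \<psi> n)"

definition bounded_operator :: "((int \<Rightarrow> complex) \<Rightarrow> (int \<Rightarrow> complex)) \<Rightarrow> bool" where
  "bounded_operator A \<longleftrightarrow>
     (\<forall>\<psi>\<in>ell2. A \<psi> \<in> ell2) \<and>
     (\<forall>\<phi>\<in>ell2. \<forall>\<psi>\<in>ell2. A (\<lambda>n. \<phi> n + \<psi> n) = (\<lambda>n. A \<phi> n + A \<psi> n)) \<and>
     (\<forall>c. \<forall>\<psi>\<in>ell2. A (\<lambda>n. c * \<psi> n) = (\<lambda>n. c * A \<psi> n)) \<and>
     (\<exists>C. \<forall>\<psi>\<in>ell2. ell2_norm (A \<psi>) \<le> C * ell2_norm \<psi>)"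

text \<open>\<open>R\<close> is the bounded inverse of \<open>A - z\<close> on \<open>ell2\<close>.\<close>

definition is_resolvent ::
  "((int \<Rightarrow> complex) \<Rightarrow> (int \<Rightarrow> complex)) \<Rightarrow> complex \<Rightarrow> ((int \<Rightarrow> complex) \<Rightarrow> (int \<Rightarrow> complex)) \<Rightarrow> bool" where
  "is_resolvent A z R \<longleftrightarrow>
     bounded_operator R \<and>
     (\<forall>\<psi>\<in>ell2. R (\<lambda>n. A \<psi> n - z * \<psi> n) = \<psi> \<and> (\<lambda>n. A (R \<psi>) n - z * R \<psi> n) = \<psi>)"

definition spectrum :: "((int \<Rightarrow> complex) \<Rightarrow> (int \<Rightarrow> complex)) \<Rightarrow> complex set" where
  "spectrum A = {z. \<not> (\<exists>R. is_resolvent A z R)}"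

text \<open>For bounded self-adjoint \<open>A\<close>, the spectral measure of \<open>\<psi>\<close> is the unique finite Borel measure
  on the real line whose Borel transform is the diagonal matrix element of the resolvent at
  \<open>\<psi>\<close>.\<close>

definition is_spectral_measure ::
  "((int \<Rightarrow> complex) \<Rightarrow> (int \<Rightarrow> complex)) \<Rightarrow> (int \<Rightarrow> complex) \<Rightarrow> real measure \<Rightarrow> bool" where
  "is_spectral_measure A \<psi> \<nu> \<longleftrightarrow>
     sets \<nu> = sets borel \<and> finite_measure \<nu> \<and>
     (\<forall>z R. Im z \<noteq> 0 \<longrightarrow> is_resolvent A z R \<longrightarrow>
        ell2_inner \<psi> (R \<psi>) = (\<integral>x. 1 / (complex_of_real x - z) \<partial>\<nu>))"

definition continuous_measure :: "real measure \<Rightarrow> bool" where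
  "continuous_measure \<nu> \<longleftrightarrow> (\<forall>x. emeasure \<nu> {x} = 0)"

definition singular_measure :: "real measure \<Rightarrow> bool" where
  "singular_measure \<nu> \<longleftrightarrow>
     (\<exists>N\<in>sets borel. emeasure lborel N = 0 \<and> emeasure \<nu> (- N) = 0)"

definition purely_singular_continuous :: "((int \<Rightarrow> complex) \<Rightarrow> (int \<Rightarrow> complex)) \<Rightarrow> bool" where
  "purely_singular_continuous A \<longleftrightarrow>
     (\<forall>\<psi>\<in>ell2. \<forall>\<nu>. is_spectral_measure A \<psi> \<nu> \<longrightarrow> continuous_measure \<nu> \<and> singular_measure \<nu>)"


subsection \<open>Dynamically defined Schroedinger operators\<close>

definition schrodinger ::
  "('a \<Rightarrow> 'a) \<Rightarrow> ('a \<Rightarrow> real) \<Rightarrow> 'a \<Rightarrow> (int \<Rightarrow> complex) \<Rightarrow> (int \<Rightarrow> complex)" where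
  "schrodinger T g \<omega> \<psi> =
     (\<lambda>n. \<psi> (n + 1) + \<psi> (n - 1) + complex_of_real (g (int_iter T n \<omega>)) * \<psi> n)"

text \<open>The common spectrum of the operators \<open>schrodinger T g \<omega>\<close>, as a set of reals (the operators
  are self-adjoint). For minimal \<open>T\<close> and continuous \<open>g\<close> it does not depend on \<open>\<omega>\<close>.\<close>

definition Sigma_spec :: "('a \<Rightarrow> 'a) \<Rightarrow> ('a \<Rightarrow> real) \<Rightarrow> real set" where
  "Sigma_spec T g =
     (THE S. \<forall>\<omega>. S = {E. complex_of_real E \<in> spectrum (schrodinger T g \<omega>)})"


subsection \<open>Haar measure and the Lyapunov exponent\<close>

definition normalized_haar :: "'a::{topological_group_add, t2_space} measure \<Rightarrow> bool" where
  "normalized_haar \<mu> \<longleftrightarrow>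
     sets \<mu> = sets borel \<and>
     emeasure \<mu> UNIV = 1 \<and>
     (\<forall>a. \<forall>A\<in>sets borel. emeasure \<mu> ((+) a ` A) = emeasure \<mu> A) \<and>
     (\<forall>A\<in>sets borel. emeasure \<mu> A = (SUP K\<in>{K. compact K \<and> K \<subseteq> A}. emeasure \<mu> K)) \<and>
     (\<forall>A\<in>sets borel. emeasure \<mu> A = (INF U\<in>{U. open U \<and> A \<subseteq> U}. emeasure \<mu> U))"

definition transfer_step :: "real \<Rightarrow> ('a \<Rightarrow> 'a) \<Rightarrow> ('a \<Rightarrow> real) \<Rightarrow> 'a \<Rightarrow> nat \<Rightarrow> real^2^2" where
  "transfer_step E T g \<omega> i =
     vector [vector [E - g ((T ^^ i) \<omega>), - 1],
             vector [1, 0]]"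

fun transfer_matrix :: "real \<Rightarrow> ('a \<Rightarrow> 'a) \<Rightarrow> ('a \<Rightarrow> real) \<Rightarrow> 'a \<Rightarrow> nat \<Rightarrow> real^2^2" where
  "transfer_matrix E T g \<omega> 0 = mat 1"
| "transfer_matrix E T g \<omega> (Suc n) =
     transfer_step E T g \<omega> (Suc n) ** transfer_matrix E T g \<omega> n"

definition lyapunov_exponent ::
  "'a measure \<Rightarrow> real \<Rightarrow> ('a \<Rightarrow> 'a) \<Rightarrow> ('a \<Rightarrow> real) \<Rightarrow> real" where
  "lyapunov_exponent \<mu> E T g =
     lim (\<lambda>n. 1 / real n * (\<integral>\<omega>. ln (onorm ((*v) (transfer_matrix E T g \<omega> n))) \<partial>\<mu>))"

end

theory Submission
  imports Defs "HOL-Computational_Algebra.Fundamental_Theorem_Algebra"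
begin

text \<open>The functions in the generic set are extremely well approximated by periodic functions whose
  spectrum is tiny for all couplings in a compact range. Let \<open>D(E)\<close> be the trace of the transfer
  matrix over a period \<open>q\<close> (the discriminant). By Cayley--Hamilton, whatever is close enough to the
  periodic function has its spectrum inside \<open>\<bar>D\<bar> \<le> 2 + \<eta>\<close> with \<open>\<eta>\<close> as small as desired, hence has
  small spectrum and transfer matrices of subexponential growth there; the same identity is Gordon's
  argument against eigenvalues, so spectral measures have no atoms, and they are carried by the null
  set \<open>\<Sigma>\<close>.

  To make the bands of a periodic function \<open>f\<close> short by a small perturbation: for every coupling
  and energy some small periodic perturbation opens a gap there (repeat the period, rotate it to trace
  \<open>2\<close> or \<open>-2\<close> by a constant shift, perturb two neighbouring sites). By compactness finitely many of
  these perturbations suffice. Concatenate many repetitions of each of them into one very long period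
  \<open>Q\<close>. Then at every energy some sub-block has an exponentially large transfer matrix, which bounds
  \<open>\<bar>D'\<bar> / sqrt (4 - D\<^sup>2)\<close> below by an exponential in \<open>Q\<close>, so each of the at most \<open>Q\<close> bands is
  exponentially short.\<close>

subsection \<open>Two-by-two transfer matrices\<close>

text \<open>One residual set must serve all nonzero couplings, an uncountable family. Stage
  \<open>k\<close> therefore treats all \<open>l\<close> with 1/k <= |l| <= k at once, and gaps are
  opened uniformly over a compact set of pairs (coupling, energy). A stage is an open condition
  because its tolerance \<open>r\<close> is fixed after the period, its bands and the block length;
  Baire's theorem then intersects the stages. Floquet theory and the spectral theorem are avoided. E
  lies in the spectrum iff no bound delta * norm x <= norm ((H - E) x) with delta > 0 holds, a
  criterion that is stable under small changes of the potential; spectral measures are reached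
  through the resolvent. The price is that the bands are only known up to |D| <= 2 + eta, so the
  rims 2 <= |D| <= 2 + eta have to be measured as well. The group enters through the orbit of 0.
  Open subgroups yield the available periods (their first return times), and infinitude of the group
  yields arbitrarily large multiples of each of them. A constructed period must be of this kind and
  cannot be prescribed exactly, so the concatenation leaves some sites unperturbed.\<close>

datatype mat2 = Mat2 (m11: real) (m12: real) (m21: real) (m22: real)

instantiation mat2 :: monoid_mult
begin
definition one_mat2 :: mat2 where "1 = Mat2 1 0 0 1"
definition times_mat2 :: "mat2 \<Rightarrow> mat2 \<Rightarrow> mat2" where
  "A * B = Mat2 (m11 A * m11 B + m12 A * m21 B) (m11 A * m12 B + m12 A * m22 B)
                (m21 A * m11 B + m22 A * m21 B) (m21 A * m12 B + m22 A * m22 B)"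
instance
  by standard (simp_all add: one_mat2_def times_mat2_def algebra_simps)
end

lemma mat2_times_sel [simp]:
  "m11 (A * B) = m11 A * m11 B + m12 A * m21 B"
  "m12 (A * B) = m11 A * m12 B + m12 A * m22 B"
  "m21 (A * B) = m21 A * m11 B + m22 A * m21 B"
  "m22 (A * B) = m21 A * m12 B + m22 A * m22 B"
  by (simp_all add: times_mat2_def)

lemma mat2_one_sel [simp]: "m11 1 = 1" "m12 1 = 0" "m21 1 = 0" "m22 1 = 1"
  by (simp_all add: one_mat2_def)

definition tr2 :: "mat2 \<Rightarrow> real" where "tr2 A = m11 A + m22 A"
definition det2 :: "mat2 \<Rightarrow> real" where "det2 A = m11 A * m22 A - m12 A * m21 A"
definition nm2 :: "mat2 \<Rightarrow> real" where
  "nm2 A = \<bar>m11 A\<bar> + \<bar>m12 A\<bar> + \<bar>m21 A\<bar> + \<bar>m22 A\<bar>"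

lemma det2_one [simp]: "det2 1 = 1" by (simp add: det2_def)
lemma det2_mult: "det2 (A * B) = det2 A * det2 B"
  by (simp add: det2_def algebra_simps)

lemma tr2_one [simp]: "tr2 1 = 2" by (simp add: tr2_def)
lemma tr2_mult_commute: "tr2 (A * B) = tr2 (B * A)"
  by (simp add: tr2_def algebra_simps)

lemma nm2_nonneg [simp]: "0 \<le> nm2 A" by (simp add: nm2_def)
lemma nm2_one [simp]: "nm2 1 = 2" by (simp add: nm2_def)

lemma abs_entry_le_nm2: "\<bar>m11 A\<bar> \<le> nm2 A" "\<bar>m12 A\<bar> \<le> nm2 A" "\<bar>m21 A\<bar> \<le> nm2 A" "\<bar>m22 A\<bar> \<le> nm2 A"
  by (simp_all add: nm2_def)

lemma nm2_mult_le: "nm2 (A * B) \<le> nm2 A * nm2 B"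
proof -
  have e: "\<bar>x * y + z * w\<bar> \<le> \<bar>x\<bar> * \<bar>y\<bar> + \<bar>z\<bar> * \<bar>w\<bar>" for x y z w :: real
    by (metis abs_mult abs_triangle_ineq)
  have "nm2 (A * B) \<le> (\<bar>m11 A\<bar> * \<bar>m11 B\<bar> + \<bar>m12 A\<bar> * \<bar>m21 B\<bar>) + (\<bar>m11 A\<bar> * \<bar>m12 B\<bar> + \<bar>m12 A\<bar> * \<bar>m22 B\<bar>)
     + (\<bar>m21 A\<bar> * \<bar>m11 B\<bar> + \<bar>m22 A\<bar> * \<bar>m21 B\<bar>) + (\<bar>m21 A\<bar> * \<bar>m12 B\<bar> + \<bar>m22 A\<bar> * \<bar>m22 B\<bar>)"
    unfolding nm2_def mat2_times_sel by (intro add_mono e)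
  also have "\<dots> = (\<bar>m11 A\<bar> + \<bar>m21 A\<bar>) * (\<bar>m11 B\<bar> + \<bar>m12 B\<bar>) + (\<bar>m12 A\<bar> + \<bar>m22 A\<bar>) * (\<bar>m21 B\<bar> + \<bar>m22 B\<bar>)"
    by (simp add: algebra_simps)
  also have "\<dots> \<le> (\<bar>m11 A\<bar> + \<bar>m21 A\<bar>) * nm2 B + (\<bar>m12 A\<bar> + \<bar>m22 A\<bar>) * nm2 B"
    by (intro add_mono mult_left_mono) (simp_all add: nm2_def)
  also have "\<dots> = nm2 A * nm2 B" by (simp add: nm2_def algebra_simps)
  finally show ?thesis .
qed

text \<open>This is A^2 = (tr A) A - 1, written entrywise because \<open>mat2\<close> carries only a
  multiplicative structure.\<close>

lemma cayley_hamilton_entries: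
  assumes "det2 A = 1"
  shows "m11 (A * A) = tr2 A * m11 A - 1" "m12 (A * A) = tr2 A * m12 A"
    "m21 (A * A) = tr2 A * m21 A" "m22 (A * A) = tr2 A * m22 A - 1"
  using assms by (simp_all add: det2_def tr2_def algebra_simps)

lemma tr2_square: "det2 A = 1 \<Longrightarrow> tr2 (A * A) = (tr2 A)\<^sup>2 - 2"
  using cayley_hamilton_entries(1,4)[of A] unfolding tr2_def[of "A * A"]
  by (simp add: power2_eq_square) (simp add: tr2_def algebra_simps)

lemma nm2_square_le:
  assumes "det2 A = 1"
  shows "nm2 (A * A) \<le> \<bar>tr2 A\<bar> * nm2 A + 2"
proof -
  have "nm2 (A * A) \<le> (\<bar>tr2 A\<bar> * \<bar>m11 A\<bar> + 1) + \<bar>tr2 A\<bar> * \<bar>m12 A\<bar> + \<bar>tr2 A\<bar> * \<bar>m21 A\<bar> + (\<bar>tr2 A\<bar> * \<bar>m22 A\<bar> + 1)"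
    unfolding nm2_def cayley_hamilton_entries[OF assms]
    by (intro add_mono order.trans[OF abs_triangle_ineq4]) (simp_all add: abs_mult)
  also have "\<dots> = \<bar>tr2 A\<bar> * nm2 A + 2" by (simp add: nm2_def algebra_simps)
  finally show ?thesis .
qed

lemma det2_power: "det2 (A ^ n) = det2 A ^ n"
  by (induction n) (simp_all add: det2_mult)

text \<open>Cayley-Hamilton multiplied by A^n, under the trace: the Chebyshev recursion.\<close>

lemma tr2_power_Suc_Suc:
  assumes "det2 A = 1"
  shows "tr2 (A ^ Suc (Suc n)) = tr2 A * tr2 (A ^ Suc n) - tr2 (A ^ n)"
proof -
  have "tr2 (A * A * B) = tr2 A * tr2 (A * B) - tr2 B" for B
    using assms by (simp add: tr2_def det2_def) algebra
  from this[of "A ^ n"] show ?thesis by (simp add: mult.assoc)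
qed

text \<open>The recursion subtracts the trace two steps back, so the ratio bound has to be carried
  through the induction: it makes the moduli increase, and (2 + 2k) t(n+1) <= t(n+2) + t(n) then
  leaves a factor of at least 1 + k.\<close>

lemma tr2_power_growth:
  assumes d: "det2 A = 1" and k: "0 \<le> k" "2 + 2 * k \<le> \<bar>tr2 A\<bar>"
  shows "2 * (1 + k) ^ n \<le> \<bar>tr2 (A ^ n)\<bar> \<and> (1 + k) * \<bar>tr2 (A ^ n)\<bar> \<le> \<bar>tr2 (A ^ Suc n)\<bar>"
proof (induction n)
  case 0
  show ?case using k by simp
next
  case (Suc n)
  let ?t = "\<lambda>n. \<bar>tr2 (A ^ n)\<bar>"
  have le: "?t n \<le> ?t (Suc n)"
  proof -
    have "1 * ?t n \<le> (1 + k) * ?t n" using k by (intro mult_right_mono) auto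
    then show ?thesis using Suc by linarith
  qed
  have "2 * (1 + k) ^ Suc n = (1 + k) * (2 * (1 + k) ^ n)" by simp
  also have "\<dots> \<le> (1 + k) * ?t n" using Suc k by (intro mult_left_mono) auto
  also have "\<dots> \<le> ?t (Suc n)" using Suc by simp
  finally have 1: "2 * (1 + k) ^ Suc n \<le> ?t (Suc n)" .
  have "(2 + 2 * k) * ?t (Suc n) \<le> \<bar>tr2 A\<bar> * ?t (Suc n)" using k by (intro mult_right_mono) auto
  also have "\<dots> = \<bar>tr2 A * tr2 (A ^ Suc n)\<bar>" by (simp add: abs_mult)
  also have "\<dots> \<le> ?t (Suc (Suc n)) + ?t n"
    unfolding tr2_power_Suc_Suc[OF d] by simp
  finally have "(1 + k) * ?t (Suc n) \<le> ?t (Suc (Suc n))"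
    using le mult_nonneg_nonneg[OF k(1) abs_ge_zero[of "tr2 (A ^ Suc n)"]]
    by (simp only: distrib_right mult_2 mult_1)
  with 1 show ?case by simp
qed

text \<open>Twice the cosine of a multiple angle satisfies the same recursion with the same initial
  values.\<close>

lemma tr2_power_cos:
  assumes "det2 A = 1" "tr2 A = 2 * cos \<theta>"
  shows "tr2 (A ^ n) = 2 * cos (real n * \<theta>)"
proof (induction n rule: less_induct)
  case (less n)
  consider "n = 0" | "n = 1" | m where "n = Suc (Suc m)"
    by (metis One_nat_def not0_implies_Suc)
  then show ?case
  proof cases
    case 3
    have "tr2 (A ^ n) = 2 * cos \<theta> * (2 * cos (real (Suc m) * \<theta>)) - 2 * cos (real m * \<theta>)"
      using less[of m] less[of "Suc m"] 3 assms tr2_power_Suc_Suc[OF assms(1), of m] by simp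
    also have "\<dots> = 2 * cos (real n * \<theta>)"
    proof -
      have "cos (real n * \<theta>) + cos (real m * \<theta>) = 2 * cos (real (Suc m) * \<theta>) * cos \<theta>"
        using cos_plus_cos[of "real n * \<theta>" "real m * \<theta>"]
        by (simp add: 3 add_divide_distrib algebra_simps)
      then show ?thesis by (simp add: algebra_simps)
    qed
    finally show ?thesis .
  qed (use assms in auto)
qed

definition step2 :: "real \<Rightarrow> mat2" where "step2 x = Mat2 x (- 1) 1 0"

lemma step2_sel [simp]: "m11 (step2 x) = x" "m12 (step2 x) = - 1" "m21 (step2 x) = 1" "m22 (step2 x) = 0"
  by (simp_all add: step2_def)
lemma det2_step2 [simp]: "det2 (step2 x) = 1" by (simp add: det2_def)
lemma nm2_step2: "nm2 (step2 x) = \<bar>x\<bar> + 2" by (simp add: nm2_def)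

text \<open>For a solution of u(i+1) + u(i-1) = b(i) u(i) this matrix takes (u(j), u(j-1)) to
  (u(j+n), u(j+n-1)). In use \<open>b\<close> is the energy minus the potential.\<close>

primrec tm :: "(int \<Rightarrow> real) \<Rightarrow> int \<Rightarrow> nat \<Rightarrow> mat2" where
  "tm b j 0 = 1"
| "tm b j (Suc n) = step2 (b (j + int n)) * tm b j n"

lemma det2_tm [simp]: "det2 (tm b j n) = 1"
  by (induction n) (simp_all add: det2_mult)

lemma tm_add: "tm b j (m + n) = tm b (j + int m) n * tm b j m"
  by (induction n) (simp_all add: algebra_simps)

lemma tm_cong: "(\<And>i. j \<le> i \<Longrightarrow> i < j + int n \<Longrightarrow> b i = c i) \<Longrightarrow> tm b j n = tm c j n"
  by (induction n) simp_all

lemma tm_translate: "tm (\<lambda>i. b (i + m)) j n = tm b (j + m) n"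
  by (induction n) (simp_all add: algebra_simps)

lemma periodic_int_mult:
  assumes "\<And>n. V (n + q) = V n" 
  shows "V (n + q * k) = V (n::int)"
proof (induction k rule: int_induct[where k = 0])
  case (step1 k)
  then show ?case using assms[of "n + q * k"] by (simp add: algebra_simps)
next
  case (step2 k)
  then show ?case using assms[of "n + q * (k - 1)"] by (simp add: algebra_simps)
qed simp_all

lemma periodic_mod:
  assumes "\<And>n. V (n + q) = V n"
  shows "V (n mod q) = V (n::int)"
  using periodic_int_mult[of V q "n mod q" "n div q", OF assms] by simp

lemma tm_periodic:
  assumes "\<And>n. b (n + int q) = b n"
  shows "tm b (j + int q * k) n = tm b j n"
proof -
  have "tm b (j + int q * k) n = tm (\<lambda>i. b (i + int q * k)) j n"
    by (simp add: tm_translate)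
  also have "\<dots> = tm b j n" using periodic_int_mult[of b "int q"] assms by simp
  finally show ?thesis .
qed

text \<open>Moving the starting site by one conjugates the period matrix by a one-step
  matrix.\<close>

lemma tr2_tm_shift:
  assumes "\<And>n. b (n + int q) = b n"
  shows "tr2 (tm b j q) = tr2 (tm b 0 q)"
proof -
  have *: "tr2 (tm b (j + 1) q) = tr2 (tm b j q)" for j
  proof -
    have "tm b (j + 1) q * step2 (b j) = tm b j (Suc q)"
      using tm_add[of b j 1 q] by simp
    also have "\<dots> = step2 (b j) * tm b j q" using assms by simp
    finally have eq: "tm b (j + 1) q * step2 (b j) = step2 (b j) * tm b j q" .
    \<comment> \<open>The inverse of the one-step matrix, that is, its adjugate.\<close>
    define R where "R = Mat2 0 1 (- 1) (b j)"
    have R: "step2 (b j) * R = 1"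
      by (simp add: R_def step2_def times_mat2_def one_mat2_def)
    have R': "R * step2 (b j) = 1"
      by (simp add: R_def step2_def times_mat2_def one_mat2_def)
    have "tm b (j + 1) q = step2 (b j) * tm b j q * R"
      using R eq by (metis mult.assoc mult.right_neutral)
    then have "tr2 (tm b (j + 1) q) = tr2 (R * (step2 (b j) * tm b j q))"
      by (simp add: tr2_mult_commute)
    then show ?thesis using R' by (metis mult.assoc mult_1)
  qed
  show ?thesis
  proof (induction j rule: int_induct[where k = 0])
    case (step1 i) then show ?case using *[of i] by simp
  next
    case (step2 i) then show ?case using *[of "i - 1"] by simp
  qed simp
qed

lemma tm_power:
  assumes "\<And>n. b (n + int q) = b n"
  shows "tm b j (n * q) = tm b j q ^ n"
proof (induction n)
  case (Suc n)
  have "tm b j (Suc n * q) = tm b (j + int (n * q)) q * tm b j (n * q)"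
    by (metis add.commute mult_Suc tm_add)
  also have "tm b (j + int (n * q)) q = tm b j q"
    using tm_periodic[of b q j "int n" q] assms by (simp add: mult.commute)
  finally show ?case using Suc by simp
qed simp

lemma nm2_tm_le:
  assumes "\<And>i. \<bar>b i\<bar> \<le> X"
  shows "nm2 (tm b j n) \<le> 2 * (X + 2) ^ n"
proof (induction n)
  case (Suc n)
  have "0 \<le> X" using assms[of 0] by linarith
  have "nm2 (tm b j (Suc n)) \<le> nm2 (step2 (b (j + int n))) * nm2 (tm b j n)"
    by (simp add: nm2_mult_le)
  also have "\<dots> \<le> (X + 2) * (2 * (X + 2) ^ n)"
    using Suc assms[of "j + int n"] \<open>0 \<le> X\<close> by (intro mult_mono) (auto simp: nm2_step2)
  finally show ?case by simp
qed simp

section \<open>Stability of transfer matrices and approximate solutions\<close>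

definition diff2 :: "mat2 \<Rightarrow> mat2 \<Rightarrow> real" where
  "diff2 A B = \<bar>m11 A - m11 B\<bar> + \<bar>m12 A - m12 B\<bar> + \<bar>m21 A - m21 B\<bar> + \<bar>m22 A - m22 B\<bar>"

lemma nm2_le_diff2: "nm2 A \<le> nm2 B + diff2 A B"
proof -
  have e: "\<bar>x\<bar> \<le> \<bar>y\<bar> + \<bar>x - y\<bar>" for x y :: real by simp
  show ?thesis
    unfolding nm2_def diff2_def
    using add_mono[OF add_mono[OF add_mono[OF e[of "m11 A" "m11 B"] e[of "m12 A" "m12 B"]]
      e[of "m21 A" "m21 B"]] e[of "m22 A" "m22 B"]]
    by (simp only: add_ac)
qed

text \<open>Telescoping: each of the \<open>n\<close> factors is exchanged once at cost
  \<open>d\<close>, the other factors contribute at most \<open>X + 2\<close> each, and the 2 is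
  \<open>nm2 1\<close>.\<close>

lemma diff2_tm_le:
  assumes b: "\<And>i. \<bar>b i\<bar> \<le> X" and c: "\<And>i. \<bar>c i\<bar> \<le> X" and d: "\<And>i. \<bar>b i - c i\<bar> \<le> d"
  shows "diff2 (tm b j n) (tm c j n) \<le> 2 * real n * (X + 2) ^ n * d"
proof (induction n)
  case 0
  show ?case by (simp add: diff2_def)
next
  case (Suc n)
  have X: "0 \<le> X" and d0: "0 \<le> d" using assms[of 0] by linarith+
  define A where "A = tm b j n"
  define B where "B = tm c j n"
  define x where "x = b (j + int n)"
  define y where "y = c (j + int n)"
  have xy: "\<bar>x\<bar> \<le> X" "\<bar>x - y\<bar> \<le> d" using b d by (auto simp: x_def y_def)
  have e: "\<bar>(x * p - u) - (y * q - v)\<bar> \<le> \<bar>x\<bar> * \<bar>p - q\<bar> + \<bar>u - v\<bar> + \<bar>x - y\<bar> * \<bar>q\<bar>" for p q u v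
  proof -
    have eq: "(x * p - u) - (y * q - v) = x * (p - q) - (u - v) + (x - y) * q" by (simp add: algebra_simps)
    have "\<bar>(x * p - u) - (y * q - v)\<bar> \<le> \<bar>x * (p - q) - (u - v)\<bar> + \<bar>(x - y) * q\<bar>"
      unfolding eq by (rule abs_triangle_ineq)
    then show ?thesis
      using
        abs_triangle_ineq4[of "x * (p - q)" "u - v"]
      unfolding abs_mult[symmetric] by linarith
  qed
  have "diff2 (step2 x * A) (step2 y * B) \<le>
     (\<bar>x\<bar> * \<bar>m11 A - m11 B\<bar> + \<bar>m21 A - m21 B\<bar> + \<bar>x - y\<bar> * \<bar>m11 B\<bar>)
     + (\<bar>x\<bar> * \<bar>m12 A - m12 B\<bar> + \<bar>m22 A - m22 B\<bar> + \<bar>x - y\<bar> * \<bar>m12 B\<bar>)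
     + \<bar>m11 A - m11 B\<bar> + \<bar>m12 A - m12 B\<bar>"
    unfolding diff2_def mat2_times_sel step2_sel
    by (intro add_mono order.trans[OF _ e]) simp_all
  also have "\<dots> = (\<bar>x\<bar> + 1) * (\<bar>m11 A - m11 B\<bar> + \<bar>m12 A - m12 B\<bar>) + (\<bar>m21 A - m21 B\<bar> + \<bar>m22 A - m22 B\<bar>)
      + \<bar>x - y\<bar> * (\<bar>m11 B\<bar> + \<bar>m12 B\<bar>)" by (simp add: algebra_simps)
  also have "\<dots> \<le> (X + 2) * (\<bar>m11 A - m11 B\<bar> + \<bar>m12 A - m12 B\<bar>) + (X + 2) * (\<bar>m21 A - m21 B\<bar> + \<bar>m22 A - m22 B\<bar>)
      + d * nm2 B"
  proof (intro add_mono mult_mono)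
    show "\<bar>m21 A - m21 B\<bar> + \<bar>m22 A - m22 B\<bar> \<le> (X + 2) * (\<bar>m21 A - m21 B\<bar> + \<bar>m22 A - m22 B\<bar>)"
      using X by (simp add: mult_le_cancel_right1)
  qed (use X xy d0 in \<open>auto simp: nm2_def\<close>)
  also have "\<dots> = (X + 2) * diff2 A B + d * nm2 B"
    by (simp add: diff2_def algebra_simps)
  also have "\<dots> \<le> (X + 2) * (2 * real n * (X + 2) ^ n * d) + d * (2 * (X + 2) ^ n)"
    using Suc X d0 nm2_tm_le[of c X, OF c] by (intro add_mono mult_left_mono) (auto simp: A_def B_def)
  also have "\<dots> \<le> (X + 2) * (2 * real n * (X + 2) ^ n * d) + d * (2 * (X + 2) ^ Suc n)"
    using X d0 by (intro add_mono mult_left_mono) (auto simp: mult_le_cancel_right1)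
  also have "\<dots> = 2 * real (Suc n) * (X + 2) ^ Suc n * d" by (simp add: algebra_simps)
  finally show ?case by (simp add: A_def B_def x_def y_def)
qed

text \<open>Variation of constants: \<open>psi\<close> is the defect of \<open>x\<close> as a
  solution, and the defect at each site is carried to the end of the block by the remaining one-step
  matrices, each enlarging it by at most \<open>X + 2\<close>.\<close>

lemma tm_approx_solution:
  fixes x b :: "int \<Rightarrow> real"
  defines "psi \<equiv> \<lambda>n. x (n + 1) + x (n - 1) - b n * x n"
  assumes b: "\<And>i. \<bar>b i\<bar> \<le> X"
  shows "\<bar>x (j + int n) - (m11 (tm b j n) * x j + m12 (tm b j n) * x (j - 1))\<bar>
       + \<bar>x (j + int n - 1) - (m21 (tm b j n) * x j + m22 (tm b j n) * x (j - 1))\<bar>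
       \<le> (X + 2) ^ n * (\<Sum>i<n. \<bar>psi (j + int i)\<bar>)"
proof (induction n)
  case (Suc n)
  have X: "0 \<le> X" using b[of 0] by linarith
  define e1 where "e1 = x (j + int n) - (m11 (tm b j n) * x j + m12 (tm b j n) * x (j - 1))"
  define e2 where "e2 = x (j + int n - 1) - (m21 (tm b j n) * x j + m22 (tm b j n) * x (j - 1))"
  define S where "S = (\<Sum>i<n. \<bar>psi (j + int i)\<bar>)"
  have IH: "\<bar>e1\<bar> + \<bar>e2\<bar> \<le> (X + 2) ^ n * S" using Suc unfolding e1_def e2_def S_def .
  have n1: "x (j + int (Suc n)) - (m11 (tm b j (Suc n)) * x j + m12 (tm b j (Suc n)) * x (j - 1))
     = b (j + int n) * e1 - e2 + psi (j + int n)"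
    unfolding e1_def e2_def psi_def by (simp add: algebra_simps)
  have n2: "x (j + int (Suc n) - 1) - (m21 (tm b j (Suc n)) * x j + m22 (tm b j (Suc n)) * x (j - 1)) = e1"
    unfolding e1_def by simp
  have "\<bar>b (j + int n) * e1 - e2 + psi (j + int n)\<bar> \<le> \<bar>b (j + int n) * e1\<bar> + \<bar>e2\<bar> + \<bar>psi (j + int n)\<bar>"
    by linarith
  moreover have "\<bar>b (j + int n) * e1\<bar> \<le> X * \<bar>e1\<bar>"
    using b by (simp add: abs_mult mult_right_mono)
  ultimately have "\<bar>b (j + int n) * e1 - e2 + psi (j + int n)\<bar> + \<bar>e1\<bar> \<le> (X + 1) * \<bar>e1\<bar> + \<bar>e2\<bar> + \<bar>psi (j + int n)\<bar>"
    by (simp add: algebra_simps)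
  also have "\<dots> \<le> (X + 2) * \<bar>e1\<bar> + (X + 2) * \<bar>e2\<bar> + (X + 2) ^ Suc n * \<bar>psi (j + int n)\<bar>"
  proof (intro add_mono mult_right_mono)
    show "\<bar>e2\<bar> \<le> (X + 2) * \<bar>e2\<bar>" using X by (simp add: mult_le_cancel_right1)
    have "1 \<le> (X + 2) ^ Suc n" using X by (intro one_le_power) auto
    then show "\<bar>psi (j + int n)\<bar> \<le> (X + 2) ^ Suc n * \<bar>psi (j + int n)\<bar>"
      by (metis abs_ge_zero mult_right_mono mult_1)
  qed auto
  also have "\<dots> \<le> (X + 2) * ((X + 2) ^ n * S) + (X + 2) ^ Suc n * \<bar>psi (j + int n)\<bar>"
    using mult_left_mono[OF IH, of "X + 2"] X by (simp add: distrib_left)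
  also have "\<dots> = (X + 2) ^ Suc n * (\<Sum>i<Suc n. \<bar>psi (j + int i)\<bar>)"
    by (simp add: S_def algebra_simps)
  finally show ?case unfolding n1 n2 .
qed simp

text \<open>For an exact solution this is M + M^-1 = tr M, applied to the pair at site
  \<open>n\<close> and read in the first component. In general the errors of the block ending at
  \<open>n\<close> and of the block starting there are added.\<close>

lemma periodic_difference_bound_real:
  fixes x b :: "int \<Rightarrow> real"
  defines "psi \<equiv> \<lambda>n. x (n + 1) + x (n - 1) - b n * x n"
  assumes b: "\<And>i. \<bar>b i\<bar> \<le> X" and per: "\<And>n. b (n + int q) = b n"
  shows "\<bar>x (n + int q) + x (n - int q) - tr2 (tm b 0 q) * x n\<bar>
       \<le> 3 * (X + 2) ^ (2 * q) * (\<Sum>i<2 * q. \<bar>psi (n - int q + int i)\<bar>)"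
proof -
  have X: "0 \<le> X" using b[of 0] by linarith
  define M where "M = tm b n q"
  have M': "tm b (n - int q) q = M"
    using tm_periodic[of b q "n - int q" 1 q, OF per] by (simp add: M_def)
  have D: "tr2 (tm b 0 q) = tr2 M" using tr2_tm_shift[of b q n, OF per] by (simp add: M_def)
  have dM: "m11 M * m22 M - m12 M * m21 M = 1" using det2_tm[of b n q] by (simp add: M_def det2_def)
  define S1 where "S1 = (\<Sum>i<q. \<bar>psi (n + int i)\<bar>)"
  define S0 where "S0 = (\<Sum>i<q. \<bar>psi (n - int q + int i)\<bar>)"
  have S: "(\<Sum>i<2 * q. \<bar>psi (n - int q + int i)\<bar>) = S0 + S1"
  proof -
    have "(\<Sum>i<2 * q. \<bar>psi (n - int q + int i)\<bar>) = S0 + (\<Sum>i\<in>{q..<q+q}. \<bar>psi (n - int q + int i)\<bar>)"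
      unfolding S0_def lessThan_atLeast0 mult_2 by (subst sum.atLeastLessThan_concat) auto
    also have "(\<Sum>i\<in>{q..<q+q}. \<bar>psi (n - int q + int i)\<bar>) = S1"
      unfolding S1_def lessThan_atLeast0
      using sum.shift_bounds_nat_ivl[of "\<lambda>i. \<bar>psi (n - int q + int i)\<bar>" 0 q q] by simp
    finally show ?thesis .
  qed
  have S01: "0 \<le> S0" "0 \<le> S1" by (auto simp: S0_def S1_def intro!: sum_nonneg)
  define e1 where "e1 = x (n + int q) - (m11 M * x n + m12 M * x (n - 1))"
  define f1 where "f1 = x n - (m11 M * x (n - int q) + m12 M * x (n - int q - 1))"
  define f2 where "f2 = x (n - 1) - (m21 M * x (n - int q) + m22 M * x (n - int q - 1))"
  have e: "\<bar>e1\<bar> \<le> (X + 2) ^ q * S1"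
    using tm_approx_solution[of b X x n q, OF b] unfolding e1_def M_def S1_def psi_def by linarith
  have f: "\<bar>f1\<bar> + \<bar>f2\<bar> \<le> (X + 2) ^ q * S0"
    using tm_approx_solution[of b X x "n - int q" q, OF b] M'
    unfolding f1_def f2_def S0_def psi_def by simp
  \<comment> \<open>A row of the adjugate of \<open>M\<close> recovers the value one period earlier
    from the values at \<open>n\<close> and \<open>n - 1\<close>.\<close>
  have "x (n - int q) = (m11 M * m22 M - m12 M * m21 M) * x (n - int q)" by (simp add: dM)
  also have "\<dots> = m22 M * (x n - f1) - m12 M * (x (n - 1) - f2)"
    by (simp add: f1_def f2_def algebra_simps)
  finally have "x (n + int q) + x (n - int q) - tr2 M * x n = e1 - m22 M * f1 + m12 M * f2"
    by (simp add: e1_def tr2_def algebra_simps)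
  then have "\<bar>x (n + int q) + x (n - int q) - tr2 M * x n\<bar> \<le> \<bar>e1\<bar> + \<bar>m22 M * f1\<bar> + \<bar>m12 M * f2\<bar>"
    by linarith
  also have "\<dots> \<le> \<bar>e1\<bar> + nm2 M * \<bar>f1\<bar> + nm2 M * \<bar>f2\<bar>"
    unfolding abs_mult by (intro add_mono mult_right_mono abs_entry_le_nm2) auto
  also have "\<dots> = \<bar>e1\<bar> + nm2 M * (\<bar>f1\<bar> + \<bar>f2\<bar>)" by (simp add: algebra_simps)
  also have "\<dots> \<le> (X + 2) ^ q * S1 + (2 * (X + 2) ^ q) * ((X + 2) ^ q * S0)"
    using nm2_tm_le[of b X n q, OF b] X S01 by (intro add_mono e mult_mono f) (auto simp: M_def)
  also have "\<dots> \<le> 3 * (X + 2) ^ (2 * q) * S1 + 3 * (X + 2) ^ (2 * q) * S0"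
  proof -
    have p: "(X + 2) ^ (2 * q) = (X + 2) ^ q * (X + 2) ^ q" by (simp add: mult_2 power_add)
    have 1: "1 \<le> (X + 2) ^ q" using X by (intro one_le_power) auto
    have "(X + 2) ^ q \<le> (X + 2) ^ q * (X + 2) ^ q"
      using mult_left_mono[OF 1, of "(X + 2) ^ q"] 1 by simp
    then have "(X + 2) ^ q * S1 \<le> (X + 2) ^ (2 * q) * S1" using S01 p by (simp add: mult_right_mono)
    moreover have "0 \<le> (X + 2) ^ (2 * q) * S1" "0 \<le> (X + 2) ^ (2 * q) * S0" using X S01 by auto
    ultimately show ?thesis unfolding p by (simp add: algebra_simps)
  qed
  finally show ?thesis unfolding D S by (simp add: algebra_simps)
qed

text \<open>The matrices are real, so real and imaginary parts are treated separately; this turns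
  the constant 3 into 6.\<close>

lemma periodic_difference_bound:
  fixes x :: "int \<Rightarrow> complex" and b :: "int \<Rightarrow> real"
  defines "psi \<equiv> \<lambda>n. x (n + 1) + x (n - 1) - of_real (b n) * x n"
  assumes b: "\<And>i. \<bar>b i\<bar> \<le> X" and per: "\<And>n. b (n + int q) = b n"
  shows "cmod (x (n + int q) + x (n - int q) - of_real (tr2 (tm b 0 q)) * x n)
       \<le> 6 * (X + 2) ^ (2 * q) * (\<Sum>i<2 * q. cmod (psi (n - int q + int i)))"
proof -
  let ?C = "3 * (X + 2) ^ (2 * q)"
  have C: "0 \<le> ?C" using b[of 0] by auto
  let ?z = "x (n + int q) + x (n - int q) - of_real (tr2 (tm b 0 q)) * x n"
  have r: "\<bar>Re ?z\<bar> \<le> ?C * (\<Sum>i<2 * q. cmod (psi (n - int q + int i)))"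
  proof -
    have "\<bar>Re ?z\<bar> \<le> ?C * (\<Sum>i<2 * q. \<bar>Re (psi (n - int q + int i))\<bar>)"
      using periodic_difference_bound_real[of b X q "\<lambda>n. Re (x n)" n, OF b per] by (simp add: psi_def)
    also have "\<dots> \<le> ?C * (\<Sum>i<2 * q. cmod (psi (n - int q + int i)))"
      using C by (intro mult_left_mono sum_mono abs_Re_le_cmod) auto
    finally show ?thesis .
  qed
  have i: "\<bar>Im ?z\<bar> \<le> ?C * (\<Sum>i<2 * q. cmod (psi (n - int q + int i)))"
  proof -
    have "\<bar>Im ?z\<bar> \<le> ?C * (\<Sum>i<2 * q. \<bar>Im (psi (n - int q + int i))\<bar>)"
      using periodic_difference_bound_real[of b X q "\<lambda>n. Im (x n)" n, OF b per] by (simp add: psi_def)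
    also have "\<dots> \<le> ?C * (\<Sum>i<2 * q. cmod (psi (n - int q + int i)))"
      using C by (intro mult_left_mono sum_mono abs_Im_le_cmod) auto
    finally show ?thesis .
  qed
  show ?thesis using r i cmod_le[of ?z] by linarith
qed

section \<open>The derivative of the discriminant\<close>

text \<open>Both parts complete a square. For the second, four times the product of two values of
  the form is the square of a bilinear expression plus the discriminant times the squared
  determinant; then the arithmetic-geometric mean inequality is applied.\<close>

lemma definite_form_bound:
  fixes A B C :: real
  defines "G \<equiv> \<lambda>x y. A * x\<^sup>2 + B * (x * y) + C * y\<^sup>2"
  assumes disc: "0 < 4 * A * C - B\<^sup>2"
  shows "0 \<le> A * G x y"
    and "\<bar>x * v - y * u\<bar> * sqrt (4 * A * C - B\<^sup>2) \<le> \<bar>G x y\<bar> + \<bar>G u v\<bar>"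
proof -
  have pos: "4 * (A * G x y) = (2 * A * x + B * y)\<^sup>2 + (4 * A * C - B\<^sup>2) * y\<^sup>2" for x y
    by (simp add: G_def power2_eq_square algebra_simps)
  show "0 \<le> A * G x y" for x y
    using pos[of x y] disc by (smt (verit) mult_nonneg_nonneg zero_le_power2)
  have "4 * (G x y * G u v) = (2 * A * x * u + B * (x * v + u * y) + 2 * C * y * v)\<^sup>2
      + (4 * A * C - B\<^sup>2) * (x * v - y * u)\<^sup>2"
    by (simp add: G_def power2_eq_square algebra_simps)
  then have "(4 * A * C - B\<^sup>2) * (x * v - y * u)\<^sup>2 \<le> 4 * (G x y * G u v)" by simp
  also have "\<dots> \<le> 4 * (\<bar>G x y\<bar> * \<bar>G u v\<bar>)" by (metis abs_ge_self abs_mult mult_le_cancel_left_pos zero_less_numeral)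
  also have "\<dots> \<le> (\<bar>G x y\<bar> + \<bar>G u v\<bar>)\<^sup>2"
    using zero_le_power2[of "\<bar>G x y\<bar> - \<bar>G u v\<bar>"] by (simp add: power2_eq_square algebra_simps)
  finally have "(\<bar>x * v - y * u\<bar> * sqrt (4 * A * C - B\<^sup>2))\<^sup>2 \<le> (\<bar>G x y\<bar> + \<bar>G u v\<bar>)\<^sup>2"
    using disc by (simp add: power_mult_distrib mult.commute)
  then show "\<bar>x * v - y * u\<bar> * sqrt (4 * A * C - B\<^sup>2) \<le> \<bar>G x y\<bar> + \<bar>G u v\<bar>"
    by (rule power2_le_imp_le) simp
qed

text \<open>In matrix form A_n' = A_n N, where N has rows (P, R) and (-Q, -P). Differentiating the
  factor S_j contributes A_j^-1 S_j^-1 S_j' A_j to N, and since S_j' has a single nonzero entry only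
  the first row of A_j survives in it.\<close>

lemma tm_has_derivative:
  fixes a :: "int \<Rightarrow> real"
  defines "A \<equiv> \<lambda>n E. tm (\<lambda>i. E - a i) 0 n"
  defines "P \<equiv> \<lambda>n E. \<Sum>j<n. m11 (A j E) * m12 (A j E)"
    and "Q \<equiv> \<lambda>n E. \<Sum>j<n. (m11 (A j E))\<^sup>2" and "R \<equiv> \<lambda>n E. \<Sum>j<n. (m12 (A j E))\<^sup>2"
  shows "((\<lambda>E. m11 (A n E)) has_real_derivative (m11 (A n E) * P n E - m12 (A n E) * Q n E)) (at E) \<and>
    ((\<lambda>E. m12 (A n E)) has_real_derivative (m11 (A n E) * R n E - m12 (A n E) * P n E)) (at E) \<and>
    ((\<lambda>E. m21 (A n E)) has_real_derivative (m21 (A n E) * P n E - m22 (A n E) * Q n E)) (at E) \<and>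
    ((\<lambda>E. m22 (A n E)) has_real_derivative (m21 (A n E) * R n E - m22 (A n E) * P n E)) (at E)"
proof (induction n)
  case 0
  show ?case by (simp add: A_def P_def Q_def R_def)
next
  case (Suc n)
  have d: "m11 (A n E) * m22 (A n E) = 1 + m12 (A n E) * m21 (A n E)"
    using det2_tm[of "\<lambda>i. E - a i" 0 n] by (simp add: A_def det2_def)
  have s: "m11 (A (Suc n) E) = (E - a (int n)) * m11 (A n E) - m21 (A n E)"
      "m12 (A (Suc n) E) = (E - a (int n)) * m12 (A n E) - m22 (A n E)"
      "m21 (A (Suc n) E) = m11 (A n E)" "m22 (A (Suc n) E) = m12 (A n E)" for E
    by (simp_all add: A_def)
  have PQR: "P (Suc n) E = P n E + m11 (A n E) * m12 (A n E)" "Q (Suc n) E = Q n E + (m11 (A n E))\<^sup>2"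
    "R (Suc n) E = R n E + (m12 (A n E))\<^sup>2"
    by (simp_all add: P_def Q_def R_def)
  note IH = Suc[THEN conjunct1] Suc[THEN conjunct2, THEN conjunct1]
    Suc[THEN conjunct2, THEN conjunct2, THEN conjunct1] Suc[THEN conjunct2, THEN conjunct2, THEN conjunct2]
  have 1: "((\<lambda>E. m11 (A (Suc n) E)) has_real_derivative (m11 (A (Suc n) E) * P (Suc n) E - m12 (A (Suc n) E) * Q (Suc n) E)) (at E)"
    unfolding s(1) by (rule derivative_eq_intros IH refl)+
      (use d in \<open>simp add: s PQR power2_eq_square\<close>, algebra)
  have 2: "((\<lambda>E. m12 (A (Suc n) E)) has_real_derivative (m11 (A (Suc n) E) * R (Suc n) E - m12 (A (Suc n) E) * P (Suc n) E)) (at E)"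
    unfolding s(2) by (rule derivative_eq_intros IH refl)+
      (use d in \<open>simp add: s PQR power2_eq_square\<close>, algebra)
  have 3: "((\<lambda>E. m21 (A (Suc n) E)) has_real_derivative (m21 (A (Suc n) E) * P (Suc n) E - m22 (A (Suc n) E) * Q (Suc n) E)) (at E)"
    unfolding s(3) using IH(1) by (simp add: s PQR power2_eq_square algebra_simps)
  have 4: "((\<lambda>E. m22 (A (Suc n) E)) has_real_derivative (m21 (A (Suc n) E) * R (Suc n) E - m22 (A (Suc n) E) * P (Suc n) E)) (at E)"
    unfolding s(4) using IH(2) by (simp add: s PQR power2_eq_square algebra_simps)
  show ?case using 1 2 3 4 by blast
qed

text \<open>The derivative of the discriminant \<open>D\<close> is the sum over the sites of one period of a quadratic
  form with discriminant \<open>D\<^sup>2 - 4\<close>, evaluated at the first rows of the transfer matrices. Where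
  \<open>\<bar>D\<bar> < 2\<close> all summands have the same sign, and two of them already dominate the determinant of the
  corresponding rows. The trace of a sub-block is a difference of two such determinants.\<close>

lemma discriminant_derivative_bound:
  fixes a :: "int \<Rightarrow> real" and q :: nat
  defines "A \<equiv> \<lambda>n E. tm (\<lambda>i. E - a i) 0 n"
  defines "D \<equiv> \<lambda>E. tr2 (A q E)"
  obtains D' where "\<And>E. (D has_real_derivative D' E) (at E)"
    and "\<And>E j n. \<bar>D E\<bar> < 2 \<Longrightarrow> 0 < j \<Longrightarrow> 0 < n \<Longrightarrow> j + n < q \<Longrightarrow>
      \<bar>tr2 (tm (\<lambda>i. E - a i) (int j) n)\<bar> / 2 * sqrt (4 - (D E)\<^sup>2) \<le> \<bar>D' E\<bar>"
proof -
  \<comment> \<open>The trace of A_q N, with N as in the derivative formula, is the sum of this form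
    over the first rows of the A_j.\<close>
  define G where "G E x y = (- m12 (A q E)) * x\<^sup>2 + (m11 (A q E) - m22 (A q E)) * (x * y) + m21 (A q E) * y\<^sup>2" for E x y
  define g where "g E j = G E (m11 (A j E)) (m12 (A j E))" for E j
  define D' where "D' E = (\<Sum>j<q. g E j)" for E
  have 1: "(D has_real_derivative D' E) (at E)" for E
  proof -
    let ?P = "\<Sum>j<q. m11 (A j E) * m12 (A j E)" and ?Q = "\<Sum>j<q. (m11 (A j E))\<^sup>2" and ?R = "\<Sum>j<q. (m12 (A j E))\<^sup>2"
    have "(D has_real_derivative (m11 (A q E) * ?P - m12 (A q E) * ?Q) + (m21 (A q E) * ?R - m22 (A q E) * ?P)) (at E)"
      unfolding D_def tr2_def using tm_has_derivative[where n = q and a = a and E = E] unfolding A_def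
      by (intro DERIV_add) blast+
    also have "(m11 (A q E) * ?P - m12 (A q E) * ?Q) + (m21 (A q E) * ?R - m22 (A q E) * ?P) = D' E"
      by (simp add: D'_def g_def G_def sum.distrib sum_distrib_left algebra_simps sum_subtractf sum_negf)
    finally show ?thesis .
  qed
  have 2: "\<bar>tr2 (tm (\<lambda>i. E - a i) (int j) n)\<bar> / 2 * sqrt (4 - (D E)\<^sup>2) \<le> \<bar>D' E\<bar>"
    if "\<bar>D E\<bar> < 2" and jn: "0 < j" "0 < n" "j + n < q" for E j n
  proof -
    let ?B = "m11 (A q E) - m22 (A q E)"
    have "m11 (A q E) * m22 (A q E) - m12 (A q E) * m21 (A q E) = 1"
      using det2_tm[of "\<lambda>i. E - a i" 0 q] by (simp add: A_def det2_def)
    then have disc: "4 * (- m12 (A q E)) * m21 (A q E) - ?B\<^sup>2 = 4 - (D E)\<^sup>2"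
      unfolding D_def tr2_def power2_eq_square by algebra
    have pos: "0 < 4 - (D E)\<^sup>2"
      using that(1) abs_square_less_1[of "D E / 2"] by (simp add: power2_eq_square)
    note F = definite_form_bound[of "- m12 (A q E)" "m21 (A q E)" ?B, unfolded disc, OF pos, folded G_def]
    have sgn: "0 \<le> (- m12 (A q E)) * g E k" for k unfolding g_def by (rule F(1))
    have nz: "m12 (A q E) \<noteq> 0"
    proof
      assume "m12 (A q E) = 0"
      then have "4 - (D E)\<^sup>2 = - (?B\<^sup>2)" using disc by simp
      then show False using pos zero_le_power2[of ?B] by linarith
    qed
    have abs: "\<bar>D' E\<bar> = (\<Sum>j<q. \<bar>g E j\<bar>)"
    proof (cases "m12 (A q E) < 0")
      case True
      then have "0 \<le> g E k" for k using sgn[of k] by (simp add: zero_le_mult_iff mult_le_0_iff)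
      then show ?thesis unfolding D'_def by (simp add: sum_nonneg)
    next
      case False
      with nz have "g E k \<le> 0" for k using sgn[of k] by (simp add: zero_le_mult_iff mult_le_0_iff)
      then have "(\<Sum>j<q. \<bar>g E j\<bar>) = - D' E" unfolding D'_def sum_negf[symmetric] by (intro sum.cong) auto
      moreover have "0 \<le> (\<Sum>j<q. \<bar>g E j\<bar>)" by (intro sum_nonneg) auto
      ultimately show ?thesis by simp
    qed
    let ?w = "\<lambda>k l. m11 (A k E) * m12 (A l E) - m12 (A k E) * m11 (A l E)"
    have W: "\<bar>?w k l\<bar> * sqrt (4 - (D E)\<^sup>2) \<le> \<bar>D' E\<bar>" if "k < q" "l < q" for k l
    proof (cases "k = l")
      case True then show ?thesis by simp
    next
      case False
      have "\<bar>?w k l\<bar> * sqrt (4 - (D E)\<^sup>2) \<le> \<bar>g E k\<bar> + \<bar>g E l\<bar>"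
        unfolding g_def by (rule F(2))
      also have "\<dots> = (\<Sum>j\<in>{k, l}. \<bar>g E j\<bar>)" using False by simp
      also have "\<dots> \<le> (\<Sum>j<q. \<bar>g E j\<bar>)" using that by (intro sum_mono2) auto
      finally show ?thesis using abs by simp
    qed
    \<comment> \<open>The second row of A_j is the first row of A_(j-1). Determinants of first rows
      therefore express the trace of the block, provided that both \<open>j\<close> and
      \<open>n\<close> have predecessors.\<close>
    obtain j' where j': "j = Suc j'" using jn by (cases j) auto
    obtain n' where n': "n = Suc n'" using jn by (cases n) auto
    have "tr2 (tm (\<lambda>i. E - a i) (int j) n) = ?w (j + n) j' - ?w (j + n') j"
    proof -
      let ?T = "tm (\<lambda>i. E - a i) (int j) n"
      have jn: "A (j + n) E = ?T * A j E"
        unfolding A_def using tm_add[of "\<lambda>i. E - a i" 0 j n] by simp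
      have r: "m11 (A (j + n') E) = m21 (A (j + n) E)" "m12 (A (j + n') E) = m22 (A (j + n) E)"
          "m11 (A j' E) = m21 (A j E)" "m12 (A j' E) = m22 (A j E)"
        by (simp_all add: A_def n' j')
      have d: "m11 (A j E) * m22 (A j E) - m12 (A j E) * m21 (A j E) = 1"
        using det2_tm[of "\<lambda>i. E - a i" 0 j] by (simp add: A_def det2_def)
      have "?w (j + n) j' - ?w (j + n') j
        = tr2 ?T * (m11 (A j E) * m22 (A j E) - m12 (A j E) * m21 (A j E))"
        unfolding r jn tr2_def by (simp add: algebra_simps)
      then show ?thesis using d by simp
    qed
    then have "\<bar>tr2 (tm (\<lambda>i. E - a i) (int j) n)\<bar> * sqrt (4 - (D E)\<^sup>2)
       \<le> (\<bar>?w (j + n) j'\<bar> + \<bar>?w (j + n') j\<bar>) * sqrt (4 - (D E)\<^sup>2)"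
      using pos by (intro mult_right_mono) auto
    also have "\<dots> \<le> 2 * \<bar>D' E\<bar>"
      using W[of "j + n" j'] W[of "j + n'" j] jn j' n' by (simp add: distrib_right)
    finally show ?thesis by simp
  qed
  show ?thesis using that[of D'] 1 2 by blast
qed

subsection \<open>Measure of the bands\<close>

text \<open>The upper left entry carries the leading term; the strict bound on the degree of
  \<open>t\<close> keeps the trace monic.\<close>

lemma tm_polynomials:
  fixes a :: "int \<Rightarrow> real"
  shows "\<exists>p r s t. degree p = n \<and> lead_coeff p = 1 \<and> degree r \<le> n \<and> degree s \<le> n \<and> degree t \<le> n
      \<and> (0 < n \<longrightarrow> degree t < n) \<and> (\<forall>E. tm (\<lambda>i. E - a i) 0 n = Mat2 (poly p E) (poly r E) (poly s E) (poly t E))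
      \<and> (0 < n \<longrightarrow> degree s < n)"
proof (induction n)
  case 0
  show ?case
    by (rule exI[of _ 1], rule exI[of _ 0], rule exI[of _ 0], rule exI[of _ 1]) (simp add: one_mat2_def)
next
  case (Suc n)
  then obtain p r s t where p: "degree p = n" "lead_coeff p = 1" and r: "degree r \<le> n" and s: "degree s \<le> n"
      "0 < n \<longrightarrow> degree s < n" and t: "degree t \<le> n"
    and eq: "\<forall>E. tm (\<lambda>i. E - a i) 0 n = Mat2 (poly p E) (poly r E) (poly s E) (poly t E)"
    by (elim exE conjE) (rule that)
  let ?x = "[:- a (int n), 1:]"
  have x: "degree ?x = 1" "?x \<noteq> 0" "lead_coeff ?x = 1" by auto
  have p0: "p \<noteq> 0" using p by auto
  have d1: "degree (?x * p) = Suc n"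
    using p p0 x by (simp add: degree_mult_eq del: mult_pCons_left)
  have d2: "lead_coeff (?x * p) = 1"
    unfolding lead_coeff_mult using p x by simp
  note d = d1 d2
  have "degree s < degree (?x * p)" using s d by simp
  then have p1: "degree (?x * p - s) = Suc n"
    using d1 degree_add_eq_left[of "- s" "?x * p"] by (simp del: mult_pCons_left)
  have "coeff s (Suc n) = 0" using s by (simp add: coeff_eq_0)
  then have p2: "lead_coeff (?x * p - s) = 1"
    using d1 d2 unfolding p1 by (simp del: mult_pCons_left)
  note p' = p1 p2
  have r': "degree (?x * r - t) \<le> Suc n"
  proof (rule degree_diff_le)
    show "degree (?x * r) \<le> Suc n" using degree_mult_le[of ?x r] r x by simp
  qed (use t in simp)
  show ?case
    by (rule exI[of _ "?x * p - s"], rule exI[of _ "?x * r - t"], rule exI[of _ p], rule exI[of _ r])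
      (use p' r' p r in \<open>auto simp: eq step2_def times_mat2_def algebra_simps\<close>)
qed

lemma discriminant_polynomial:
  fixes a :: "int \<Rightarrow> real"
  assumes "0 < n"
  obtains p where "degree p = n" "lead_coeff p = 1" "\<And>E. tr2 (tm (\<lambda>i. E - a i) 0 n) = poly p E"
proof -
  obtain p r s t where p: "degree p = n" "lead_coeff p = 1" "degree t < n"
    "\<And>E. tm (\<lambda>i. E - a i) 0 n = Mat2 (poly p E) (poly r E) (poly s E) (poly t E)"
    using tm_polynomials[of n a] assms by metis
  show ?thesis
    by (rule that[of "p + t"]) (use p in \<open>auto simp: tr2_def degree_add_eq_left coeff_eq_0\<close>)
qed

text \<open>The modulus of a monic polynomial is the product of the distances to its complex roots.
  Projecting the roots to the real axis does not increase these distances, so a point farther than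
  \<open>h\<close> from all real parts has a value above \<open>h ^ q\<close>.\<close>

lemma small_value_near_root:
  fixes p :: "real poly"
  assumes "degree p = q" "0 < q" "lead_coeff p = 1" "0 \<le> h"
  obtains Z :: "real set" where "finite Z" "card Z \<le> q"
    "\<And>E. \<bar>poly p E\<bar> \<le> h ^ q \<Longrightarrow> \<exists>z\<in>Z. \<bar>E - z\<bar> \<le> h"
proof -
  define P where "P = map_poly complex_of_real p"
  have dP: "degree P = q" using assms by (simp add: P_def degree_map_poly)
  have lP: "lead_coeff P = 1" using assms dP by (simp add: P_def coeff_map_poly)
  obtain root where root: "smult (lead_coeff P) (\<Prod>i<degree P. [:-root i, 1:]) = P"
    by (rule complex_poly_decompose')
  have val: "\<bar>poly p E\<bar> = (\<Prod>i<q. cmod (of_real E - root i))" for E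
  proof -
    have "poly P (of_real E) = of_real (poly p E)"
      unfolding P_def by (induction p) (auto simp: map_poly_pCons)
    moreover have "poly P (of_real E) = (\<Prod>i<q. of_real E - root i)"
      by (subst root[symmetric]) (use lP in \<open>simp add: dP poly_prod\<close>)
    ultimately have "complex_of_real (poly p E) = (\<Prod>i<q. of_real E - root i)" by simp
    then have "cmod (of_real (poly p E)) = cmod (\<Prod>i<q. of_real E - root i)" by simp
    then show ?thesis by (simp add: prod_norm)
  qed
  let ?Z = "(\<lambda>i. Re (root i)) ` {..<q}"
  have "\<exists>z\<in>?Z. \<bar>E - z\<bar> \<le> h" if "\<bar>poly p E\<bar> \<le> h ^ q" for E
  proof (rule ccontr)
    assume neg: "\<not> (\<exists>z\<in>?Z. \<bar>E - z\<bar> \<le> h)"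
    have gt: "h < cmod (of_real E - root i)" if "i < q" for i
    proof -
      have "h < \<bar>E - Re (root i)\<bar>" using neg that by (fastforce simp: not_le)
      also have "\<dots> \<le> cmod (of_real E - root i)"
        using abs_Re_le_cmod[of "of_real E - root i"] by simp
      finally show ?thesis .
    qed
    have "(\<Prod>i<q. h) < (\<Prod>i<q. cmod (of_real E - root i))"
    proof (rule prod_mono_strict[of 0])
      show "0 < cmod (of_real E - root i)" if "i \<in> {..<q}" for i
        using gt[of i] that assms(4) by (simp del: zero_less_norm_iff)
    qed (use assms gt in \<open>auto intro: less_imp_le\<close>)
    then show False using val[of E] that by simp
  qed
  moreover have "card ?Z \<le> q" using card_image_le[of "{..<q}"] by simp
  ultimately show ?thesis using that[of ?Z] by blast
qed

text \<open>As long as 0 < D < 2, the function arcsin (D/2) has a derivative of modulus at least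
  \<open>B\<close>. Over a length \<open>h\<close> it would change by at least pi, although it stays
  in [0, pi/2]. The decrease at \<open>x\<close> keeps \<open>D\<close> from escaping through
  2.\<close>

lemma no_zero_contradiction:
  fixes D D' :: "real \<Rightarrow> real"
  assumes der: "\<And>E. (D has_real_derivative D' E) (at E)"
    and x: "0 < D x" "D x < 2" "D' x < 0" and h: "0 < h" "pi \<le> B * h"
    and nz: "\<And>y. x \<le> y \<Longrightarrow> y \<le> x + h \<Longrightarrow> D y \<noteq> 0" and B: "0 < B"
    and bnd: "\<And>y. x \<le> y \<Longrightarrow> y \<le> x + h \<Longrightarrow> \<bar>D y\<bar> < 2 \<Longrightarrow> B * sqrt (4 - (D y)\<^sup>2) \<le> \<bar>D' y\<bar>"
  shows False
proof -
  have cont: "isCont D y" for y using der by (rule DERIV_isCont)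
  have pos: "0 < D y" if y: "x \<le> y" "y \<le> x + h" for y
  proof (rule ccontr)
    assume "\<not> 0 < D y"
    then obtain z where "x \<le> z" "z \<le> y" "D z = 0"
      using IVT2[of D y 0 x] x y cont by auto
    then show False using nz y by force
  qed
  have rt: "0 < B * sqrt (4 - (D y)\<^sup>2)" if "0 < D y" "D y < 2" for y
    using that B abs_square_less_1[of "D y / 2"] by (simp add: power2_eq_square)
  \<comment> \<open>Otherwise a minimum over [x, y] would be interior: a critical point with 0 < D <
    2, where the lower bound on |D'| is positive.\<close>
  have less: "D y < D x" if y: "x < y" "y \<le> x + h" for y
  proof (rule ccontr)
    assume ge: "\<not> D y < D x"
    obtain d where d: "0 < d" "\<And>e. 0 < e \<Longrightarrow> e < d \<Longrightarrow> D (x + e) < D x"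
      using DERIV_neg_dec_right[OF der x(3)] by blast
    define e where "e = min (d / 2) ((y - x) / 2)"
    have "0 < e" using d(1) y by (simp add: e_def)
    moreover have "e \<le> d / 2" "e \<le> (y - x) / 2"
      unfolding e_def by (rule min.cobounded1, rule min.cobounded2)
    ultimately have e: "0 < e" "e < d" "x + e < y" using d(1) y by (simp_all add: field_simps)
    then have De: "D (x + e) < D x" using d(2) by blast
    obtain m where m: "x \<le> m" "m \<le> y" "\<And>z. x \<le> z \<Longrightarrow> z \<le> y \<Longrightarrow> D m \<le> D z"
      using isCont_eq_Lb[of x y D] y cont by force
    have Dm: "D m < D x" using m(3)[of "x + e"] e De by simp
    then have mxy: "x < m" "m < y" using m ge by (auto simp: less_le)
    have "D' m = 0"
    proof (rule DERIV_local_min[OF der])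
      show "0 < min (m - x) (y - m)" using mxy by simp
      show "\<forall>z. \<bar>m - z\<bar> < min (m - x) (y - m) \<longrightarrow> D m \<le> D z"
        using m(3) by (auto simp: abs_if split: if_splits)
    qed
    moreover have "B * sqrt (4 - (D m)\<^sup>2) \<le> \<bar>D' m\<bar>"
      using bnd[of m] mxy y Dm x pos[of m] by simp
    ultimately show False using rt[of m] pos[of m] mxy y Dm x by simp
  qed
  have r: "0 < D y \<and> D y < 2" if "x \<le> y" "y \<le> x + h" for y
    using pos[OF that] less[of y] that x by (cases "y = x") auto
  define g where "g y = arcsin (D y / 2)" for y
  have gder: "(g has_real_derivative D' y / sqrt (4 - (D y)\<^sup>2)) (at y)" if "x \<le> y" "y \<le> x + h" for y
  proof -
    have "sqrt (4 - (D y)\<^sup>2) = 2 * sqrt (1 - (D y / 2)\<^sup>2)"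
    proof -
      have "4 - (D y)\<^sup>2 = 4 * (1 - (D y / 2)\<^sup>2)" by (simp add: power2_eq_square)
      then show ?thesis by (simp only: real_sqrt_mult) simp
    qed
    then have "inverse (sqrt (1 - (D y / 2)\<^sup>2)) * (D' y / 2) = D' y / sqrt (4 - (D y)\<^sup>2)"
      by (simp add: field_simps)
    moreover have "(g has_real_derivative inverse (sqrt (1 - (D y / 2)\<^sup>2)) * (D' y / 2)) (at y)"
      unfolding g_def using r[OF that]
      by (intro DERIV_chain2[OF DERIV_arcsin] DERIV_cdivide der) auto
    ultimately show ?thesis by simp
  qed
  obtain z where z: "x < z" "z < x + h" "g (x + h) - g x = (x + h - x) * (D' z / sqrt (4 - (D z)\<^sup>2))"
    using MVT2[of x "x + h" g "\<lambda>y. D' y / sqrt (4 - (D y)\<^sup>2)"] h gder by force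
  have "0 < sqrt (4 - (D z)\<^sup>2)"
    using rt[of z] r[of z] z B by (simp add: zero_less_mult_iff)
  then have "B \<le> \<bar>D' z / sqrt (4 - (D z)\<^sup>2)\<bar>"
    using bnd[of z] r[of z] z by (simp add: abs_divide pos_le_divide_eq)
  then have "pi \<le> h * \<bar>D' z / sqrt (4 - (D z)\<^sup>2)\<bar>"
    using mult_left_mono[of B _ h] h by (metis less_imp_le mult.commute order.trans)
  also have "\<dots> = \<bar>g (x + h) - g x\<bar>" using z h by (simp add: abs_mult)
  finally have "pi \<le> \<bar>g (x + h) - g x\<bar>" .
  moreover
  have "0 \<le> g y \<and> g y \<le> pi / 2" if "x \<le> y" "y \<le> x + h" for y
    unfolding g_def using r[OF that] arcsin_le_arcsin[of 0 "D y / 2"] arcsin_bounded[of "D y / 2"] by auto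
  from this[of x] this[of "x + h"] h have "\<bar>g (x + h) - g x\<bar> \<le> pi / 2" by (auto simp: abs_if field_simps)
  ultimately show False using pi_gt_zero by simp
qed

text \<open>Changing the sign of \<open>D\<close> and reflecting the energy axis reduce everything
  to a positive value with negative derivative.\<close>

lemma zero_near:
  fixes D D' :: "real \<Rightarrow> real"
  assumes der: "\<And>E. (D has_real_derivative D' E) (at E)"
    and x: "\<bar>D x\<bar> < 2" and h: "0 < h" "pi \<le> B * h" and B: "0 < B"
    and bnd: "\<And>y. \<bar>y - x\<bar> \<le> h \<Longrightarrow> \<bar>D y\<bar> < 2 \<Longrightarrow> B * sqrt (4 - (D y)\<^sup>2) \<le> \<bar>D' y\<bar>"
  shows "\<exists>z. \<bar>x - z\<bar> \<le> h \<and> D z = 0"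
proof (rule ccontr)
  assume neg: "\<not> ?thesis"
  have pos: False if der: "\<And>E. (D has_real_derivative D' E) (at E)" and x: "0 < D x" "D x < 2"
    and bnd: "\<And>y. \<bar>y - x\<bar> \<le> h \<Longrightarrow> \<bar>D y\<bar> < 2 \<Longrightarrow> B * sqrt (4 - (D y)\<^sup>2) \<le> \<bar>D' y\<bar>"
    and nz: "\<And>z. \<bar>x - z\<bar> \<le> h \<Longrightarrow> D z \<noteq> 0" for D D' :: "real \<Rightarrow> real"
  proof -
    have "0 < B * sqrt (4 - (D x)\<^sup>2)"
      using x B abs_square_less_1[of "D x / 2"] by (simp add: power2_eq_square)
    then have "D' x \<noteq> 0" using bnd[of x] x h by auto
    then consider "D' x < 0" | "0 < D' x" by linarith
    then show False
    proof cases
      case 1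
      show False
        by (rule no_zero_contradiction[of D D' x h B]) (use 1 der x h B bnd nz in auto)
    next
      case 2
      have der': "((\<lambda>y. D (- y)) has_real_derivative - D' (- y)) (at y)" for y
        using DERIV_chain2[OF der[of "- y"] DERIV_minus[OF DERIV_ident]] by simp
      show False
      proof (rule no_zero_contradiction[of "\<lambda>y. D (- y)" "\<lambda>y. - D' (- y)" "- x" h B])
        show "B * sqrt (4 - (D (- y))\<^sup>2) \<le> \<bar>- D' (- y)\<bar>" if "- x \<le> y" "y \<le> - x + h" "\<bar>D (- y)\<bar> < 2" for y
          using bnd[of "- y"] that by simp
      qed (use 2 der' x h B nz in auto)
    qed
  qed
  have "D x \<noteq> 0" using neg h by force
  then consider "0 < D x" | "D x < 0" by linarith
  then show False
  proof cases
    case 1 then show False using pos[of D D'] der x bnd neg by auto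
  next
    case 2
    show False
      by (rule pos[of "\<lambda>y. - D y" "\<lambda>y. - D' y"]) (use 2 der x bnd neg in \<open>auto intro: DERIV_minus\<close>)
  qed
qed

text \<open>The conclusion supplies a measurable cover because \<open>S\<close> comes without
  measurability.\<close>

lemma emeasure_near_finite_le:
  fixes Z :: "real set"
  assumes "finite Z" "card Z \<le> q" "0 \<le> h" "\<And>E. E \<in> S \<Longrightarrow> \<exists>z\<in>Z. \<bar>E - z\<bar> \<le> h"
  shows "\<exists>W. W \<in> sets lborel \<and> S \<subseteq> W \<and> emeasure lborel W \<le> ennreal (real q * (2 * h))"
proof (intro exI conjI)
  let ?W = "\<Union>z\<in>Z. {z - h..z + h}"
  show "?W \<in> sets lborel" using assms(1) by auto
  show "S \<subseteq> ?W" using assms(4) by (fastforce simp: abs_le_iff)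
  have "emeasure lborel ?W \<le> (\<Sum>z\<in>Z. emeasure lborel {z - h..z + h})"
    using assms(1) by (intro emeasure_subadditive_finite) auto
  also have "\<dots> = (\<Sum>z\<in>Z. ennreal (2 * h))" using assms(3) by simp
  also have "\<dots> = ennreal (real (card Z) * (2 * h))"
    using assms(3) by (simp add: ennreal_mult ennreal_of_nat_eq_real_of_nat)
  also have "\<dots> \<le> ennreal (real q * (2 * h))"
    using assms by (intro ennreal_leI mult_right_mono) auto
  finally show "emeasure lborel ?W \<le> ennreal (real q * (2 * h))" .
qed

text \<open>Where |D| < 2 a zero of \<open>D\<close> lies within \<open>h\<close>, and there are at
  most \<open>q\<close> zeros. The two rims lie within \<open>\<eta>\<close> of the projected roots
  of D - 2 and D + 2; their width is a \<open>q\<close>-th power because a monic polynomial of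
  degree \<open>q\<close> is that small only near a root. The long block is required up to
  \<open>R + 1\<close> because the search for a zero moves by \<open>h <= 1\<close>.\<close>

lemma emeasure_bands_le:
  fixes a :: "int \<Rightarrow> real" and q :: nat
  defines "D \<equiv> \<lambda>E. tr2 (tm (\<lambda>i. E - a i) 0 q)"
  assumes q: "0 < q" and B: "0 < B" "pi \<le> B * h" "0 < h" "h \<le> 1" and eta: "0 \<le> \<eta>"
    and big: "\<And>E. \<bar>E\<bar> \<le> R + 1 \<Longrightarrow> \<exists>j n. 0 < j \<and> 0 < n \<and> j + n < q \<and> 2 * B \<le> \<bar>tr2 (tm (\<lambda>i. E - a i) (int j) n)\<bar>"
  shows "emeasure lborel {E. \<bar>E\<bar> \<le> R \<and> \<bar>D E\<bar> \<le> 2 + \<eta> ^ q} \<le> ennreal (2 * real q * h + 4 * real q * \<eta>)"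
proof -
  obtain p where p: "degree p = q" "lead_coeff p = 1" "\<And>E. D E = poly p E"
    unfolding D_def using discriminant_polynomial[OF q, of a] by blast
  obtain D' where D': "\<And>E. (D has_real_derivative D' E) (at E)"
    and bnd: "\<And>E j n. \<bar>D E\<bar> < 2 \<Longrightarrow> 0 < j \<Longrightarrow> 0 < n \<Longrightarrow> j + n < q \<Longrightarrow>
      \<bar>tr2 (tm (\<lambda>i. E - a i) (int j) n)\<bar> / 2 * sqrt (4 - (D E)\<^sup>2) \<le> \<bar>D' E\<bar>"
    unfolding D_def using discriminant_derivative_bound[where q = q and a = a] by blast
  have bnd': "B * sqrt (4 - (D E)\<^sup>2) \<le> \<bar>D' E\<bar>" if E: "\<bar>E\<bar> \<le> R + 1" "\<bar>D E\<bar> < 2" for E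
  proof -
    obtain j n where jn: "0 < j" "0 < n" "j + n < q" "2 * B \<le> \<bar>tr2 (tm (\<lambda>i. E - a i) (int j) n)\<bar>"
      using big[OF E(1)] by blast
    have "0 < 4 - (D E)\<^sup>2"
      using E(2) abs_square_less_1[of "D E / 2"] by (simp add: power2_eq_square)
    then have "B * sqrt (4 - (D E)\<^sup>2) \<le> \<bar>tr2 (tm (\<lambda>i. E - a i) (int j) n)\<bar> / 2 * sqrt (4 - (D E)\<^sup>2)"
      using jn(4) by (intro mult_right_mono) auto
    also have "\<dots> \<le> \<bar>D' E\<bar>" by (rule bnd) (use jn E in auto)
    finally show ?thesis .
  qed
  let ?Z0 = "{z. poly p z = 0}"
  have p0: "p \<noteq> 0" using p q by auto
  have 0: "\<exists>W. W \<in> sets lborel \<and> {E. \<bar>E\<bar> \<le> R \<and> \<bar>D E\<bar> < 2} \<subseteq> W \<and> emeasure lborel W \<le> ennreal (real q * (2 * h))"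
  proof (rule emeasure_near_finite_le)
    show "finite ?Z0" using p0 by (rule poly_roots_finite)
    show "card ?Z0 \<le> q" using card_poly_roots_bound[OF p0] p by simp
    show "\<exists>z\<in>?Z0. \<bar>E - z\<bar> \<le> h" if "E \<in> {E. \<bar>E\<bar> \<le> R \<and> \<bar>D E\<bar> < 2}" for E
    proof -
      have "\<exists>z. \<bar>E - z\<bar> \<le> h \<and> D z = 0"
      proof (rule zero_near[OF D' _ \<open>0 < h\<close> B(2) B(1)])
        show "B * sqrt (4 - (D y)\<^sup>2) \<le> \<bar>D' y\<bar>" if "\<bar>y - E\<bar> \<le> h" "\<bar>D y\<bar> < 2" for y
          by (rule bnd') (use that \<open>E \<in> _\<close> B in auto)
      qed (use that in auto)
      then show ?thesis using p(3) by auto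
    qed
  qed (use B in auto)
  have s: "\<exists>W. W \<in> sets lborel \<and> {E. \<bar>D E - c\<bar> \<le> \<eta> ^ q} \<subseteq> W \<and> emeasure lborel W \<le> ennreal (real q * (2 * \<eta>))" for c
  proof -
    have dq: "degree (p - [:c:]) = q"
      using p(1) q degree_add_eq_left[of "- [:c:]" p] unfolding diff_conv_add_uminus by simp
    have lq: "lead_coeff (p - [:c:]) = 1"
      unfolding dq using p q by (cases q) (auto)
    obtain Z where Z: "finite Z" "card Z \<le> q" "\<And>E. \<bar>poly (p - [:c:]) E\<bar> \<le> \<eta> ^ q \<Longrightarrow> \<exists>z\<in>Z. \<bar>E - z\<bar> \<le> \<eta>"
      using small_value_near_root[OF dq q lq eta] by blast
    show ?thesis
      by (rule emeasure_near_finite_le[OF Z(1,2) eta]) (use Z(3) p(3) in auto)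
  qed
  obtain W0 where W0: "W0 \<in> sets lborel" "{E. \<bar>E\<bar> \<le> R \<and> \<bar>D E\<bar> < 2} \<subseteq> W0" "emeasure lborel W0 \<le> ennreal (real q * (2 * h))"
    using 0 by blast
  obtain W1 where W1: "W1 \<in> sets lborel" "{E. \<bar>D E - 2\<bar> \<le> \<eta> ^ q} \<subseteq> W1" "emeasure lborel W1 \<le> ennreal (real q * (2 * \<eta>))"
    using s[of 2] by blast
  obtain W2 where W2: "W2 \<in> sets lborel" "{E. \<bar>D E - (- 2)\<bar> \<le> \<eta> ^ q} \<subseteq> W2" "emeasure lborel W2 \<le> ennreal (real q * (2 * \<eta>))"
    using s[of "- 2"] by blast
  have "{E. \<bar>E\<bar> \<le> R \<and> \<bar>D E\<bar> \<le> 2 + \<eta> ^ q} \<subseteq> W0 \<union> W1 \<union> W2"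
  proof
    fix E assume E: "E \<in> {E. \<bar>E\<bar> \<le> R \<and> \<bar>D E\<bar> \<le> 2 + \<eta> ^ q}"
    consider "\<bar>D E\<bar> < 2" | "2 \<le> D E" | "D E \<le> - 2" by linarith
    then show "E \<in> W0 \<union> W1 \<union> W2"
    proof cases
      case 1 then show ?thesis using E W0(2) by auto
    next
      case 2 then have "E \<in> W1" using E by (intro subsetD[OF W1(2)]) auto
      then show ?thesis by simp
    next
      case 3 then have "E \<in> W2" using E by (intro subsetD[OF W2(2)]) auto
      then show ?thesis by simp
    qed
  qed
  then have "emeasure lborel {E. \<bar>E\<bar> \<le> R \<and> \<bar>D E\<bar> \<le> 2 + \<eta> ^ q} \<le> emeasure lborel (W0 \<union> W1 \<union> W2)"
    using W0 W1 W2 by (intro emeasure_mono) auto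
  also have "\<dots> \<le> emeasure lborel W0 + emeasure lborel W1 + emeasure lborel W2"
    using W0(1) W1(1) W2(1)
    by (intro order.trans[OF emeasure_subadditive] add_mono emeasure_subadditive) auto
  also have "\<dots> \<le> ennreal (real q * (2 * h)) + ennreal (real q * (2 * \<eta>)) + ennreal (real q * (2 * \<eta>))"
    by (intro add_mono W0 W1 W2)
  also have "\<dots> = ennreal (2 * real q * h + 4 * real q * \<eta>)"
    using B eta by (simp flip: ennreal_plus add: algebra_simps)
  finally show ?thesis .
qed

subsection \<open>Opening gaps\<close>

text \<open>The pair \<open>z\<close> is (coupling, energy). Joint continuity makes an opened gap
  persist for nearby couplings and energies.\<close>

lemma continuous_tm:
  fixes c :: "int \<Rightarrow> real" and j :: int
  defines "A \<equiv> \<lambda>n z. tm (\<lambda>i. snd z - fst z * c i) j n"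
  shows "continuous_on UNIV (\<lambda>z. m11 (A n z)) \<and> continuous_on UNIV (\<lambda>z. m12 (A n z)) \<and>
    continuous_on UNIV (\<lambda>z. m21 (A n z)) \<and> continuous_on UNIV (\<lambda>z. m22 (A n z))"
proof (induction n)
  case (Suc n)
  then show ?case by (auto simp: A_def intro!: continuous_intros)
qed (simp add: A_def)

lemma continuous_tr2_tm:
  fixes c :: "int \<Rightarrow> real"
  shows "continuous_on UNIV (\<lambda>z. tr2 (tm (\<lambda>i. snd z - fst z * c i) j n))"
  unfolding tr2_def using continuous_tm[of c j n] by (auto intro!: continuous_intros)

text \<open>If no small change of two neighbouring sites made the trace leave \<open>{-2..2}\<close>, the first row
  of the remaining product would vanish.\<close>

lemma two_site_perturbation:
  assumes tr: "\<bar>tr2 (tm b 0 Q)\<bar> = 2" and Q: "2 \<le> Q" and \<delta>: "0 < \<delta>"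
  obtains s t where "\<bar>s\<bar> \<le> \<delta>" "\<bar>t\<bar> \<le> \<delta>"
    "\<And>b'. b' 0 = b 0 + s \<Longrightarrow> b' 1 = b 1 + t \<Longrightarrow> (\<And>i. 2 \<le> i \<Longrightarrow> i < int Q \<Longrightarrow> b' i = b i) \<Longrightarrow> 2 < \<bar>tr2 (tm b' 0 Q)\<bar>"
proof -
  obtain k where k: "Q = 2 + k" using Q le_Suc_ex by blast
  define R where "R = tm b 2 k"
  \<comment> \<open>The trace is affine in each of the two site values: \<open>X\<close> and
    \<open>Y\<close> are the coefficients of \<open>s\<close> and \<open>t\<close>, and
    \<open>m11 R\<close> is that of \<open>s * t\<close>.\<close>
  define X where "X = m11 R * b 1 + m12 R"
  define Y where "Y = m11 R * b 0 - m21 R"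
  define f where "f s t = tr2 (tm b 0 Q) + s * X + t * Y + s * t * m11 R" for s t
  have eq: "tr2 (tm b' 0 Q) = f s t"
    if "b' 0 = b 0 + s" "b' 1 = b 1 + t" "\<And>i. 2 \<le> i \<Longrightarrow> i < int Q \<Longrightarrow> b' i = b i" for b' s t
  proof -
    have *: "tm b'' 0 Q = R * (step2 (b'' 1) * step2 (b'' 0))" if "\<And>i. 2 \<le> i \<Longrightarrow> i < int Q \<Longrightarrow> b'' i = b i" for b''
    proof -
      have "tm b'' 0 Q = tm b'' 2 k * tm b'' 0 2"
        using tm_add[of b'' 0 2 k, folded k] by simp
      moreover have "tm b'' 2 k = R" unfolding R_def using that k by (intro tm_cong) auto
      moreover have "tm b'' 0 2 = step2 (b'' 1) * step2 (b'' 0)" by (simp add: numeral_2_eq_2)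
      ultimately show ?thesis by simp
    qed
    have "tm b' 0 Q = R * (step2 (b' 1) * step2 (b' 0))" by (rule *) (rule that(3))
    moreover have "tm b 0 Q = R * (step2 (b 1) * step2 (b 0))" by (rule *) (rule refl)
    ultimately show ?thesis unfolding f_def that(1,2)
      by (simp add: tr2_def X_def Y_def algebra_simps)
  qed
  \<comment> \<open>From a value of modulus 2, a nonzero change and its opposite cannot both stay
    inside [-2, 2].\<close>
  have pm: "u = 0" if "\<bar>x + u\<bar> \<le> 2" "\<bar>x - u\<bar> \<le> 2" "\<bar>x\<bar> = 2" for x u :: real
    using that by (auto simp: abs_if split: if_splits)
  have "\<exists>s t. \<bar>s\<bar> \<le> \<delta> \<and> \<bar>t\<bar> \<le> \<delta> \<and> 2 < \<bar>f s t\<bar>"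
  proof (rule ccontr)
    assume "\<not> ?thesis"
    then have le: "\<bar>f s t\<bar> \<le> 2" if "\<bar>s\<bar> \<le> \<delta>" "\<bar>t\<bar> \<le> \<delta>" for s t using that by force
    have "\<delta> * X = 0"
      by (rule pm[OF _ _ tr]) (use le[of \<delta> 0] le[of "- \<delta>" 0] \<delta> in \<open>simp_all add: f_def\<close>)
    then have X: "X = 0" using \<delta> by simp
    have "\<delta> * Y = 0"
      by (rule pm[OF _ _ tr]) (use le[of 0 \<delta>] le[of 0 "- \<delta>"] \<delta> in \<open>simp_all add: f_def\<close>)
    then have Y: "Y = 0" using \<delta> by simp
    have "\<delta> * \<delta> * m11 R = 0"
      by (rule pm[OF _ _ tr]) (use le[of \<delta> \<delta>] le[of \<delta> "- \<delta>"] \<delta> in \<open>simp_all add: f_def X Y\<close>)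
    then have "m11 R = 0" using \<delta> by simp
    moreover have "m12 R = 0" using X calculation by (simp add: X_def)
    ultimately have "det2 R = 0" by (simp add: det2_def)
    then show False by (simp add: R_def)
  qed
  then obtain s t where "\<bar>s\<bar> \<le> \<delta>" "\<bar>t\<bar> \<le> \<delta>" "2 < \<bar>f s t\<bar>" by blast
  then show ?thesis using that[of s t] eq by metis
qed

lemma IVT_between:
  fixes f :: "real \<Rightarrow> real"
  assumes "continuous_on {a..b} f" "a \<le> b" "min (f a) (f b) \<le> y" "y \<le> max (f a) (f b)"
  shows "\<exists>x. a \<le> x \<and> x \<le> b \<and> f x = y"
proof (cases "f a \<le> f b")
  case True
  then show ?thesis using IVT'[of f a y b] assms by auto
next
  case False
  then show ?thesis using IVT2'[of f b y a] assms by auto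
qed

text \<open>After an arbitrarily small constant shift the rotation angle of the period is a rational
  multiple of \<open>pi\<close> with prescribed large denominator \<open>n\<close>, so that the \<open>n\<close>-fold period has trace \<open>2\<close> or
  \<open>-2\<close>.\<close>

lemma gap_opening:
  fixes a :: "int \<Rightarrow> real"
  assumes p: "0 < p" and per: "\<And>i. a (i + int p) = a i" and l: "l \<noteq> 0" and \<epsilon>: "0 < \<epsilon>"
  obtains N where "\<And>n. N \<le> n \<Longrightarrow> \<exists>v. (\<forall>i. v (i + int (n * p)) = v i) \<and> (\<forall>i. \<bar>v i\<bar> \<le> \<epsilon>) \<and>
      2 < \<bar>tr2 (tm (\<lambda>i. E - l * (a i + v i)) 0 (n * p))\<bar>"
proof -
  \<comment> \<open>Half of the allowance is for the constant shift and half for the two sites; |l|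
    converts changes of the potential into changes of the energy.\<close>
  define \<delta> where "\<delta> = \<bar>l\<bar> * \<epsilon> / 2"
  have \<delta>: "0 < \<delta>" using l \<epsilon> by (simp add: \<delta>_def)
  define M where "M x = tm (\<lambda>i. E + x - l * a i) 0 p" for x
  define d where "d x = tr2 (M x)" for x
  have det: "det2 (M x) = 1" for x by (simp add: M_def)
  obtain P where P: "degree P = p" "\<And>x. tr2 (tm (\<lambda>i. x - l * a i) 0 p) = poly P x"
    using discriminant_polynomial[OF p, of "\<lambda>i. l * a i"] by metis
  have dP: "d x = poly P (E + x)" for x by (simp add: d_def M_def P)
  have cont: "continuous_on S d" for S unfolding dP by (intro continuous_intros)
  have Mpow: "tm (\<lambda>i. E + x - l * a i) 0 (n * p) = M x ^ n" for x n
    unfolding M_def by (rule tm_power) (simp add: per)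
  \<comment> \<open>The discriminant is a nonconstant polynomial, so a small shift really moves the
    rotation angle.\<close>
  obtain x where x: "0 < x" "x \<le> \<delta>" "d x \<noteq> d 0"
  proof (rule ccontr)
    assume "\<not> thesis"
    then have "\<And>x. 0 < x \<Longrightarrow> x \<le> \<delta> \<Longrightarrow> d x = d 0" using that by blast
    then have "(\<lambda>x. E + x) ` {0<..\<delta>} \<subseteq> {z. poly (P - [:d 0:]) z = 0}"
      unfolding image_subset_iff by (simp add: dP)
    moreover have "infinite ((\<lambda>x. E + x) ` {0<..\<delta>})"
      using \<delta> by (simp add: finite_image_iff infinite_Ioc)
    moreover have "P - [:d 0:] \<noteq> 0" using P p by auto
    ultimately show False using poly_roots_finite finite_subset by blast
  qed
  show ?thesis
  proof (cases "\<exists>y. 0 \<le> y \<and> y \<le> \<delta> \<and> 2 < \<bar>d y\<bar>")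
    case True
    then obtain y where y: "0 \<le> y" "y \<le> \<delta>" "2 < \<bar>d y\<bar>" by blast
    show ?thesis
    proof (rule that[of 1])
      fix n :: nat assume n: "1 \<le> n"
      define \<kappa> where "\<kappa> = (\<bar>d y\<bar> - 2) / 2"
      have "0 < \<kappa>" using y by (simp add: \<kappa>_def)
      have "2 + 2 * \<kappa> \<le> \<bar>tr2 (M y)\<bar>" by (simp add: \<kappa>_def d_def field_simps)
      then have "2 * (1 + \<kappa>) ^ n \<le> \<bar>tr2 (M y ^ n)\<bar>"
        using tr2_power_growth[OF det less_imp_le[OF \<open>0 < \<kappa>\<close>], of y n] by blast
      moreover have "1 < (1 + \<kappa>) ^ n" using n \<open>0 < \<kappa>\<close> by (intro one_less_power) auto
      ultimately have tr: "2 < \<bar>tr2 (M y ^ n)\<bar>" by linarith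
      have "\<bar>- y / l\<bar> \<le> \<epsilon>" using y \<delta> l \<epsilon> by (simp add: \<delta>_def abs_divide field_simps)
      moreover have "(\<lambda>i. E - l * (a i + - y / l)) = (\<lambda>i. E + y - l * a i)" using l by (auto simp: field_simps)
      ultimately show "\<exists>v. (\<forall>i. v (i + int (n * p)) = v i) \<and> (\<forall>i. \<bar>v i\<bar> \<le> \<epsilon>) \<and>
          2 < \<bar>tr2 (tm (\<lambda>i. E - l * (a i + v i)) 0 (n * p))\<bar>"
        using tr Mpow[of y n] by (intro exI[of _ "\<lambda>_. - y / l"]) simp
    qed
  next
    case False
    then have le2: "\<bar>d y\<bar> \<le> 2" if "0 \<le> y" "y \<le> \<delta>" for y using that by force
    define u where "u = arccos (d 0 / 2)"
    define w where "w = arccos (d x / 2)"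
    have d0: "d 0 = 2 * cos u" "0 \<le> u" "u \<le> pi" and dx: "d x = 2 * cos w" "0 \<le> w" "w \<le> pi"
      using le2[of 0] le2[of x] x \<delta> by (auto simp: u_def w_def cos_arccos_abs arccos_lbound arccos_ubound)
    have "u \<noteq> w" using d0 dx x by auto
    define lo where "lo = min u w"
    define hi where "hi = max u w"
    have lohi: "lo < hi" "0 \<le> lo" "hi \<le> pi" using \<open>u \<noteq> w\<close> d0 dx by (auto simp: lo_def hi_def)
    show ?thesis
    \<comment> \<open>Once pi / n is at most \<open>hi - lo\<close>, a multiple of pi / n lies
      between the two angles and is attained by a shift. The bound 2 provides two distinct sites to
      perturb.\<close>
    proof (rule that[of "max 2 (nat \<lceil>pi / (hi - lo)\<rceil>)"])
      fix n :: nat assume n: "max 2 (nat \<lceil>pi / (hi - lo)\<rceil>) \<le> n"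
      have n2: "2 \<le> n" using n by simp
      have "pi / (hi - lo) \<le> real n" using n by linarith
      then have n': "pi / real n \<le> hi - lo" using n2 lohi by (simp add: field_simps)
      define m where "m = \<lceil>lo * real n / pi\<rceil>"
      define \<theta> where "\<theta> = of_int m * pi / real n"
      have "lo * real n / pi \<le> of_int m" "of_int m \<le> lo * real n / pi + 1" by (auto simp: m_def)
      then have "lo \<le> \<theta>" "\<theta> \<le> lo + pi / real n" using n2 by (simp_all add: \<theta>_def field_simps)
      then have th: "lo \<le> \<theta>" "\<theta> \<le> hi" using n' by auto
      have mono: "cos hi \<le> cos \<theta>" "cos \<theta> \<le> cos lo" using th lohi by (auto intro!: cos_monotone_0_pi_le)
      have "\<exists>y. 0 \<le> y \<and> y \<le> x \<and> d y = 2 * cos \<theta>"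
      proof (rule IVT_between[OF cont])
        show "min (d 0) (d x) \<le> 2 * cos \<theta>" "2 * cos \<theta> \<le> max (d 0) (d x)"
          using mono unfolding d0 dx lo_def hi_def by (auto simp: min_def max_def split: if_splits)
      qed (use x in simp)
      then obtain y where y: "0 \<le> y" "y \<le> x" "d y = 2 * cos \<theta>" by blast
      define b where "b i = E + y - l * a i" for i
      define Q where "Q = n * p"
      have Q2: "2 \<le> Q" using n2 p by (metis Q_def One_nat_def Suc_leI mult_le_mono nat_mult_1_right)
      have "tr2 (tm b 0 Q) = 2 * cos (real n * \<theta>)"
        unfolding b_def Q_def Mpow using tr2_power_cos[OF det, of y \<theta> n] y by (simp add: d_def)
      also have "real n * \<theta> = of_int m * pi" using n2 by (simp add: \<theta>_def)
      finally have "tr2 (tm b 0 Q) = 2 * cos (of_int m * pi)" .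
      moreover have "\<bar>cos (of_int m * pi)\<bar> = 1"
        by (rule sin_zero_abs_cos_one) (auto simp: sin_zero_iff_int2)
      ultimately have tr: "\<bar>tr2 (tm b 0 Q)\<bar> = 2" by (simp add: abs_mult)
      obtain s t where st: "\<bar>s\<bar> \<le> \<delta>" "\<bar>t\<bar> \<le> \<delta>" "\<And>b'. b' 0 = b 0 + s \<Longrightarrow> b' 1 = b 1 + t \<Longrightarrow>
          (\<And>i. 2 \<le> i \<Longrightarrow> i < int Q \<Longrightarrow> b' i = b i) \<Longrightarrow> 2 < \<bar>tr2 (tm b' 0 Q)\<bar>"
        using two_site_perturbation[OF tr Q2 \<delta>] by metis
      define e where "e i = (if i mod int Q = 0 then s else if i mod int Q = 1 then t else 0)" for i
      define v where "v i = - (y + e i) / l" for i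
      have e: "\<bar>e i\<bar> \<le> \<delta>" for i using st \<delta> by (simp add: e_def)
      have eq: "E - l * (a i + v i) = b i + e i" for i using l by (simp add: v_def b_def field_simps)
      have "2 < \<bar>tr2 (tm (\<lambda>i. E - l * (a i + v i)) 0 Q)\<bar>"
        unfolding eq by (rule st(3)) (use Q2 in \<open>auto simp: e_def\<close>)
      moreover have "\<bar>v i\<bar> \<le> \<epsilon>" for i
      proof -
        have "\<bar>y + e i\<bar> \<le> \<bar>l\<bar> * \<epsilon>" using e[of i] y x unfolding \<delta>_def by linarith
        then have "\<bar>y + e i\<bar> / \<bar>l\<bar> \<le> \<epsilon>" using l by (simp add: field_simps)
        then show ?thesis unfolding v_def abs_divide abs_minus_cancel .
      qed
      moreover have "v (i + int Q) = v i" for i by (simp add: v_def e_def)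
      ultimately show "\<exists>v. (\<forall>i. v (i + int (n * p)) = v i) \<and> (\<forall>i. \<bar>v i\<bar> \<le> \<epsilon>) \<and>
          2 < \<bar>tr2 (tm (\<lambda>i. E - l * (a i + v i)) 0 (n * p))\<bar>"
        unfolding Q_def[symmetric] by blast
    qed
  qed
qed

section \<open>Short bands by concatenation\<close>

lemma linear_le_exponential:
  fixes \<kappa> \<delta> \<alpha> \<beta> :: real
  assumes "0 < \<kappa>" "0 < \<delta>"
  shows "\<exists>M. \<forall>m\<ge>M. \<alpha> * real m + \<beta> \<le> \<delta> * (1 + \<kappa>) ^ m"
proof -
  define x where "x = inverse (1 + \<kappa>)"
  have x: "0 < x" "x < 1" using assms by (auto simp: x_def field_simps)
  have "(\<lambda>m. \<alpha> * (real m * x ^ m) + \<beta> * x ^ m) \<longlonglongrightarrow> \<alpha> * 0 + \<beta> * 0"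
    using x by (intro tendsto_intros powser_times_n_limit_0 LIMSEQ_power_zero) auto
  then have "eventually (\<lambda>m. \<alpha> * (real m * x ^ m) + \<beta> * x ^ m < \<delta>) sequentially"
    using assms(2) by (intro order_tendstoD(2)) auto
  then obtain M where M: "\<And>m. M \<le> m \<Longrightarrow> \<alpha> * (real m * x ^ m) + \<beta> * x ^ m < \<delta>"
    by (auto simp: eventually_sequentially)
  show ?thesis
  proof (intro exI allI impI)
    fix m assume "M \<le> m"
    have "\<alpha> * real m + \<beta> = (\<alpha> * (real m * x ^ m) + \<beta> * x ^ m) * (1 + \<kappa>) ^ m"
    proof -
      have "x ^ m * (1 + \<kappa>) ^ m = 1"
        unfolding power_mult_distrib[symmetric] x_def using assms by simp
      then show ?thesis by (simp add: algebra_simps)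
    qed
    also have "\<dots> \<le> \<delta> * (1 + \<kappa>) ^ m"
      using M[OF \<open>M \<le> m\<close>] assms by (intro mult_right_mono) auto
    finally show "\<alpha> * real m + \<beta> \<le> \<delta> * (1 + \<kappa>) ^ m" .
  qed
qed

text \<open>\<open>\<A>\<close> stands for the periods realizable on the group. They can be made
  large and divisible by \<open>p\<close> but not chosen freely, so all block lengths are computed
  from \<open>Q\<close> afterwards by integer division.\<close>

lemma small_bands_perturbation:
  fixes a :: "int \<Rightarrow> real" and \<A> :: "nat set"
  assumes Apos: "\<And>p. p \<in> \<A> \<Longrightarrow> 0 < p" and Amult: "\<And>p N. p \<in> \<A> \<Longrightarrow> \<exists>q\<in>\<A>. N \<le> q \<and> p dvd q"
    and p: "p \<in> \<A>" and per: "\<And>i. a (i + int p) = a i"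
    and \<epsilon>: "0 < \<epsilon>" and K: "0 < K" and \<delta>: "0 < \<delta>"
  shows "\<exists>q\<in>\<A>. N0 \<le> q \<and> (\<exists>a' \<eta>. (\<forall>i. a' (i + int q) = a' i) \<and> (\<forall>i. \<bar>a' i - a i\<bar> \<le> \<epsilon>) \<and> 0 < \<eta> \<and>
     (\<forall>l. 1 / K \<le> \<bar>l\<bar> \<longrightarrow> \<bar>l\<bar> \<le> K \<longrightarrow>
        emeasure lborel {E. \<bar>E\<bar> \<le> R \<and> \<bar>tr2 (tm (\<lambda>i. E - l * a' i) 0 q)\<bar> \<le> 2 + \<eta>} \<le> ennreal \<delta>))"
proof -
  define S where "S = {l::real. 1 / K \<le> \<bar>l\<bar> \<and> \<bar>l\<bar> \<le> K} \<times> {- (R + 1)..R + 1}"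
  have "compact {l::real. 1 / K \<le> \<bar>l\<bar> \<and> \<bar>l\<bar> \<le> K}"
  proof -
    have "{l::real. 1 / K \<le> \<bar>l\<bar> \<and> \<bar>l\<bar> \<le> K} = {1 / K..K} \<union> {- K..- (1 / K)}"
    proof -
      have "{l::real. c \<le> \<bar>l\<bar> \<and> \<bar>l\<bar> \<le> K} = {c..K} \<union> {- K..- c}" if "0 < c" for c
        using that by (auto simp: abs_if split: if_splits)
      then show ?thesis using K by simp
    qed
    then show ?thesis by (simp add: compact_Un)
  qed
  then have S: "compact S" unfolding S_def by (intro compact_Times) auto
  define f where "f v P z = tr2 (tm (\<lambda>i. snd z - fst z * (a i + v i)) 0 P)" for v P z
  have cf: "continuous_on UNIV (f v P)" for v P
    unfolding f_def using continuous_tr2_tm[of "\<lambda>i. a i + v i" 0 P] by simp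
  \<comment> \<open>A local solution: a period, a perturbation of that period, and the margin by
    which its gap is open.\<close>
  define I where "I = {(P, v, \<kappa>). P \<in> \<A> \<and> p dvd P \<and> (\<forall>i. v (i + int P) = v i) \<and> (\<forall>i. \<bar>v i\<bar> \<le> \<epsilon>) \<and> (0::real) < \<kappa>}"
  define U where "U x = (case x of (P, v, \<kappa>) \<Rightarrow> {z. 2 + 2 * \<kappa> < \<bar>f v P z\<bar>})" for x
  have opU: "open (U x)" for x
    unfolding U_def by (cases x) (auto intro!: open_Collect_less continuous_intros cf)
  have cover: "S \<subseteq> (\<Union>x\<in>I. U x)"
  proof
    fix z assume z: "z \<in> S"
    obtain l E where lE: "z = (l, E)" by (cases z)
    have l: "l \<noteq> 0" using z K by (auto simp: S_def lE)
    obtain N where N: "\<And>n. N \<le> n \<Longrightarrow> \<exists>v. (\<forall>i. v (i + int (n * p)) = v i) \<and> (\<forall>i. \<bar>v i\<bar> \<le> \<epsilon>) \<and>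
      2 < \<bar>tr2 (tm (\<lambda>i. E - l * (a i + v i)) 0 (n * p))\<bar>"
      using gap_opening[of p a l \<epsilon> E] Apos[OF p] per l \<epsilon> by blast
    obtain q where q: "q \<in> \<A>" "N * p \<le> q" "p dvd q" using Amult[OF p] by blast
    obtain n where n: "q = n * p" using q(3) by (metis dvdE mult.commute)
    then have "N \<le> n" using q(2) Apos[OF p] by simp
    then obtain v where v: "\<forall>i. v (i + int (n * p)) = v i" "\<forall>i. \<bar>v i\<bar> \<le> \<epsilon>" "2 < \<bar>f v q z\<bar>"
      using N unfolding f_def lE n by fastforce
    define \<kappa> where "\<kappa> = (\<bar>f v q z\<bar> - 2) / 4"
    have "0 < \<kappa>" "2 + 2 * \<kappa> < \<bar>f v q z\<bar>" using v(3) by (simp_all add: \<kappa>_def field_simps)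
    then have "(q, v, \<kappa>) \<in> I" "z \<in> U (q, v, \<kappa>)"
      using v q by (auto simp: I_def U_def n)
    then show "z \<in> (\<Union>x\<in>I. U x)" by blast
  qed
  obtain C where C: "C \<subseteq> I" "finite C" "S \<subseteq> (\<Union>x\<in>C. U x)"
    using compactE_image[OF S opU cover] by blast
  obtain xs where xs: "set xs = C" using finite_list[OF C(2)] by blast
  define J where "J = length xs"
  define V where "V j = fst (snd (xs ! j))" for j
  define per' where "per' j = fst (xs ! j)" for j
  have xsI: "per' j \<in> \<A>" "p dvd per' j" "\<And>i. V j (i + int (per' j)) = V j i" "\<And>i. \<bar>V j i\<bar> \<le> \<epsilon>" "0 < snd (snd (xs ! j))"
    if "j < J" for j
  proof -
    have "xs ! j \<in> I" using that C(1) xs by (auto simp: J_def)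
    then show "per' j \<in> \<A>" "p dvd per' j" "\<And>i. V j (i + int (per' j)) = V j i" "\<And>i. \<bar>V j i\<bar> \<le> \<epsilon>" "0 < snd (snd (xs ! j))"
      by (auto simp: I_def V_def per'_def)
  qed
  define \<kappa> where "\<kappa> = Min (insert 1 ((\<lambda>x. snd (snd x)) ` C))"
  have \<kappa>: "0 < \<kappa>" using C by (auto simp: \<kappa>_def I_def)
  have \<kappa>le: "\<kappa> \<le> snd (snd (xs ! j))" if "j < J" for j
    unfolding \<kappa>_def using C(2) xs that by (intro Min_le) (auto simp: J_def)
  define Pm where "Pm = Max (insert 1 (fst ` C))"
  have Pm1: "1 \<le> Pm" using C(2) by (simp add: Pm_def)
  have Pm: "per' j \<le> Pm" if "j < J" for j
    unfolding Pm_def per'_def using C(2) xs that by (intro Max_ge) (auto simp: J_def)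
  \<comment> \<open>These make 4 pi Q / \<delta> <= \<alpha> m + \<beta>, because Q <= (J + 1) (m Pm
    + Pm + 3) below. The exponential (1 + \<kappa>)^m then beats the length of the period.\<close>
  define \<alpha> where "\<alpha> = 4 * pi * real ((J + 1) * Pm) / \<delta>"
  define \<beta> where "\<beta> = 4 * pi * real ((J + 1) * (Pm + 3)) / \<delta>"
  have pd: "0 < 4 * pi / \<delta>" using \<delta> by simp
  obtain M1 where M1: "\<And>m. M1 \<le> m \<Longrightarrow> \<alpha> * real m + \<beta> \<le> 1 * (1 + \<kappa>) ^ m"
    using linear_le_exponential[OF \<kappa> zero_less_one] by blast
  obtain M2 where M2: "\<And>m. M2 \<le> m \<Longrightarrow> 0 * real m + pi \<le> 1 * (1 + \<kappa>) ^ m"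
    using linear_le_exponential[OF \<kappa> zero_less_one] by blast
  define M where "M = Suc (max M1 M2)"
  obtain Q where Q: "Q \<in> \<A>" "max N0 ((J + 1) * (M * Pm + 2)) \<le> Q" "p dvd Q" using Amult[OF p] by blast
  have Q0: "0 < Q" using Apos[OF Q(1)] .
  \<comment> \<open>The period is cut into \<open>J + 1\<close> slots of length \<open>L\<close>.
    Slot number \<open>j < J\<close> carries the \<open>j\<close>-th perturbation; the last slot and
    the remainder stay unperturbed. Any local period, being at most \<open>Pm\<close>, fits
    \<open>m\<close> times into a slot, with two sites to spare since blocks start at offset
    1.\<close>
  define L where "L = Q div (J + 1)"
  define m where "m = (L - 2) div Pm"
  have LQ: "(J + 1) * L \<le> Q" unfolding L_def by (rule times_div_less_eq_dividend)
  have QL: "Q \<le> (J + 1) * (L + 1)"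
    unfolding L_def using dividend_less_div_times[of "J + 1" Q] by (simp add: algebra_simps)
  have "M * Pm + 2 \<le> L"
    unfolding L_def using Q(2) by (subst less_eq_div_iff_mult_less_eq) (auto simp: mult.commute)
  then have L2: "M * Pm \<le> L - 2" "2 \<le> L" by auto
  have Mm: "M \<le> m" unfolding m_def using L2 Pm1 by (subst less_eq_div_iff_mult_less_eq) auto
  have mL: "m * Pm \<le> L - 2" unfolding m_def by simp
  have "L - 2 < (m + 1) * Pm" unfolding m_def using dividend_less_div_times[of Pm "L - 2"] Pm1 by (simp add: algebra_simps)
  then have "L + 1 \<le> m * Pm + (Pm + 3)" using L2 by (simp add: algebra_simps)
  then have "(J + 1) * (L + 1) \<le> (J + 1) * (m * Pm + (Pm + 3))" by (rule mult_le_mono2)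
  with QL have "Q \<le> (J + 1) * (m * Pm + (Pm + 3))" by linarith
  also have "\<dots> = (J + 1) * Pm * m + (J + 1) * (Pm + 3)" by (simp add: algebra_simps)
  finally have "real Q \<le> real ((J + 1) * Pm) * real m + real ((J + 1) * (Pm + 3))"
    by (metis of_nat_add of_nat_le_iff of_nat_mult)
  then have "4 * pi / \<delta> * real Q \<le> 4 * pi / \<delta> * (real ((J + 1) * Pm) * real m + real ((J + 1) * (Pm + 3)))"
    using pd by (intro mult_left_mono) auto
  also have "\<dots> = \<alpha> * real m + \<beta>" by (simp add: \<alpha>_def \<beta>_def algebra_simps add_divide_distrib)
  also have "\<dots> \<le> (1 + \<kappa>) ^ m" using M1[of m] Mm by (simp add: M_def)
  finally have QB: "4 * pi / \<delta> * real Q \<le> (1 + \<kappa>) ^ m" .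
  define B where "B = (1 + \<kappa>) ^ m"
  have B: "0 < B" "pi \<le> B" using \<kappa> M2[of m] Mm by (auto simp: B_def M_def)
  \<comment> \<open>The measure bound is 2 Q h + 4 Q \<eta>; these choices make each summand at most
    \<delta> / 2.\<close>
  define h where "h = pi / B"
  have h: "0 < h" "h \<le> 1" "pi \<le> B * h" using B by (auto simp: h_def)
  define \<eta> where "\<eta> = \<delta> / (8 * real Q)"
  have \<eta>: "0 < \<eta>" using \<delta> Q0 by (simp add: \<eta>_def)
  have "2 * real Q * h \<le> \<delta> / 2" using QB B(1) \<delta> by (simp add: h_def B_def[symmetric] field_simps)
  moreover have "4 * real Q * \<eta> = \<delta> / 2" using Q0 by (simp add: \<eta>_def)
  ultimately have tot: "2 * real Q * h + 4 * real Q * \<eta> \<le> \<delta>" by (simp add: field_simps)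
  define a' where "a' i = a i + (let r = nat (i mod int Q) in if r div L < J then V (r div L) i else 0)" for i
  define a'' where "a'' i = a' (i mod int Q)" for i
  have per'': "a'' (i + int Q) = a'' i" for i by (simp add: a''_def)
  have aQ: "a (i mod int Q) = a i" for i
  proof -
    obtain k where k: "Q = p * k" using Q(3) by blast
    have "a (i + int Q) = a i" for i
      using periodic_int_mult[of a "int p" i "int k", OF per] by (simp add: k)
    then show ?thesis using periodic_mod[of a "int Q" i] by blast
  qed
  have close: "\<bar>a'' i - a i\<bar> \<le> \<epsilon>" for i
    using xsI(4) \<epsilon> by (simp add: a''_def a'_def aQ Let_def)
  have meas: "emeasure lborel {E. \<bar>E\<bar> \<le> R \<and> \<bar>tr2 (tm (\<lambda>i. E - l * a'' i) 0 Q)\<bar> \<le> 2 + \<eta> ^ Q} \<le> ennreal \<delta>"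
    if l: "1 / K \<le> \<bar>l\<bar>" "\<bar>l\<bar> \<le> K" for l
  proof -
    have "\<exists>j n. 0 < j \<and> 0 < n \<and> j + n < Q \<and> 2 * B \<le> \<bar>tr2 (tm (\<lambda>i. E - l * a'' i) (int j) n)\<bar>"
      if E: "\<bar>E\<bar> \<le> R + 1" for E
    proof -
      have "(l, E) \<in> S" using l E by (auto simp: S_def)
      then obtain k where k: "k < J" "(l, E) \<in> U (xs ! k)"
        using C(3) xs by (metis J_def UN_E in_set_conv_nth subsetD)
      define P where "P = per' k"
      have P: "0 < P" "P \<le> Pm" "p dvd P" using Apos xsI(1,2)[OF k(1)] Pm[OF k(1)] by (auto simp: P_def)
      define b where "b i = E - l * (a i + V k i)" for i
      have "2 + 2 * snd (snd (xs ! k)) < \<bar>tr2 (tm b 0 P)\<bar>"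
        using k(2) by (simp add: U_def f_def b_def[abs_def] P_def per'_def V_def split: prod.splits)
      then have trb: "2 + 2 * \<kappa> \<le> \<bar>tr2 (tm b 0 P)\<bar>" using \<kappa>le[OF k(1)] by linarith
      have bper: "b (i + int P) = b i" for i
      proof -
        obtain t where t: "P = p * t" using P(3) by blast
        have "a (i + int P) = a i"
          using periodic_int_mult[of a "int p" i "int t", OF per] by (simp add: t)
        then show ?thesis using xsI(3)[OF k(1)] by (simp add: b_def P_def)
      qed
      let ?j = "k * L + 1" and ?n = "m * P"
      have nL: "?n \<le> L - 2" using mL P(2) by (meson le_trans mult_le_mono2)
      have kL: "(k + 1) * L \<le> J * L" using k(1) by (intro mult_le_mono1) simp
      then have kLQ: "(k + 1) * L \<le> Q" using LQ by (simp add: algebra_simps)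
      have "tm (\<lambda>i. E - l * a'' i) (int ?j) ?n = tm b (int ?j) ?n"
      proof (rule tm_cong)
        fix i assume i: "int ?j \<le> i" "i < int ?j + int ?n"
        define r where "r = nat i"
        have "0 \<le> i" using i(1) of_nat_0_le_iff order_trans by blast
        then have r: "i = int r" by (simp add: r_def)
        have "?j \<le> r" "r < ?j + ?n"
          using i unfolding r by (simp_all only: of_nat_le_iff of_nat_less_iff flip: of_nat_add)
        then have rr: "k * L \<le> r" "r < (k + 1) * L" using nL L2(2) by (auto simp: algebra_simps)
        have "r div L = k" by (rule div_nat_eqI) (use rr in \<open>auto simp: algebra_simps\<close>)
        moreover have "i mod int Q = i" using rr kLQ by (simp add: r)
        ultimately show "E - l * a'' i = b i" using k(1) by (simp add: a''_def a'_def b_def r)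
      qed
      also have "\<dots> = tm b (int ?j) P ^ m" by (rule tm_power) (rule bper)
      finally have eq: "tm (\<lambda>i. E - l * a'' i) (int ?j) ?n = tm b (int ?j) P ^ m" .
      have "2 + 2 * \<kappa> \<le> \<bar>tr2 (tm b (int ?j) P)\<bar>" using trb tr2_tm_shift[of b P "int ?j"] bper by metis
      then have "2 * B \<le> \<bar>tr2 (tm (\<lambda>i. E - l * a'' i) (int ?j) ?n)\<bar>"
        unfolding eq B_def using tr2_power_growth[OF det2_tm less_imp_le[OF \<kappa>]] by blast
      moreover have "?j + ?n < Q"
        using nL L2(2) kLQ by (simp add: algebra_simps)
      moreover have "0 < ?n" using P Mm by (simp add: M_def)
      ultimately show ?thesis by (intro exI[of _ ?j] exI[of _ ?n]) simp
    qed
    then have "emeasure lborel {E. \<bar>E\<bar> \<le> R \<and> \<bar>tr2 (tm (\<lambda>i. E - l * a'' i) 0 Q)\<bar> \<le> 2 + \<eta> ^ Q}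
       \<le> ennreal (2 * real Q * h + 4 * real Q * \<eta>)"
      by (intro emeasure_bands_le[OF Q0 B(1) h(3,1,2) less_imp_le[OF \<eta>]])
    also have "\<dots> \<le> ennreal \<delta>" by (rule ennreal_leI[OF tot])
    finally show ?thesis .
  qed
  show ?thesis
    by (rule bexI[OF _ Q(1)], rule conjI, use Q(2) in simp, rule exI[of _ a''], rule exI[of _ "\<eta> ^ Q"])
      (use per'' close meas \<eta> in simp)
qed

subsection \<open>Open subgroups and orbits of a minimal translation\<close>

definition open_subgroup :: "'a::topological_group_add set \<Rightarrow> bool" where
  "open_subgroup K \<longleftrightarrow> open K \<and> 0 \<in> K \<and> (\<forall>x\<in>K. \<forall>y\<in>K. x - y \<in> K)"

lemma open_subgroup_add: "open_subgroup K \<Longrightarrow> x \<in> K \<Longrightarrow> y \<in> K \<Longrightarrow> x + y \<in> K"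
  unfolding open_subgroup_def by (metis diff_0 diff_minus_eq_add)

lemma open_subgroup_diff: "open_subgroup K \<Longrightarrow> x \<in> K \<Longrightarrow> y \<in> K \<Longrightarrow> x - y \<in> K"
  by (simp add: open_subgroup_def)

lemma open_subgroup_uminus: "open_subgroup K \<Longrightarrow> x \<in> K \<Longrightarrow> - x \<in> K"
  unfolding open_subgroup_def by (metis diff_0)

lemma open_subgroup_Inter:
  assumes "finite F" "\<And>i. i \<in> F \<Longrightarrow> open_subgroup (K i)"
  shows "open_subgroup (\<Inter>i\<in>F. K i)"
  using assms by (auto simp: open_subgroup_def)

lemma diff_diff_cancel_right: "(a - x) - (b - x) = a - (b::'a::group_add)"
  by (simp add: diff_conv_add_uminus minus_add add.assoc del: add_uminus_conv_diff)

lemma diff_add_diff: "(a - x) + (x - b) = a - (b::'a::group_add)"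
  by (simp add: diff_conv_add_uminus add.assoc del: add_uminus_conv_diff)

lemma open_coset_left:
  fixes x :: "'a::{topological_group_add}"
  assumes "open U" shows "open {y. y - x \<in> U}"
  using open_vimage[OF assms, of "\<lambda>y. y - x"] by (simp add: vimage_def continuous_on_diff continuous_on_id)

lemma open_coset_right:
  fixes x :: "'a::{topological_group_add}"
  assumes "open U" shows "open {y. x - y \<in> U}"
  using open_vimage[OF assms, of "\<lambda>y. x - y"] by (simp add: vimage_def continuous_on_diff continuous_on_id)

lemma open_translate_right:
  fixes x :: "'a::{topological_group_add}"
  assumes "open U" shows "open {y. y + x \<in> U}"
  using open_vimage[OF assms, of "\<lambda>y. y + x"] by (simp add: vimage_def continuous_on_add continuous_on_id)

text \<open>A basic neighbourhood of the identity in a product of discrete groups restricts finitely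
  many coordinates. The kernels of these coordinate maps are open subgroups, and their intersection
  fits inside.\<close>

lemma procyclic_open_subgroup_base:
  fixes U :: "'a::{topological_group_add, t2_space} set"
  assumes pc: "procyclic TYPE('a) TYPE('i) TYPE('g)" and U: "open U" "0 \<in> U"
  shows "\<exists>K. open_subgroup K \<and> K \<subseteq> U"
proof -
  obtain I :: "'i set" and below and G :: "'i \<Rightarrow> 'g monoid" and p and h :: "'a \<Rightarrow> 'i \<Rightarrow> 'g" where
    inv: "inverse_system I below G p" and h: "h \<in> iso additive_group (inverse_limit_group I below G p)"
    and hom: "homeomorphic_map euclidean (inverse_limit_topology I below G p) h"
    using pc unfolding procyclic_def by blast
  let ?C = "inverse_limit_carrier I below G p"
  have grp: "group (G i)" if "i \<in> I" for i using inv that by (simp add: inverse_system_def)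
  have bij: "bij_betw h UNIV ?C"
    using h by (auto simp: iso_def additive_group_def inverse_limit_group_def)
  have hC: "h x \<in> ?C" for x using bij by (auto simp: bij_betw_def)
  have hc: "h x i \<in> carrier (G i)" if "i \<in> I" for x i
    using hC[of x] that by (auto simp: inverse_limit_carrier_def)
  have mult: "h (x + y) i = h x i \<otimes>\<^bsub>G i\<^esub> h y i" if "i \<in> I" for x y i
  proof -
    have "h (x + y) = h x \<otimes>\<^bsub>inverse_limit_group I below G p\<^esub> h y"
      using h by (auto simp: iso_def hom_def additive_group_def)
    also have "\<dots> = (\<lambda>i\<in>I. h x i \<otimes>\<^bsub>G i\<^esub> h y i)" by (simp add: inverse_limit_group_def product_group_def)
    finally show ?thesis using that by simp
  qed
  have zero: "h 0 i = \<one>\<^bsub>G i\<^esub>" if "i \<in> I" for i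
  proof -
    interpret group "G i" by (rule grp[OF that])
    show ?thesis using mult[OF that, of 0 0] hc[OF that, of 0] by (metis add_0 l_cancel_one')
  qed
  have cont: "continuous_map euclidean (discrete_topology (carrier (G i))) (\<lambda>x. h x i)" if "i \<in> I" for i
  proof -
    have "continuous_map euclidean (product_topology (\<lambda>i. discrete_topology (carrier (G i))) I) h"
      using homeomorphic_imp_continuous_map[OF hom] unfolding inverse_limit_topology_def
      by (rule continuous_map_into_fulltopology)
    then show ?thesis using that by (simp add: continuous_map_componentwise)
  qed
  have ker: "open_subgroup {x. h x i = \<one>\<^bsub>G i\<^esub>}" if "i \<in> I" for i
    unfolding open_subgroup_def
  proof (intro conjI ballI)
    interpret group "G i" by (rule grp[OF that])
    have "openin euclidean {x \<in> topspace euclidean. h x i \<in> {\<one>\<^bsub>G i\<^esub>}}"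
      by (rule openin_continuous_map_preimage[OF cont[OF that]]) simp
    then show "open {x. h x i = \<one>\<^bsub>G i\<^esub>}" by simp
    show "0 \<in> {x. h x i = \<one>\<^bsub>G i\<^esub>}" using zero that by simp
    fix x y assume xy: "x \<in> {x. h x i = \<one>\<^bsub>G i\<^esub>}" "y \<in> {x. h x i = \<one>\<^bsub>G i\<^esub>}"
    have "h (x - y + y) i = h (x - y) i \<otimes>\<^bsub>G i\<^esub> h y i" by (rule mult[OF that])
    then show "x - y \<in> {x. h x i = \<one>\<^bsub>G i\<^esub>}" using xy hc[OF that, of "x - y"] by simp
  qed
  have "openin (inverse_limit_topology I below G p) (h ` U)"
    using homeomorphic_map_openness_eq[OF hom] U by simp
  then obtain W where W: "openin (product_topology (\<lambda>i. discrete_topology (carrier (G i))) I) W" "h ` U = W \<inter> ?C"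
    unfolding inverse_limit_topology_def openin_subtopology by blast
  have "h 0 \<in> W" using W U by blast
  then obtain V where V: "finite {i \<in> I. V i \<noteq> carrier (G i)}" "h 0 \<in> Pi\<^sub>E I V" "Pi\<^sub>E I V \<subseteq> W"
    using W(1) unfolding openin_product_topology_alt by (auto dest!: bspec)
  let ?F = "{i \<in> I. V i \<noteq> carrier (G i)}"
  let ?K = "\<Inter>i\<in>?F. {x. h x i = \<one>\<^bsub>G i\<^esub>}"
  have "open_subgroup ?K" by (rule open_subgroup_Inter[OF V(1)]) (use ker in auto)
  moreover have "?K \<subseteq> U"
  proof
    fix x assume x: "x \<in> ?K"
    have "h x i \<in> V i" if i: "i \<in> I" for i
    proof (cases "V i = carrier (G i)")
      case True then show ?thesis using hc i by simp
    next
      case False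
      then have "h x i = h 0 i" using x i zero by auto
      then show ?thesis using V(2) i by (auto simp: PiE_iff)
    qed
    moreover have "h x \<in> extensional I" using hC[of x] by (auto simp: inverse_limit_carrier_def PiE_iff)
    ultimately have "h x \<in> Pi\<^sub>E I V" by (simp add: PiE_iff)
    then have "h x \<in> W" using V(3) by blast
    then have "h x \<in> h ` U" using W(2) hC by blast
    then show "x \<in> U" using bij by (auto simp: bij_betw_def inj_on_def)
  qed
  ultimately show ?thesis by blast
qed

lemma int_iter_Suc:
  assumes "bij T" shows "int_iter T (n + 1) x = T (int_iter T n x)"
proof (cases "0 \<le> n")
  case True
  then have "nat (n + 1) = Suc (nat n)" by simp
  then show ?thesis using True by (simp add: int_iter_def)
next
  case False
  then obtain k where k: "nat (- n) = Suc k" by (metis gr0_implies_Suc neg_0_less_iff_less not_le zero_less_nat_eq)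
  then have n: "n = - int k - 1" by linarith
  have "T (int_iter T n x) = (inv_into UNIV T ^^ k) x"
    using False k bij_is_surj[OF assms] by (simp add: int_iter_def surj_f_inv_f)
  also have "\<dots> = int_iter T (n + 1) x"
  proof (cases k)
    case (Suc j)
    then have "\<not> 0 \<le> n + 1" "nat (- (n + 1)) = k" using n by auto
    then show ?thesis by (simp add: int_iter_def)
  qed (simp add: int_iter_def n)
  finally show ?thesis by simp
qed

lemma int_iter_0 [simp]: "int_iter T 0 x = x" by (simp add: int_iter_def)

lemma int_iter_of_nat: "int_iter T (int n) x = (T ^^ n) x" by (simp add: int_iter_def)

lemma int_iter_add:
  assumes "bij T" shows "int_iter T (m + n) x = int_iter T m (int_iter T n x)"
proof (induction m rule: int_induct[where k = 0])
  case (step1 i)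
  then show ?case using int_iter_Suc[OF assms, of "i + n" x] int_iter_Suc[OF assms, of i]
    by (simp add: algebra_simps)
next
  case (step2 i)
  have "T (int_iter T (i - 1 + n) x) = T (int_iter T (i - 1) (int_iter T n x))"
    using step2 int_iter_Suc[OF assms, of "i - 1 + n" x] int_iter_Suc[OF assms, of "i - 1"]
    by (simp add: algebra_simps)
  then show ?case using bij_is_inj[OF assms] by (simp add: inj_eq)
qed simp

text \<open>From procyclicity the argument takes compactness and a neighbourhood base of open
  subgroups at 0.\<close>

locale minimal_translation =
  fixes T :: "'a::{topological_group_add, t2_space} \<Rightarrow> 'a" and \<omega>\<^sub>0
  assumes T: "T \<omega> = \<omega> + \<omega>\<^sub>0" and compact: "compact (UNIV :: 'a set)"
    and base: "open U \<Longrightarrow> 0 \<in> U \<Longrightarrow> \<exists>K::'a set. open_subgroup K \<and> K \<subseteq> U"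
    and inf: "infinite (UNIV :: 'a set)" and minimal: "minimal T"
begin

lemma bij_T: "bij T"
  by (rule bij_betw_byWitness[where f' = "\<lambda>\<omega>. \<omega> - \<omega>\<^sub>0"]) (auto simp: T)

definition \<tau> :: "int \<Rightarrow> 'a" where "\<tau> n = int_iter T n 0"

text \<open>Right translation does not change \<open>x - y\<close>, hence preserves the relation of
  lying in the same coset.\<close>

lemma int_iter_diff: "int_iter T n x - int_iter T n y = x - y"
proof (induction n rule: int_induct[where k = 0])
  case (step1 i)
  have "T a - T b = a - b" for a b
    by (simp add: T diff_conv_add_uminus minus_add add.assoc del: add_uminus_conv_diff)
  then show ?case using step1 by (simp add: int_iter_Suc[OF bij_T])
next
  case (step2 i)
  have "T a - T b = a - b" for a b
    by (simp add: T diff_conv_add_uminus minus_add add.assoc del: add_uminus_conv_diff)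
  then show ?case using step2 int_iter_Suc[OF bij_T, of "i - 1"] by (metis diff_add_cancel)
qed simp

lemma \<tau>_0: "\<tau> 0 = 0"
  by (simp add: \<tau>_def)

lemma \<tau>_add: "\<tau> (n + m) = int_iter T n (\<tau> m)"
  by (simp add: \<tau>_def int_iter_add[OF bij_T])

lemma \<tau>_diff: "\<tau> m - \<tau> n = \<tau> (m - n)"
  using \<tau>_add[of n "m - n"] int_iter_diff[of n "\<tau> (m - n)" 0] by (simp add: \<tau>_def)

lemma orbit_meets_coset:
  assumes "open_subgroup K" shows "\<exists>n. \<tau> n - x \<in> K"
proof -
  have "open {y. y - x \<in> K}" using assms by (simp add: open_coset_left open_subgroup_def)
  moreover have "x \<in> {y. y - x \<in> K}" using assms by (simp add: open_subgroup_def)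
  moreover have "x \<in> closure (range \<tau>)"
    using minimal unfolding minimal_def \<tau>_def[abs_def] by blast
  ultimately have "{y. y - x \<in> K} \<inter> range \<tau> \<noteq> {}"
    using open_Int_closure_eq_empty by blast
  then show ?thesis by auto
qed

definition index :: "'a set \<Rightarrow> nat" where
  "index K = (LEAST q. 0 < q \<and> \<tau> (int q) \<in> K)"

text \<open>By compactness finitely many orbit points represent all cosets. A time \<open>N\<close>
  beyond all of theirs shares its coset with one of them, and the difference of the two times is a
  positive return time.\<close>

lemma index_props:
  assumes K: "open_subgroup K" shows "0 < index K \<and> \<tau> (int (index K)) \<in> K"
proof -
  have "UNIV \<subseteq> (\<Union>n. {y. \<tau> n - y \<in> K})" using orbit_meets_coset[OF K] by auto
  then obtain C where C: "finite C" "UNIV \<subseteq> (\<Union>n\<in>C. {y. \<tau> n - y \<in> K})"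
    using compactE_image[OF compact, of UNIV "\<lambda>n. {y. \<tau> n - y \<in> K}"] K
    by (metis open_coset_right open_subgroup_def)
  define N where "N = Max (insert 0 C) + 1"
  have N: "n < N" if "n \<in> C" for n using Max_ge[of "insert 0 C" n] C(1) that by (simp add: N_def)
  obtain n where n: "n \<in> C" "\<tau> n - \<tau> N \<in> K" using C(2) by blast
  have "\<tau> N - \<tau> n \<in> K" using open_subgroup_uminus[OF K n(2)] by simp
  then have "0 < nat (N - n) \<and> \<tau> (int (nat (N - n))) \<in> K" using N[OF n(1)] by (simp add: \<tau>_diff)
  then show ?thesis unfolding index_def by (rule LeastI)
qed

lemma \<tau>_mult_in:
  assumes K: "open_subgroup K" and q: "\<tau> q \<in> K" shows "\<tau> (q * k) \<in> K"
proof (induction k rule: int_induct[where k = 0])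
  case base
  show ?case using K by (simp add: \<tau>_0 open_subgroup_def)
next
  case (step1 i)
  have "\<tau> (q * (i + 1)) = \<tau> (q * i) - (0 - \<tau> q)"
    using \<tau>_diff[of 0 q] \<tau>_diff[of "q * i" "- q"] by (simp add: \<tau>_0 distrib_left)
  then show ?case using step1 q K by (simp add: open_subgroup_add)
next
  case (step2 i)
  have "\<tau> (q * (i - 1)) = \<tau> (q * i) - \<tau> q" by (simp add: \<tau>_diff right_diff_distrib)
  then show ?case using step2 q K by (simp add: open_subgroup_diff)
qed

lemma \<tau>_in_iff:
  assumes K: "open_subgroup K" shows "\<tau> n \<in> K \<longleftrightarrow> int (index K) dvd n"
proof
  let ?q = "int (index K)"
  assume n: "\<tau> n \<in> K"
  have "\<tau> (n - ?q * (n div ?q)) \<in> K"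
    using open_subgroup_diff[OF K n \<tau>_mult_in[OF K]] index_props[OF K] by (simp add: \<tau>_diff)
  then have r: "\<tau> (int (nat (n mod ?q))) \<in> K"
    using index_props[OF K] by (simp add: minus_mult_div_eq_mod)
  have "nat (n mod ?q) < index K" using index_props[OF K] by (simp add: nat_less_iff)
  then have "\<not> (0 < nat (n mod ?q) \<and> \<tau> (int (nat (n mod ?q))) \<in> K)"
    by (intro not_less_Least) (simp only: index_def[symmetric])
  then have "\<not> 0 < nat (n mod ?q)" using r by (simp del: zero_less_nat_eq nat_0_iff)
  moreover have "0 \<le> n mod ?q" using index_props[OF K] by simp
  ultimately have "n mod ?q = 0" by simp
  then show "?q dvd n" by (simp add: dvd_eq_mod_eq_0)
next
  assume "int (index K) dvd n"
  then show "\<tau> n \<in> K" using \<tau>_mult_in[OF K] index_props[OF K] by (metis dvdE)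
qed

text \<open>The first return times to open subgroups: each sequence with such a period extends
  continuously from the orbit of 0 to the group.\<close>

definition admissible :: "nat set" where "admissible = {index K | K. open_subgroup K}"

lemma admissible_pos: "q \<in> admissible \<Longrightarrow> 0 < q"
  using index_props by (auto simp: admissible_def)

text \<open>The extension is constant on cosets. It is well defined because two orbit times in the
  same coset differ by a multiple of the period.\<close>

lemma periodic_extension:
  fixes V :: "int \<Rightarrow> real"
  assumes q: "q \<in> admissible" and V: "\<And>n. V (n + int q) = V n"
  obtains g :: "'a \<Rightarrow>\<^sub>C real" where "\<And>n. apply_bcontfun g (\<tau> n) = V n"
proof -
  obtain K where K: "open_subgroup K" "q = index K" using q by (auto simp: admissible_def)
  define g where "g x = V (SOME n. \<tau> n - x \<in> K)" for x
  have g: "g x = V n" if n: "\<tau> n - x \<in> K" for x n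
  proof -
    define m where "m = (SOME n. \<tau> n - x \<in> K)"
    have "\<tau> m - x \<in> K" unfolding m_def using n by (rule someI)
    then have "\<tau> m - x - (\<tau> n - x) \<in> K" by (rule open_subgroup_diff[OF K(1) _ n])
    then have "\<tau> (m - n) \<in> K" by (simp only: diff_diff_cancel_right \<tau>_diff)
    then obtain k where "m = n + int q * k" using \<tau>_in_iff[OF K(1)] K(2) by (auto simp: dvd_def algebra_simps)
    then show ?thesis unfolding g_def m_def[symmetric] using periodic_int_mult[of V "int q" n k, OF V] by simp
  qed
  have "continuous_on UNIV g"
    unfolding continuous_on_def
  proof
    fix x
    obtain n where n: "\<tau> n - x \<in> K" using orbit_meets_coset[OF K(1)] by blast
    have o: "open {y. x - y \<in> K}" "x \<in> {y. x - y \<in> K}" using K by (auto simp: open_coset_right open_subgroup_def)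
    have eq: "g y = g x" if "y \<in> {y. x - y \<in> K}" for y
      using g[OF n] g[of n y] open_subgroup_add[OF K(1) n, of "x - y"] that by (simp add: diff_add_diff)
    have "eventually (\<lambda>y. g y = g x) (at x)"
      unfolding eventually_at_topological using o eq by blast
    then show "(g \<longlongrightarrow> g x) (at x within UNIV)" by (simp add: tendsto_eventually)
  qed
  moreover have "bounded (range g)"
    using compact_imp_bounded compact_continuous_image[OF calculation compact] by blast
  ultimately have "g \<in> bcontfun" by (simp add: bcontfun_def)
  then have "apply_bcontfun (Bcontfun g) = g" by (rule Bcontfun_inverse)
  moreover have "g (\<tau> n) = V n" for n using g[of n "\<tau> n"] K by (simp add: open_subgroup_def)
  ultimately show ?thesis using that[of "Bcontfun g"] by simp
qed

text \<open>A Lebesgue number argument with cosets as the cover. As the neighbourhoods are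
  subgroups, \<open>a\<close> lies in the same coset as \<open>b\<close> without any
  shrinking.\<close>

lemma uniform_continuity:
  fixes f :: "'a \<Rightarrow> real"
  assumes f: "continuous_on UNIV f" and \<epsilon>: "0 < \<epsilon>"
  shows "\<exists>K. open_subgroup K \<and> (\<forall>a b. a - b \<in> K \<longrightarrow> \<bar>f a - f b\<bar> < \<epsilon>)"
proof -
  have "\<exists>K. open_subgroup K \<and> (\<forall>k\<in>K. \<bar>f (k + x) - f x\<bar> < \<epsilon> / 2)" for x
  proof -
    have "open {y. \<bar>f y - f x\<bar> < \<epsilon> / 2}" using f by (intro open_Collect_less continuous_intros)
    then have "open {k. k + x \<in> {y. \<bar>f y - f x\<bar> < \<epsilon> / 2}}" by (rule open_translate_right)
    then show ?thesis using base[of "{k. k + x \<in> {y. \<bar>f y - f x\<bar> < \<epsilon> / 2}}"] \<epsilon> by auto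
  qed
  then obtain K where K: "\<And>x. open_subgroup (K x)" "\<And>x k. k \<in> K x \<Longrightarrow> \<bar>f (k + x) - f x\<bar> < \<epsilon> / 2" by metis
  have "UNIV \<subseteq> (\<Union>x. {y. y - x \<in> K x})"
  proof
    fix x show "x \<in> (\<Union>x. {y. y - x \<in> K x})"
      by (rule UN_I[of x]) (use K(1)[of x] in \<open>auto simp: open_subgroup_def\<close>)
  qed
  note cover = this
  have op: "open {y. y - x \<in> K x}" if "x \<in> UNIV" for x
    using K(1)[of x] by (intro open_coset_left) (simp add: open_subgroup_def)
  obtain C where C: "C \<subseteq> UNIV" "finite C" "UNIV \<subseteq> (\<Union>x\<in>C. {y. y - x \<in> K x})"
    by (rule compactE_image[OF compact op cover])
  have "\<bar>f a - f b\<bar> < \<epsilon>" if ab: "a - b \<in> (\<Inter>x\<in>C. K x)" for a b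
  proof -
    obtain x where x: "x \<in> C" "b - x \<in> K x" using C(3) by blast
    have "a - x \<in> K x" using open_subgroup_add[OF K(1), of "a - b" x "b - x"] ab x by (auto simp: diff_add_diff)
    then show ?thesis using K(2)[of "a - x" x] K(2)[of "b - x" x] x(2) by (simp add: abs_if field_simps split: if_splits)
  qed
  then show ?thesis using open_subgroup_Inter[OF C(2), of K] K(1) by blast
qed

lemma periodic_approximation:
  fixes f :: "'a \<Rightarrow> real"
  assumes "continuous_on UNIV f" "0 < \<epsilon>"
  shows "\<exists>q\<in>admissible. \<exists>V. (\<forall>n. V (n + int q) = V n) \<and> (\<forall>n. \<bar>f (\<tau> n) - V n\<bar> < \<epsilon>)"
proof -
  obtain K where K: "open_subgroup K" "\<And>a b. a - b \<in> K \<Longrightarrow> \<bar>f a - f b\<bar> < \<epsilon>"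
    using uniform_continuity[OF assms] by blast
  let ?q = "int (index K)"
  have "\<tau> n - \<tau> (n mod ?q) \<in> K" for n
    unfolding \<tau>_diff \<tau>_in_iff[OF K(1)] by (metis dvd_minus_mod)
  then have "\<bar>f (\<tau> n) - f (\<tau> (n mod ?q))\<bar> < \<epsilon>" for n by (rule K(2))
  then show ?thesis
    by (intro bexI[of _ "index K"] exI[of _ "\<lambda>n. f (\<tau> (n mod ?q))"]) (use K(1) in \<open>auto simp: admissible_def\<close>)
qed

text \<open>Starting from an orbit point of 0 in the coset of \<omega>, the two orbits stay in
  common cosets forever. Every base point is thus reduced to a shift of one sequence.\<close>

lemma orbit_approximation:
  fixes f :: "'a \<Rightarrow> real"
  assumes "continuous_on UNIV f" "0 < \<epsilon>"
  shows "\<exists>m. \<forall>n. \<bar>f (int_iter T n \<omega>) - f (\<tau> (n + m))\<bar> < \<epsilon>"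
proof -
  obtain K where K: "open_subgroup K" "\<And>a b. a - b \<in> K \<Longrightarrow> \<bar>f a - f b\<bar> < \<epsilon>"
    using uniform_continuity[OF assms] by blast
  obtain m where m: "\<tau> m - \<omega> \<in> K" using orbit_meets_coset[OF K(1)] by blast
  have "\<tau> (n + m) - int_iter T n \<omega> \<in> K" for n using m by (simp add: \<tau>_add int_iter_diff)
  then show ?thesis using K(2) by (metis abs_minus_commute)
qed

text \<open>Infinitude enters here: take \<open>N\<close> distinct points and shrink
  \<open>K\<close> to an open subgroup separating them. They then meet the orbit at times in
  distinct residue classes modulo the new period, which is therefore at least
  \<open>N\<close>.\<close>

lemma admissible_multiple:
  assumes p: "p \<in> admissible" shows "\<exists>q\<in>admissible. N \<le> q \<and> p dvd q"
proof -
  obtain K where K: "open_subgroup K" "p = index K" using p by (auto simp: admissible_def)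
  obtain X :: "'a set" where X: "finite X" "card X = N" using infinite_arbitrarily_large[OF inf] by blast
  have "\<exists>H. open_subgroup H \<and> (x \<noteq> y \<longrightarrow> x - y \<notin> H)" for x y :: 'a
  proof (cases "x = y")
    case False
    then have "open (- {x - y})" "0 \<in> - {x - y}" by (auto simp: open_Compl)
    then show ?thesis using base[of "- {x - y}"] by blast
  qed (use K in blast)
  note ex = this
  define H where "H x y = (SOME H. open_subgroup H \<and> (x \<noteq> y \<longrightarrow> x - y \<notin> H))" for x y :: 'a
  have "open_subgroup (H x y) \<and> (x \<noteq> y \<longrightarrow> x - y \<notin> H x y)" for x y
    unfolding H_def by (rule someI_ex[OF ex])
  then have H: "\<And>x y. open_subgroup (H x y)" "\<And>x y. x \<noteq> y \<Longrightarrow> x - y \<notin> H x y" by blast+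
  define K' where "K' = (\<Inter>z\<in>insert None (Some ` (X \<times> X)). case z of None \<Rightarrow> K | Some (x, y) \<Rightarrow> H x y)"
  have K': "open_subgroup K'"
    unfolding K'_def by (rule open_subgroup_Inter) (use X K H in \<open>auto split: option.splits\<close>)
  have K'K: "K' \<subseteq> K" and K'H: "\<And>x y. x \<in> X \<Longrightarrow> y \<in> X \<Longrightarrow> K' \<subseteq> H x y"
    unfolding K'_def by (auto dest!: bspec)
  let ?q = "index K'"
  have "p dvd ?q" using \<tau>_in_iff[OF K(1), of "int ?q"] index_props[OF K'] K'K K(2) by auto
  moreover have "N \<le> ?q"
  proof -
    define r where "r x = nat ((SOME n. \<tau> n - x \<in> K') mod int ?q)" for x
    have some: "\<tau> (SOME n. \<tau> n - x \<in> K') - x \<in> K'" for x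
      using orbit_meets_coset[OF K'] by (rule someI_ex)
    have "inj_on r X"
    proof (rule inj_onI, rule ccontr)
      fix x y assume xy: "x \<in> X" "y \<in> X" "r x = r y" "x \<noteq> y"
      define n where "n = (SOME n. \<tau> n - x \<in> K')"
      define m where "m = (SOME n. \<tau> n - y \<in> K')"
      have "0 \<le> n mod int ?q" "0 \<le> m mod int ?q" using index_props[OF K'] by simp_all
      moreover have "nat (n mod int ?q) = nat (m mod int ?q)"
        using xy(3) unfolding r_def n_def[symmetric] m_def[symmetric] .
      ultimately have "n mod int ?q = m mod int ?q" by simp
      then have "\<tau> n - \<tau> m \<in> K'" unfolding \<tau>_diff \<tau>_in_iff[OF K'] by (simp add: mod_eq_dvd_iff)
      then have "(\<tau> n - \<tau> m) + (\<tau> m - y) \<in> K'" using some[of y] open_subgroup_add[OF K'] by (simp add: m_def)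
      then have "\<tau> n - y \<in> K'" by (simp add: diff_add_diff)
      then have "- (\<tau> n - x) + (\<tau> n - y) \<in> K'"
        using some[of x] open_subgroup_add[OF K'] open_subgroup_uminus[OF K'] unfolding n_def by blast
      moreover have "- (\<tau> n - x) + (\<tau> n - y) = x - y" by (simp add: diff_add_diff)
      ultimately show False using K'H[OF xy(1,2)] H(2)[OF xy(4)] by auto
    qed
    moreover have "r ` X \<subseteq> {..<?q}" using index_props[OF K'] by (auto simp: r_def nat_less_iff)
    ultimately have "card X \<le> card {..<?q}" by (rule card_inj_on_le) simp
    then show ?thesis using X by simp
  qed
  ultimately show ?thesis using K' by (auto simp: admissible_def)
qed

lemma dist_le_of_orbit:
  fixes f g :: "'a \<Rightarrow>\<^sub>C real"
  assumes "\<And>n. \<bar>apply_bcontfun f (\<tau> n) - apply_bcontfun g (\<tau> n)\<bar> \<le> c"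
  shows "dist f g \<le> c"
proof (rule dist_bound)
  fix x
  have "continuous_on UNIV (apply_bcontfun f)" "continuous_on UNIV (apply_bcontfun g)"
    using apply_bcontfun[of f] apply_bcontfun[of g] by (auto simp: bcontfun_def)
  then have "closed {x. \<bar>apply_bcontfun f x - apply_bcontfun g x\<bar> \<le> c}"
    by (intro closed_Collect_le continuous_intros)
  then have "closure (range \<tau>) \<subseteq> {x. \<bar>apply_bcontfun f x - apply_bcontfun g x\<bar> \<le> c}"
    using assms by (intro closure_minimal) auto
  moreover have "closure (range \<tau>) = UNIV" using minimal unfolding minimal_def \<tau>_def[abs_def] by blast
  ultimately show "dist (apply_bcontfun f x) (apply_bcontfun g x) \<le> c" by (auto simp: dist_real_def)
qed

end

subsection \<open>The Hilbert space of square-summable sequences\<close>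

lemma ell2I_bounded:
  assumes "\<And>F. finite F \<Longrightarrow> (\<Sum>i\<in>F. (cmod (x i))\<^sup>2) \<le> C"
  shows "x \<in> ell2" "(\<Sum>\<^sub>\<infinity>i. (cmod (x i))\<^sup>2) \<le> C"
proof -
  show s: "x \<in> ell2"
    unfolding ell2_def mem_Collect_eq
  proof (rule nonneg_bdd_above_summable_on)
    show "bdd_above (sum (\<lambda>i. (cmod (x i))\<^sup>2) ` {F. F \<subseteq> UNIV \<and> finite F})"
      using assms by (intro bdd_aboveI2[where M = C]) auto
  qed auto
  show "(\<Sum>\<^sub>\<infinity>i. (cmod (x i))\<^sup>2) \<le> C"
    using s assms by (intro infsum_le_finite_sums) (auto simp: ell2_def)
qed

lemma ell2_comparison: "y \<in> ell2 \<Longrightarrow> (\<And>i. cmod (x i) \<le> cmod (y i)) \<Longrightarrow> x \<in> ell2"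
  unfolding ell2_def mem_Collect_eq
  by (rule summable_on_comparison_test[of "\<lambda>i. (cmod (y i))\<^sup>2"]) (auto intro: power_mono)

lemma ell2_add: assumes "x \<in> ell2" "y \<in> ell2" shows "(\<lambda>i. x i + y i) \<in> ell2"
proof -
  have "(\<lambda>i. 2 * (cmod (x i))\<^sup>2 + 2 * (cmod (y i))\<^sup>2) summable_on UNIV"
    using assms by (intro summable_on_add summable_on_cmult_right) (auto simp: ell2_def)
  moreover have "(cmod (x i + y i))\<^sup>2 \<le> 2 * (cmod (x i))\<^sup>2 + 2 * (cmod (y i))\<^sup>2" for i
  proof -
    have "(cmod (x i + y i))\<^sup>2 \<le> (cmod (x i) + cmod (y i))\<^sup>2"
      by (intro power_mono norm_triangle_ineq) auto
    also have "\<dots> \<le> 2 * (cmod (x i))\<^sup>2 + 2 * (cmod (y i))\<^sup>2"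
      using zero_le_power2[of "cmod (x i) - cmod (y i)"] by (simp add: power2_eq_square algebra_simps)
    finally show ?thesis .
  qed
  ultimately show ?thesis
    unfolding ell2_def mem_Collect_eq by (rule summable_on_comparison_test) auto
qed

lemma ell2_cmult: "x \<in> ell2 \<Longrightarrow> (\<lambda>i. c * x i) \<in> ell2"
  unfolding ell2_def mem_Collect_eq norm_mult power_mult_distrib by (rule summable_on_cmult_right)

lemma ell2_mult_bounded:
  assumes "x \<in> ell2" "\<And>i. cmod (c i) \<le> M" shows "(\<lambda>i. c i * x i) \<in> ell2"
proof (rule ell2_comparison[OF ell2_cmult[OF assms(1), of "of_real M"]])
  fix i
  have "0 \<le> M" using assms(2)[of i] norm_ge_zero order_trans by blast
  then show "cmod (c i * x i) \<le> cmod (of_real M * x i)"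
    using assms(2) by (simp add: norm_mult mult_right_mono)
qed

lemma bij_int_add: "bij (\<lambda>i. i + k :: int)"
  by (rule bij_betw_byWitness[where f' = "\<lambda>i. i - k"]) auto

lemma ell2_shift: "x \<in> ell2 \<Longrightarrow> (\<lambda>i. x (i + k)) \<in> ell2"
  unfolding ell2_def mem_Collect_eq
  using summable_on_reindex_bij_betw[OF bij_int_add, of "\<lambda>i. (cmod (x i))\<^sup>2" k] by simp

text \<open>As a type, the space can join the classes of real inner product and complete spaces. Its
  \<open>inner\<close> is the real part of the complex inner product, so complex scalars act by
  \<open>cscale_l2\<close>.\<close>

typedef l2 = ell2
  by (rule exI[of _ "\<lambda>_. 0"]) (simp add: ell2_def)

setup_lifting type_definition_l2

lemma l2_ext: "(\<And>i. Rep_l2 x i = Rep_l2 y i) \<Longrightarrow> x = y"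
  by (simp add: Rep_l2_inject[symmetric] ext)

lemma summable_inner_ell2:
  assumes "x \<in> ell2" "y \<in> ell2" shows "(\<lambda>i. x i \<bullet> y i) summable_on UNIV"
proof (rule Infinite_Sum.abs_summable_summable, rule Infinite_Sum.abs_summable_on_comparison_test')
  show "(\<lambda>i. (cmod (x i))\<^sup>2 + (cmod (y i))\<^sup>2) summable_on UNIV"
    using assms by (intro summable_on_add) (auto simp: ell2_def)
  fix i
  have "\<bar>x i \<bullet> y i\<bar> \<le> cmod (x i) * cmod (y i)" by (rule Cauchy_Schwarz_ineq2)
  also have "\<dots> \<le> (cmod (x i))\<^sup>2 + (cmod (y i))\<^sup>2"
    using zero_le_power2[of "cmod (x i) - cmod (y i)"] zero_le_power2[of "cmod (x i)"] zero_le_power2[of "cmod (y i)"]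
    unfolding power2_diff by linarith
  finally show "norm (x i \<bullet> y i) \<le> (cmod (x i))\<^sup>2 + (cmod (y i))\<^sup>2" by simp
qed

instantiation l2 :: real_inner
begin

lift_definition zero_l2 :: l2 is "\<lambda>_. 0" by (simp add: ell2_def)
lift_definition plus_l2 :: "l2 \<Rightarrow> l2 \<Rightarrow> l2" is "\<lambda>x y i. x i + y i" by (rule ell2_add)
lift_definition uminus_l2 :: "l2 \<Rightarrow> l2" is "\<lambda>x i. - x i" by (simp add: ell2_def)
lift_definition minus_l2 :: "l2 \<Rightarrow> l2 \<Rightarrow> l2" is "\<lambda>x y i. x i - y i"
  using ell2_add[OF _ ell2_cmult, of _ _ "- 1"] by simp
lift_definition scaleR_l2 :: "real \<Rightarrow> l2 \<Rightarrow> l2" is "\<lambda>r x i. r *\<^sub>R x i"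
  unfolding scaleR_conv_of_real by (rule ell2_cmult)
lift_definition inner_l2 :: "l2 \<Rightarrow> l2 \<Rightarrow> real" is "\<lambda>x y. \<Sum>\<^sub>\<infinity>i. x i \<bullet> y i" .
definition norm_l2 :: "l2 \<Rightarrow> real" where "norm_l2 x = sqrt (inner x x)"
definition dist_l2 :: "l2 \<Rightarrow> l2 \<Rightarrow> real" where "dist_l2 x y = norm (x - y)"
definition sgn_l2 :: "l2 \<Rightarrow> l2" where "sgn_l2 x = inverse (norm x) *\<^sub>R x"
definition uniformity_l2 :: "(l2 \<times> l2) filter" where
  "uniformity_l2 = (INF e\<in>{0 <..}. principal {(x, y). dist x y < e})"
definition open_l2 :: "l2 set \<Rightarrow> bool" where
  "open_l2 U \<longleftrightarrow> (\<forall>x\<in>U. eventually (\<lambda>(x', y). x' = x \<longrightarrow> y \<in> U) uniformity)"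

instance
proof
  fix x y z :: l2 and a b :: real and U :: "l2 set"
  show "x + y + z = x + (y + z)" by transfer (simp add: add.assoc)
  show "x + y = y + x" by transfer (rule ext, rule add.commute)
  show "0 + x = x" by transfer simp
  show "- x + x = 0" by transfer simp
  show "x - y = x + - y" by transfer simp
  show "a *\<^sub>R (x + y) = a *\<^sub>R x + a *\<^sub>R y" by transfer (simp add: scaleR_add_right)
  show "(a + b) *\<^sub>R x = a *\<^sub>R x + b *\<^sub>R x" by transfer (simp add: scaleR_add_left)
  show "a *\<^sub>R b *\<^sub>R x = (a * b) *\<^sub>R x" by transfer simp
  show "1 *\<^sub>R x = x" by transfer simp
  show "dist x y = norm (x - y)" by (rule dist_l2_def)
  show "sgn x = inverse (norm x) *\<^sub>R x" by (rule sgn_l2_def)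
  show "uniformity = (INF e\<in>{0 <..}. principal {(x, y::l2). dist x y < e})" by (rule uniformity_l2_def)
  show "open U \<longleftrightarrow> (\<forall>x\<in>U. eventually (\<lambda>(x', y). x' = x \<longrightarrow> y \<in> U) uniformity)" by (rule open_l2_def)
  show "inner x y = inner y x" by transfer (simp add: inner_commute)
  show "inner (x + y) z = inner x z + inner y z"
    by transfer (simp add: inner_add_left infsum_add summable_inner_ell2)
  show "inner (a *\<^sub>R x) y = a * inner x y" by transfer (simp add: infsum_cmult_right')
  show "0 \<le> inner x x" by transfer (simp add: infsum_nonneg)
  show "inner x x = 0 \<longleftrightarrow> x = 0"
  proof
    assume "inner x x = 0"
    then show "x = 0"
    proof transfer
      fix x assume x: "x \<in> ell2" "(\<Sum>\<^sub>\<infinity>i. x i \<bullet> x i) = 0"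
      have "x i \<bullet> x i = 0" for i
        by (rule nonneg_infsum_le_0D[of "\<lambda>i. x i \<bullet> x i" UNIV]) (use x summable_inner_ell2 in auto)
      then show "x = (\<lambda>_. 0)" by auto
    qed
  qed (transfer, simp)
  show "norm x = sqrt (inner x x)" by (rule norm_l2_def)
qed

end

lemmas Rep_l2_arith [simp] = zero_l2.rep_eq plus_l2.rep_eq uminus_l2.rep_eq minus_l2.rep_eq scaleR_l2.rep_eq

lemma power2_norm_l2: "(norm x)\<^sup>2 = (\<Sum>\<^sub>\<infinity>i. (cmod (Rep_l2 x i))\<^sup>2)"
  by (simp add: power2_norm_eq_inner inner_l2.rep_eq)

lemma norm_l2_eq: "norm x = ell2_norm (Rep_l2 x)"
  by (simp add: ell2_norm_def power2_norm_l2[symmetric])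

lemma sum_le_norm_l2: "finite F \<Longrightarrow> (\<Sum>i\<in>F. (cmod (Rep_l2 x i))\<^sup>2) \<le> (norm x)\<^sup>2"
  unfolding power2_norm_l2 using Rep_l2[of x] by (intro finite_sum_le_infsum) (auto simp: ell2_def)

lemma cmod_le_norm_l2: "cmod (Rep_l2 x i) \<le> norm x"
  by (rule power2_le_imp_le) (use sum_le_norm_l2[of "{i}" x] in simp_all)

lemma norm_l2_le:
  assumes "\<And>F. finite F \<Longrightarrow> (\<Sum>i\<in>F. (cmod (Rep_l2 x i))\<^sup>2) \<le> c\<^sup>2" "0 \<le> c"
  shows "norm x \<le> c"
proof (rule power2_le_imp_le)
  show "(norm x)\<^sup>2 \<le> c\<^sup>2"
    unfolding power2_norm_l2 by (rule ell2I_bounded(2)) (rule assms(1))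
qed (rule assms(2))

lemma norm_l2_mono:
  assumes "\<And>i. cmod (Rep_l2 x i) \<le> cmod (Rep_l2 y i)" shows "norm x \<le> norm y"
proof (rule norm_l2_le)
  fix F :: "int set" assume "finite F"
  have "(\<Sum>i\<in>F. (cmod (Rep_l2 x i))\<^sup>2) \<le> (\<Sum>i\<in>F. (cmod (Rep_l2 y i))\<^sup>2)"
    using assms by (intro sum_mono power_mono) auto
  also have "\<dots> \<le> (norm y)\<^sup>2" by (rule sum_le_norm_l2) fact
  finally show "(\<Sum>i\<in>F. (cmod (Rep_l2 x i))\<^sup>2) \<le> (norm y)\<^sup>2" .
qed simp

text \<open>Pointwise limits exist, and the Cauchy estimates pass to the limit on finite sets of
  sites.\<close>

instance l2 :: complete_space
proof
  fix X :: "nat \<Rightarrow> l2" assume X: "Cauchy X"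
  have "Cauchy (\<lambda>n. Rep_l2 (X n) i)" for i
  proof (rule CauchyI)
    fix e :: real assume "0 < e"
    then obtain M where M: "\<And>m n. m \<ge> M \<Longrightarrow> n \<ge> M \<Longrightarrow> norm (X m - X n) < e" using X CauchyD by blast
    have "norm (Rep_l2 (X m) i - Rep_l2 (X n) i) < e" if "m \<ge> M" "n \<ge> M" for m n
      using cmod_le_norm_l2[of "X m - X n" i] M[OF that] by simp
    then show "\<exists>M. \<forall>m\<ge>M. \<forall>n\<ge>M. norm (Rep_l2 (X m) i - Rep_l2 (X n) i) < e" by blast
  qed
  then have "convergent (\<lambda>n. Rep_l2 (X n) i)" for i by (rule Cauchy_convergent)
  then obtain x where x: "\<And>i. (\<lambda>n. Rep_l2 (X n) i) \<longlonglongrightarrow> x i" unfolding convergent_def by metis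
  have le: "(\<Sum>i\<in>F. (cmod (Rep_l2 (X m) i - x i))\<^sup>2) \<le> e\<^sup>2"
    if "finite F" and e: "\<And>n. n \<ge> M \<Longrightarrow> norm (X m - X n) \<le> e" for F m e M
  proof (rule tendsto_le[OF _ tendsto_const])
    show "(\<lambda>n. \<Sum>i\<in>F. (cmod (Rep_l2 (X m) i - Rep_l2 (X n) i))\<^sup>2) \<longlonglongrightarrow> (\<Sum>i\<in>F. (cmod (Rep_l2 (X m) i - x i))\<^sup>2)"
      by (intro tendsto_intros x)
    have "(\<Sum>i\<in>F. (cmod (Rep_l2 (X m) i - Rep_l2 (X n) i))\<^sup>2) \<le> e\<^sup>2" if "n \<ge> M" for n
      using sum_le_norm_l2[OF \<open>finite F\<close>, of "X m - X n"] power_mono[OF e[OF that] norm_ge_zero, of 2] by simp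
    then show "\<forall>\<^sub>F n in sequentially. (\<Sum>i\<in>F. (cmod (Rep_l2 (X m) i - Rep_l2 (X n) i))\<^sup>2) \<le> e\<^sup>2"
      unfolding eventually_sequentially by blast
  qed simp
  obtain M1 where M1: "\<And>m n. m \<ge> M1 \<Longrightarrow> n \<ge> M1 \<Longrightarrow> norm (X m - X n) < 1"
    using X CauchyD[OF X, of 1] by auto
  have "(\<lambda>i. Rep_l2 (X M1) i - x i) \<in> ell2"
    by (rule ell2I_bounded(1)[where C = "1\<^sup>2"], rule le[where M = M1]) (use M1 in \<open>auto intro: less_imp_le\<close>)
  then have "(\<lambda>i. Rep_l2 (X M1) i + (- 1) * (Rep_l2 (X M1) i - x i)) \<in> ell2"
    by (intro ell2_add Rep_l2 ell2_cmult)
  then have xl: "x \<in> ell2" by simp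
  have "X \<longlonglongrightarrow> Abs_l2 x"
  proof (rule LIMSEQ_I)
    fix r :: real assume r: "0 < r"
    then obtain M where M: "\<And>m n. m \<ge> M \<Longrightarrow> n \<ge> M \<Longrightarrow> norm (X m - X n) < r / 2"
      using CauchyD[OF X, of "r / 2"] by auto
    have "norm (X n - Abs_l2 x) < r" if "n \<ge> M" for n
    proof -
      have "norm (X n - Abs_l2 x) \<le> r / 2"
      proof (rule norm_l2_le)
        fix F :: "int set" assume "finite F"
        then show "(\<Sum>i\<in>F. (cmod (Rep_l2 (X n - Abs_l2 x) i))\<^sup>2) \<le> (r / 2)\<^sup>2"
          using le[of F M n "r / 2"] M[OF that] by (simp add: Abs_l2_inverse[OF xl] less_imp_le)
      qed (use r in simp)
      then show ?thesis using r by simp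
    qed
    then show "\<exists>no. \<forall>n\<ge>no. norm (X n - Abs_l2 x) < r" by blast
  qed
  then show "convergent X" by (rule convergentI)
qed

instance l2 :: banach ..

lift_definition shift_l2 :: "int \<Rightarrow> l2 \<Rightarrow> l2" is "\<lambda>k x i. x (i + k)" by (rule ell2_shift)
lift_definition cscale_l2 :: "complex \<Rightarrow> l2 \<Rightarrow> l2" is "\<lambda>c x i. c * x i" by (rule ell2_cmult)
lift_definition cmod_l2 :: "l2 \<Rightarrow> l2" is "\<lambda>x i. of_real (cmod (x i))" by (simp add: ell2_def)

lemma norm_shift_l2 [simp]: "norm (shift_l2 k x) = norm x"
proof -
  have "(norm (shift_l2 k x))\<^sup>2 = (norm x)\<^sup>2"
    unfolding power2_norm_l2 shift_l2.rep_eq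
    using infsum_reindex_bij_betw[OF bij_int_add, of "\<lambda>i. (cmod (Rep_l2 x i))\<^sup>2" k] by simp
  then show ?thesis by simp
qed

lemma inner_shift_l2: "inner (shift_l2 k x) y = inner x (shift_l2 (- k) y)"
  unfolding inner_l2.rep_eq shift_l2.rep_eq
  using infsum_reindex_bij_betw[OF bij_int_add, of "\<lambda>i. Rep_l2 x i \<bullet> Rep_l2 y (i + - k)" k] by simp

lemma norm_cscale_l2 [simp]: "norm (cscale_l2 c x) = cmod c * norm x"
proof -
  have "(norm (cscale_l2 c x))\<^sup>2 = (cmod c * norm x)\<^sup>2"
    unfolding power2_norm_l2 power_mult_distrib cscale_l2.rep_eq norm_mult by (rule infsum_cmult_right')
  then show ?thesis by simp
qed

lemma norm_cmod_l2 [simp]: "norm (cmod_l2 x) = norm x"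
proof -
  have "(norm (cmod_l2 x))\<^sup>2 = (norm x)\<^sup>2" unfolding power2_norm_l2 cmod_l2.rep_eq by simp
  then show ?thesis by simp
qed

lemma sum_Rep_l2: "Rep_l2 (sum f F) i = (\<Sum>j\<in>F. Rep_l2 (f j) i)"
  by (induction F rule: infinite_finite_induct) auto

text \<open>Only finitely many entries exceed a given size.\<close>

lemma ell2_tendsto_0:
  assumes "x \<in> ell2" "filterlim k at_top (F :: nat filter)" "\<And>n. \<bar>r n\<bar> \<ge> int (k n)"
  shows "((\<lambda>n. x (r n)) \<longlongrightarrow> 0) F"
proof (rule tendstoI)
  fix e :: real assume e: "0 < e"
  let ?S = "{i. e \<le> cmod (x i)}"
  have "finite ?S"
  proof (rule ccontr)
    assume inf: "infinite ?S"
    define B where "B = (\<Sum>\<^sub>\<infinity>i. (cmod (x i))\<^sup>2)"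
    obtain G where G: "finite G" "card G = nat \<lceil>B / e\<^sup>2\<rceil> + 1" "G \<subseteq> ?S"
      using infinite_arbitrarily_large[OF inf] by blast
    have "real (card G) * e\<^sup>2 = (\<Sum>i\<in>G. e\<^sup>2)" by simp
    also have "\<dots> \<le> (\<Sum>i\<in>G. (cmod (x i))\<^sup>2)" using G e by (intro sum_mono power_mono) auto
    also have "\<dots> \<le> B"
      unfolding B_def using assms(1) G by (intro finite_sum_le_infsum) (auto simp: ell2_def)
    finally have "real (card G) \<le> B / e\<^sup>2" using e by (simp add: field_simps)
    then show False unfolding G(2) by linarith
  qed
  then obtain N where N: "\<And>i. i \<in> ?S \<Longrightarrow> \<bar>i\<bar> \<le> N"
    using finite_imageI[of ?S abs] Max_ge[of "abs ` ?S"] by (metis imageI)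
  have "eventually (\<lambda>n. nat (N + 1) \<le> k n) F" using assms(2) by (simp add: filterlim_at_top)
  then show "eventually (\<lambda>n. dist (x (r n)) 0 < e) F"
  proof eventually_elim
    case (elim n)
    then have "N < \<bar>r n\<bar>" using assms(3)[of n] by linarith
    then show ?case using N[of "r n"] by force
  qed
qed

text \<open>The equation is solved by iterating x - t B (A x - y), a contraction by the lower bound
  on \<open>A\<close>. A fixed point satisfies B (A x - y) = 0, and the lower bound on the adjoint
  \<open>B\<close> removes \<open>B\<close>.\<close>

lemma contraction_surjective:
  fixes A B :: "'v::{real_inner, complete_space} \<Rightarrow> 'v"
  assumes A: "bounded_linear A" and B: "bounded_linear B" and adj: "\<And>x y. inner (A x) y = inner x (B y)"
    and \<delta>: "0 < \<delta>" and bA: "\<And>x. \<delta> * norm x \<le> norm (A x)" and bB: "\<And>x. \<delta> * norm x \<le> norm (B x)"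
  shows "\<exists>x. A x = y"
proof -
  interpret A: bounded_linear A by fact
  interpret B: bounded_linear B by fact
  obtain C1 where C1: "\<And>x. norm (A x) \<le> norm x * C1" using A.nonneg_bounded by blast
  obtain C2 where C2: "0 \<le> C2" "\<And>x. norm (B x) \<le> norm x * C2" using B.nonneg_bounded by blast
  \<comment> \<open>An upper bound for the norm of B A, enlarged so that t \<delta>^2 <= 1 holds
    both for \<delta> <= 1 and for \<delta> > 1.\<close>
  define C where "C = max \<delta> (max 1 (\<bar>C1\<bar> * C2))"
  define C' where "C' = (max 1 \<delta>) * C"
  have CC: "1 \<le> C'" "\<delta> * \<delta> \<le> C' * C'" "C \<le> C'"
    using \<delta> mult_mono[of 1 "max 1 \<delta>" 1 C] mult_mono[of 1 "max 1 \<delta>" \<delta> C] mult_mono[of 1 "max 1 \<delta>" C C] unfolding C'_def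
    by (auto simp: C_def intro!: mult_mono)
  have BA: "norm (B (A x)) \<le> C' * norm x" for x
  proof -
    have "norm (B (A x)) \<le> norm (A x) * C2" by (rule C2)
    also have "\<dots> \<le> (norm x * \<bar>C1\<bar>) * C2"
      using C1[of x] C2(1) mult_left_mono[OF abs_ge_self[of C1] norm_ge_zero[of x]] by (intro mult_right_mono) auto
    also have "\<dots> = (\<bar>C1\<bar> * C2) * norm x" by simp
    also have "\<dots> \<le> C' * norm x" using CC(3) by (intro mult_right_mono) (auto simp: C_def)
    finally show ?thesis .
  qed
  \<comment> \<open>This minimizes 1 - 2 t \<delta>^2 + t^2 C'^2, the bound for the squared
    contraction factor; the minimum is 1 - t \<delta>^2.\<close>
  define t where "t = \<delta>\<^sup>2 / C'\<^sup>2"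
  have t: "0 < t" using \<delta> CC(1) by (simp add: t_def)
  define k where "k = sqrt (1 - t * \<delta>\<^sup>2)"
  have k0: "0 \<le> 1 - t * \<delta>\<^sup>2"
  proof -
    have "\<delta>\<^sup>2 * \<delta>\<^sup>2 \<le> 1 * C'\<^sup>2" if "\<delta> \<le> 1"
    proof -
      have "\<delta>\<^sup>2 \<le> 1" using that \<delta> by (simp add: power_le_one)
      moreover have "\<delta>\<^sup>2 \<le> C'\<^sup>2" using CC(2) by (simp add: power2_eq_square)
      ultimately show ?thesis by (intro mult_mono) auto
    qed
    moreover have "\<delta>\<^sup>2 * \<delta>\<^sup>2 \<le> 1 * C'\<^sup>2" if "\<not> \<delta> \<le> 1"
    proof -
      have "\<delta> * \<delta> \<le> C'" unfolding C'_def using that by (intro mult_mono) (auto simp: C_def)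
      then have "(\<delta> * \<delta>)\<^sup>2 \<le> C'\<^sup>2" using \<delta> by (intro power_mono) auto
      then show ?thesis by (simp add: power2_eq_square mult_ac)
    qed
    ultimately have "\<delta>\<^sup>2 * \<delta>\<^sup>2 \<le> C'\<^sup>2" by fastforce
    then show ?thesis using CC(1) by (simp add: t_def field_simps)
  qed
  have k: "0 \<le> k" "k < 1" "k\<^sup>2 = 1 - t * \<delta>\<^sup>2" using k0 t \<delta> by (auto simp: k_def)
  have contr: "norm (u - t *\<^sub>R B (A u)) \<le> k * norm u" for u
  proof (rule power2_le_imp_le)
    have "(norm (u - t *\<^sub>R B (A u)))\<^sup>2 = (norm u)\<^sup>2 - 2 * t * inner u (B (A u)) + t\<^sup>2 * (norm (B (A u)))\<^sup>2"
    proof -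
      have "inner (u - t *\<^sub>R w) (u - t *\<^sub>R w) = inner u u - 2 * t * inner u w + t * t * inner w w" for w
        by (simp add: inner_diff_left inner_diff_right inner_commute[of w u] algebra_simps del: inner_same_Basis)
      then show ?thesis unfolding power2_norm_eq_inner power2_eq_square[of t] by blast
    qed
    also have "inner u (B (A u)) = (norm (A u))\<^sup>2" by (simp add: adj[symmetric] power2_norm_eq_inner)
    also have "(norm u)\<^sup>2 - 2 * t * (norm (A u))\<^sup>2 + t\<^sup>2 * (norm (B (A u)))\<^sup>2
        \<le> (norm u)\<^sup>2 - 2 * t * (\<delta> * norm u)\<^sup>2 + t\<^sup>2 * (C' * norm u)\<^sup>2"
      using t \<delta> bA[of u] BA[of u] by (intro add_mono diff_mono mult_left_mono power_mono) auto
    also have "\<dots> = (k * norm u)\<^sup>2"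
    proof -
      have "t\<^sup>2 * C'\<^sup>2 = t * \<delta>\<^sup>2" using CC(1) by (simp add: t_def power2_eq_square)
      then show ?thesis unfolding power_mult_distrib k(3) by (simp add: algebra_simps)
    qed
    finally show "(norm (u - t *\<^sub>R B (A u)))\<^sup>2 \<le> (k * norm u)\<^sup>2" .
  qed (use k in auto)
  define f where "f x = x - t *\<^sub>R B (A x - y)" for x
  have "dist (f x) (f x') \<le> k * dist x x'" for x x'
  proof -
    have "f x - f x' = (x - x') - t *\<^sub>R B (A (x - x'))"
      by (simp add: f_def A.diff B.diff algebra_simps)
    then show ?thesis unfolding dist_norm using contr[of "x - x'"] by simp
  qed
  then obtain x where "f x = x" using banach_fix_type[OF k(1,2), of f] by blast
  then have "B (A x - y) = 0" using t by (simp add: f_def)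
  then have "\<delta> * norm (A x - y) \<le> 0" using bB[of "A x - y"] by simp
  then show ?thesis using \<delta> by (auto simp: mult_le_0_iff)
qed

subsection \<open>Jacobi operators\<close>

definition jacobi :: "(int \<Rightarrow> real) \<Rightarrow> (int \<Rightarrow> complex) \<Rightarrow> int \<Rightarrow> complex" where
  "jacobi c \<psi> = (\<lambda>n. \<psi> (n + 1) + \<psi> (n - 1) + complex_of_real (c n) * \<psi> n)"

definition jacobi_l2 :: "(int \<Rightarrow> real) \<Rightarrow> complex \<Rightarrow> l2 \<Rightarrow> l2" where
  "jacobi_l2 c z x = Abs_l2 (\<lambda>n. jacobi c (Rep_l2 x) n - z * Rep_l2 x n)"

lemma schrodinger_eq_jacobi: "schrodinger T g \<omega> = jacobi (\<lambda>n. g (int_iter T n \<omega>))"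
  by (simp add: fun_eq_iff schrodinger_def jacobi_def)

locale bounded_potential =
  fixes c :: "int \<Rightarrow> real" and M :: real
  assumes bounded: "\<bar>c n\<bar> \<le> M"
begin

lemma M_nonneg: "0 \<le> M" using bounded[of 0] by linarith

definition mul_l2 :: "l2 \<Rightarrow> l2" where "mul_l2 x = Abs_l2 (\<lambda>n. complex_of_real (c n) * Rep_l2 x n)"

lemma Rep_mul_l2: "Rep_l2 (mul_l2 x) n = complex_of_real (c n) * Rep_l2 x n"
  unfolding mul_l2_def
  by (subst Abs_l2_inverse) (use ell2_mult_bounded[OF Rep_l2, of "\<lambda>n. complex_of_real (c n)" M x] bounded in auto)

lemma jacobi_l2_eq: "jacobi_l2 c z x = shift_l2 1 x + shift_l2 (- 1) x + mul_l2 x - cscale_l2 z x"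
  unfolding jacobi_l2_def
proof (rule trans[OF arg_cong[where f = Abs_l2] Rep_l2_inverse], rule ext)
  fix n
  show "jacobi c (Rep_l2 x) n - z * Rep_l2 x n = Rep_l2 (shift_l2 1 x + shift_l2 (- 1) x + mul_l2 x - cscale_l2 z x) n"
    by (simp add: jacobi_def shift_l2.rep_eq cscale_l2.rep_eq Rep_mul_l2)
qed

lemma Rep_jacobi_l2: "Rep_l2 (jacobi_l2 c z x) n = jacobi c (Rep_l2 x) n - z * Rep_l2 x n"
  by (simp add: jacobi_l2_eq jacobi_def shift_l2.rep_eq cscale_l2.rep_eq Rep_mul_l2)

lemma norm_mul_l2: "norm (mul_l2 x) \<le> M * norm x"
proof -
  have "norm (mul_l2 x) \<le> norm (cscale_l2 (of_real M) x)"
    using bounded M_nonneg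
    by (intro norm_l2_mono) (auto simp: Rep_mul_l2 cscale_l2.rep_eq norm_mult intro: mult_right_mono)
  then show ?thesis using M_nonneg by simp
qed

lemma bounded_linear_jacobi_l2: "bounded_linear (jacobi_l2 c z)"
proof (rule bounded_linear_intro)
  show "jacobi_l2 c z (x + y) = jacobi_l2 c z x + jacobi_l2 c z y" for x y
    by (rule l2_ext) (simp add: Rep_jacobi_l2 jacobi_def algebra_simps)
  show "jacobi_l2 c z (r *\<^sub>R x) = r *\<^sub>R jacobi_l2 c z x" for r x
    by (rule l2_ext) (simp add: Rep_jacobi_l2 jacobi_def algebra_simps scaleR_conv_of_real)
  show "norm (jacobi_l2 c z x) \<le> norm x * (2 + M + cmod z)" for x
  proof -
    have "norm (jacobi_l2 c z x) \<le> norm (shift_l2 1 x) + norm (shift_l2 (- 1) x) + norm (mul_l2 x) + norm (cscale_l2 z x)"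
      unfolding jacobi_l2_eq
      by (intro order.trans[OF norm_triangle_ineq4] add_mono order.trans[OF norm_triangle_ineq]) simp_all
    then show ?thesis using norm_mul_l2[of x] by (simp add: algebra_simps)
  qed
qed

lemma jacobi_l2_cscale: "jacobi_l2 c z (cscale_l2 w x) = cscale_l2 w (jacobi_l2 c z x)"
  by (rule l2_ext) (simp add: Rep_jacobi_l2 jacobi_def cscale_l2.rep_eq algebra_simps)

lemma inner_cscale_l2: "inner (cscale_l2 z x) y = inner x (cscale_l2 (cnj z) y)"
  unfolding inner_l2.rep_eq cscale_l2.rep_eq by (simp add: inner_complex_def algebra_simps)

lemma jacobi_l2_adjoint: "inner (jacobi_l2 c z x) y = inner x (jacobi_l2 c (cnj z) y)"
proof -
  have "inner (mul_l2 x) y = inner x (mul_l2 y)"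
    unfolding inner_l2.rep_eq Rep_mul_l2 by (simp add: inner_complex_def algebra_simps)
  then show ?thesis
    unfolding jacobi_l2_eq
    by (simp add: inner_add_left inner_add_right inner_diff_left inner_diff_right inner_cscale_l2
        inner_shift_l2)
qed

text \<open>H - E is symmetric, and multiplication by an imaginary number is skew and commutes with
  it, so the pairing equals its own negative. The consequence is a Pythagorean identity for H - E -
  w.\<close>

lemma inner_jacobi_imaginary:
  assumes "Re w = 0" shows "inner (jacobi_l2 c (of_real E) x) (cscale_l2 w x) = 0"
proof -
  have w: "cnj w = - w" using assms by (simp add: complex_eq_iff)
  have "inner (jacobi_l2 c (of_real E) x) (cscale_l2 w x) = inner x (cscale_l2 w (jacobi_l2 c (of_real E) x))"
    by (simp add: jacobi_l2_adjoint jacobi_l2_cscale)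
  also have "\<dots> = inner (cscale_l2 (- w) x) (jacobi_l2 c (of_real E) x)"
    by (simp add: inner_cscale_l2 w)
  also have "cscale_l2 (- w) x = - cscale_l2 w x" by (rule l2_ext) (simp add: cscale_l2.rep_eq)
  finally show ?thesis by (simp add: inner_commute)
qed

lemma jacobi_l2_complex: "jacobi_l2 c (of_real E + w) x = jacobi_l2 c (of_real E) x - cscale_l2 w x"
  by (rule l2_ext) (simp add: Rep_jacobi_l2 cscale_l2.rep_eq algebra_simps)

lemma norm_jacobi_l2_complex:
  assumes "Re w = 0"
  shows "(norm (jacobi_l2 c (of_real E + w) x))\<^sup>2 = (norm (jacobi_l2 c (of_real E) x))\<^sup>2 + (cmod w * norm x)\<^sup>2"
proof -
  have "(norm (a - b))\<^sup>2 = (norm a)\<^sup>2 + (norm b)\<^sup>2" if "inner a b = 0" for a b :: l2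
    using that by (simp add: power2_norm_eq_inner inner_diff_left inner_diff_right inner_commute)
  then show ?thesis
    unfolding jacobi_l2_complex using inner_jacobi_imaginary[OF assms, of E x] norm_cscale_l2[of w x] by metis
qed

text \<open>The bound at \<open>z\<close> gives injectivity and a bounded inverse; the bound at the
  conjugate, where the adjoint lives, gives surjectivity.\<close>

lemma resolvent_exists:
  assumes \<delta>: "0 < \<delta>" and b: "\<And>x. \<delta> * norm x \<le> norm (jacobi_l2 c z x)"
    and b': "\<And>x. \<delta> * norm x \<le> norm (jacobi_l2 c (cnj z) x)"
  shows "\<exists>R. is_resolvent (jacobi c) z R"
proof -
  interpret A: bounded_linear "jacobi_l2 c z" by (rule bounded_linear_jacobi_l2)
  have surj: "\<exists>x. jacobi_l2 c z x = y" for y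
    by (rule contraction_surjective[OF bounded_linear_jacobi_l2 bounded_linear_jacobi_l2 jacobi_l2_adjoint \<delta> b b'])
  have inj: "x = y" if "jacobi_l2 c z x = jacobi_l2 c z y" for x y
  proof -
    have "\<delta> * norm (x - y) \<le> 0" using b[of "x - y"] that by (simp add: A.diff)
    then show ?thesis using \<delta> by (auto simp: mult_le_0_iff)
  qed
  define S where "S y = (SOME x. jacobi_l2 c z x = y)" for y
  have S: "jacobi_l2 c z (S y) = y" for y unfolding S_def by (rule someI_ex[OF surj])
  have S': "S (jacobi_l2 c z x) = x" for x by (rule inj) (rule S)
  have Sadd: "S (x + y) = S x + S y" for x y by (rule inj) (simp add: S A.add)
  have Sc: "S (cscale_l2 w x) = cscale_l2 w (S x)" for w x by (rule inj) (simp add: S jacobi_l2_cscale)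
  have Sn: "norm (S y) \<le> (1 / \<delta>) * norm y" for y using b[of "S y"] \<delta> by (simp add: S field_simps)
  define R where "R \<psi> = Rep_l2 (S (Abs_l2 \<psi>))" for \<psi>
  have "is_resolvent (jacobi c) z R"
    unfolding is_resolvent_def bounded_operator_def
  proof (intro conjI ballI allI)
    fix \<psi> assume \<psi>: "\<psi> \<in> ell2"
    show "R \<psi> \<in> ell2" by (simp add: R_def Rep_l2)
    have "(\<lambda>n. jacobi c \<psi> n - z * \<psi> n) = Rep_l2 (jacobi_l2 c z (Abs_l2 \<psi>))"
      by (simp add: fun_eq_iff Rep_jacobi_l2 Abs_l2_inverse[OF \<psi>])
    then show "R (\<lambda>n. jacobi c \<psi> n - z * \<psi> n) = \<psi>"
      by (simp add: R_def Rep_l2_inverse S' Abs_l2_inverse[OF \<psi>])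
    have "(\<lambda>n. jacobi c (R \<psi>) n - z * R \<psi> n) = Rep_l2 (jacobi_l2 c z (S (Abs_l2 \<psi>)))"
      by (simp add: fun_eq_iff Rep_jacobi_l2 R_def)
    then show "(\<lambda>n. jacobi c (R \<psi>) n - z * R \<psi> n) = \<psi>"
      by (simp add: S Abs_l2_inverse[OF \<psi>])
    fix w
    have "Abs_l2 (\<lambda>n. w * \<psi> n) = cscale_l2 w (Abs_l2 \<psi>)"
      by (rule l2_ext) (simp add: cscale_l2.rep_eq Abs_l2_inverse \<psi> ell2_cmult)
    then show "R (\<lambda>n. w * \<psi> n) = (\<lambda>n. w * R \<psi> n)"
      by (simp add: R_def Sc cscale_l2.rep_eq fun_eq_iff)
  next
    fix \<phi> \<psi> assume *: "\<phi> \<in> ell2" "\<psi> \<in> ell2"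
    have "Abs_l2 (\<lambda>n. \<phi> n + \<psi> n) = Abs_l2 \<phi> + Abs_l2 \<psi>"
      by (rule l2_ext) (simp add: Abs_l2_inverse * ell2_add)
    then show "R (\<lambda>n. \<phi> n + \<psi> n) = (\<lambda>n. R \<phi> n + R \<psi> n)" by (simp add: R_def Sadd fun_eq_iff)
  next
    have "ell2_norm (R \<psi>) \<le> (1 / \<delta>) * ell2_norm \<psi>" if "\<psi> \<in> ell2" for \<psi>
      using Sn[of "Abs_l2 \<psi>"] by (simp add: R_def norm_l2_eq Abs_l2_inverse[OF that])
    then show "\<exists>C. \<forall>\<psi>\<in>ell2. ell2_norm (R \<psi>) \<le> C * ell2_norm \<psi>" by blast
  qed
  then show ?thesis by blast
qed

lemma resolvent_bounded_below:
  assumes "is_resolvent (jacobi c) z R"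
  shows "\<exists>\<delta>>0. \<forall>x. \<delta> * norm x \<le> norm (jacobi_l2 c z x)"
proof -
  obtain C where C: "\<And>\<psi>. \<psi> \<in> ell2 \<Longrightarrow> ell2_norm (R \<psi>) \<le> C * ell2_norm \<psi>"
    using assms unfolding is_resolvent_def bounded_operator_def by blast
  have "norm x \<le> max C 1 * norm (jacobi_l2 c z x)" for x
  proof -
    have "R (Rep_l2 (jacobi_l2 c z x)) = Rep_l2 x"
      using assms Rep_l2[of x] unfolding is_resolvent_def by (simp add: Rep_jacobi_l2[abs_def])
    then have "norm x \<le> C * norm (jacobi_l2 c z x)"
      using C[OF Rep_l2, of "jacobi_l2 c z x"] by (simp add: norm_l2_eq)
    also have "\<dots> \<le> max C 1 * norm (jacobi_l2 c z x)" by (intro mult_right_mono) auto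
    finally show ?thesis .
  qed
  then have "(1 / max C 1) * norm x \<le> norm (jacobi_l2 c z x)" for x
    by (simp add: field_simps)
  then show ?thesis by (intro exI[of _ "1 / max C 1"]) auto
qed

text \<open>A real energy is its own conjugate, so one lower bound suffices. This is the form in
  which the spectrum is handled from here on.\<close>

lemma spectrum_iff:
  "complex_of_real E \<in> spectrum (jacobi c) \<longleftrightarrow> \<not> (\<exists>\<delta>>0. \<forall>x. \<delta> * norm x \<le> norm (jacobi_l2 c (of_real E) x))"
proof -
  have "(\<exists>R. is_resolvent (jacobi c) (of_real E) R) \<longleftrightarrow> (\<exists>\<delta>>0. \<forall>x. \<delta> * norm x \<le> norm (jacobi_l2 c (of_real E) x))"
  proof
    assume "\<exists>\<delta>>0. \<forall>x. \<delta> * norm x \<le> norm (jacobi_l2 c (of_real E) x)"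
    then obtain \<delta> where "0 < \<delta>" "\<And>x. \<delta> * norm x \<le> norm (jacobi_l2 c (of_real E) x)" by blast
    then show "\<exists>R. is_resolvent (jacobi c) (of_real E) R"
      using resolvent_exists[of \<delta> "of_real E"] by simp
  qed (use resolvent_bounded_below in blast)
  then show ?thesis unfolding spectrum_def mem_Collect_eq by (rule arg_cong)
qed

lemma resolvent_nonreal:
  assumes "0 < \<eta>" shows "\<exists>R. is_resolvent (jacobi c) (Complex E \<eta>) R"
proof (rule resolvent_exists[OF assms])
  fix x
  have *: "\<eta> * norm x \<le> norm (jacobi_l2 c (of_real E + w) x)" if "Re w = 0" "cmod w = \<eta>" for w
  proof (rule power2_le_imp_le)
    show "(\<eta> * norm x)\<^sup>2 \<le> (norm (jacobi_l2 c (of_real E + w) x))\<^sup>2"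
      unfolding norm_jacobi_l2_complex[OF that(1)] using that(2) by simp
  qed simp
  have "Complex E \<eta> = of_real E + Complex 0 \<eta>" "cnj (Complex E \<eta>) = of_real E + Complex 0 (- \<eta>)"
    by (simp_all add: complex_eq_iff)
  then show "\<eta> * norm x \<le> norm (jacobi_l2 c (Complex E \<eta>) x)" "\<eta> * norm x \<le> norm (jacobi_l2 c (cnj (Complex E \<eta>)) x)"
    using *[of "Complex 0 \<eta>"] *[of "Complex 0 (- \<eta>)"] assms by (simp_all add: cmod_def)
qed

lemma jacobi_l2_perturbation:
  assumes "bounded_potential c' M'" and r: "\<And>n. \<bar>c n - c' n\<bar> \<le> r"
  shows "norm (jacobi_l2 c z x) \<le> norm (jacobi_l2 c' z x) + r * norm x"
proof -
  interpret c': bounded_potential c' M' by fact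
  have "0 \<le> r" using r[of 0] by linarith
  have "norm (jacobi_l2 c z x - jacobi_l2 c' z x) \<le> norm (cscale_l2 (of_real r) x)"
  proof (rule norm_l2_mono)
    fix n
    have "Rep_l2 (jacobi_l2 c z x - jacobi_l2 c' z x) n = of_real (c n - c' n) * Rep_l2 x n"
      by (simp add: Rep_jacobi_l2 c'.Rep_jacobi_l2 jacobi_def algebra_simps)
    then show "cmod (Rep_l2 (jacobi_l2 c z x - jacobi_l2 c' z x) n) \<le> cmod (Rep_l2 (cscale_l2 (of_real r) x) n)"
      using r[of n] \<open>0 \<le> r\<close> by (simp add: cscale_l2.rep_eq norm_mult mult_right_mono del: of_real_diff)
  qed
  then show ?thesis
    using \<open>0 \<le> r\<close> norm_triangle_sub[of "jacobi_l2 c z x" "jacobi_l2 c' z x"] by simp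
qed

lemma jacobi_l2_energy:
  "norm (jacobi_l2 c (of_real E) x) \<le> norm (jacobi_l2 c (of_real E') x) + \<bar>E - E'\<bar> * norm x"
proof -
  have "jacobi_l2 c (of_real E) x = jacobi_l2 c (of_real E') x - cscale_l2 (of_real (E - E')) x"
    by (rule l2_ext) (simp add: Rep_jacobi_l2 cscale_l2.rep_eq algebra_simps)
  then show ?thesis
    using norm_triangle_ineq4[of "jacobi_l2 c (of_real E') x" "cscale_l2 (of_real (E - E')) x"]
    by (simp del: of_real_diff)
qed

lemma closed_spectrum: "closed {E. complex_of_real E \<in> spectrum (jacobi c)}"
proof -
  have "open {E. \<exists>\<delta>>0. \<forall>x. \<delta> * norm x \<le> norm (jacobi_l2 c (of_real E) x)}"
    unfolding open_dist
  proof safe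
    fix E \<delta> assume \<delta>: "0 < \<delta>" "\<forall>x. \<delta> * norm x \<le> norm (jacobi_l2 c (of_real E) x)"
    have "(\<delta> / 2) * norm x \<le> norm (jacobi_l2 c (of_real E') x)" if "dist E' E < \<delta> / 2" for E' x
    proof -
      have "\<bar>E - E'\<bar> * norm x \<le> \<delta> / 2 * norm x" using that by (intro mult_right_mono) (auto simp: dist_real_def abs_minus_commute)
      then show ?thesis using \<delta>(2) jacobi_l2_energy[of E x E'] by (smt (verit) field_sum_of_halves mult.commute
        times_divide_eq_right)
    qed
    then show "\<exists>e>0. \<forall>y. dist y E < e \<longrightarrow> y \<in> {E. \<exists>\<delta>>0. \<forall>x. \<delta> * norm x \<le> norm (jacobi_l2 c (of_real E) x)}"
      using \<delta>(1) by (intro exI[of _ "\<delta> / 2"]) (auto intro!: exI[of _ "\<delta> / 2"])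
  qed
  then show ?thesis unfolding closed_def spectrum_iff by (simp add: Compl_eq)
qed

lemma spectrum_bounded:
  assumes "complex_of_real E \<in> spectrum (jacobi c)" shows "\<bar>E\<bar> \<le> 2 + M"
proof (rule ccontr)
  assume "\<not> ?thesis"
  then have pos: "0 < \<bar>E\<bar> - (2 + M)" by simp
  have "(\<bar>E\<bar> - (2 + M)) * norm x \<le> norm (jacobi_l2 c (of_real E) x)" for x
  proof -
    have "cscale_l2 (of_real E) x = shift_l2 1 x + shift_l2 (- 1) x + mul_l2 x - jacobi_l2 c (of_real E) x"
      unfolding jacobi_l2_eq by simp
    then have "norm (cscale_l2 (of_real E) x)
        \<le> norm (shift_l2 1 x) + norm (shift_l2 (- 1) x) + norm (mul_l2 x) + norm (jacobi_l2 c (of_real E) x)"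
      by (simp only:)
        (intro order.trans[OF norm_triangle_ineq4] add_mono order.trans[OF norm_triangle_ineq] order.refl)
    then show ?thesis using norm_mul_l2[of x] by (simp add: algebra_simps)
  qed
  then show False using assms pos unfolding spectrum_iff by blast
qed

end

lemma jacobi_l2_shift:
  assumes "bounded_potential c M"
  shows "norm (jacobi_l2 (\<lambda>n. c (n + m)) z (shift_l2 m x)) = norm (jacobi_l2 c z x)"
proof -
  interpret c: bounded_potential c M by fact
  interpret c': bounded_potential "\<lambda>n. c (n + m)" M by standard (rule c.bounded)
  have "jacobi_l2 (\<lambda>n. c (n + m)) z (shift_l2 m x) = shift_l2 m (jacobi_l2 c z x)"
    by (rule l2_ext) (simp add: c'.Rep_jacobi_l2 c.Rep_jacobi_l2 shift_l2.rep_eq jacobi_def algebra_simps)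
  then show ?thesis by simp
qed

text \<open>Cayley--Hamilton: applying a \<open>q\<close>-periodic operator minus \<open>E\<close> controls \<open>S\<^sup>q + S\<^sup>-\<^sup>q - D\<close>, where \<open>S\<close>
  is the shift and \<open>D\<close> the discriminant at \<open>E\<close>.\<close>

lemma periodic_bounded_below:
  assumes c: "bounded_potential c M" and per: "\<And>n. c (n + int q) = c n" and X: "\<And>n. \<bar>E - c n\<bar> \<le> X"
  shows "(\<bar>tr2 (tm (\<lambda>i. E - c i) 0 q)\<bar> - 2) * norm x
     \<le> 6 * (X + 2) ^ (2 * q) * real (2 * q) * norm (jacobi_l2 c (of_real E) x)"
proof -
  interpret bounded_potential c M by (rule c)
  let ?D = "tr2 (tm (\<lambda>i. E - c i) 0 q)" and ?C = "6 * (X + 2) ^ (2 * q)"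
  have X0: "0 \<le> X" using X[of 0] by linarith
  define \<psi> where "\<psi> = jacobi_l2 c (of_real E) x"
  define y where "y = shift_l2 (int q) x + shift_l2 (- int q) x - cscale_l2 (of_real ?D) x"
  \<comment> \<open>A pointwise majorant of \<open>y\<close>: shifting the modulus of
    \<open>\<psi>\<close> turns the sum at each site into one vector, to which the triangle
    inequality applies.\<close>
  define w where "w = cscale_l2 (of_real ?C) (\<Sum>i<2 * q. shift_l2 (- int q + int i) (cmod_l2 \<psi>))"
  have \<psi>: "Rep_l2 \<psi> n = Rep_l2 x (n + 1) + Rep_l2 x (n - 1) - of_real (E - c n) * Rep_l2 x n" for n
    by (simp add: \<psi>_def Rep_jacobi_l2 jacobi_def algebra_simps)
  have "norm y \<le> norm w"
  proof (rule norm_l2_mono)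
    fix n
    have "Rep_l2 y n = Rep_l2 x (n + int q) + Rep_l2 x (n - int q) - of_real ?D * Rep_l2 x n"
      by (simp add: y_def shift_l2.rep_eq cscale_l2.rep_eq)
    then have "cmod (Rep_l2 y n) \<le> ?C * (\<Sum>i<2 * q. cmod (Rep_l2 \<psi> (n - int q + int i)))"
      unfolding \<psi> using periodic_difference_bound[of "\<lambda>n. E - c n" X q "Rep_l2 x" n] X per by simp
    also have "\<dots> = cmod (of_real (?C * (\<Sum>i<2 * q. cmod (Rep_l2 \<psi> (n - int q + int i)))))"
      using X0 by (simp add: sum_nonneg del: of_real_mult)
    also have "of_real (?C * (\<Sum>i<2 * q. cmod (Rep_l2 \<psi> (n - int q + int i)))) = Rep_l2 w n"
      by (simp add: w_def cscale_l2.rep_eq sum_Rep_l2 shift_l2.rep_eq cmod_l2.rep_eq algebra_simps)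
    finally show "cmod (Rep_l2 y n) \<le> cmod (Rep_l2 w n)" .
  qed
  also have "norm w \<le> ?C * (\<Sum>i<2 * q. norm \<psi>)"
  proof -
    have "norm (\<Sum>i<2 * q. shift_l2 (- int q + int i) (cmod_l2 \<psi>)) \<le> (\<Sum>i<2 * q. norm \<psi>)"
      by (rule order.trans[OF norm_sum]) simp
    then show ?thesis unfolding w_def norm_cscale_l2 norm_of_real using X0 by (intro mult_mono) auto
  qed
  also have "\<dots> = ?C * real (2 * q) * norm \<psi>" by simp
  finally have y: "norm y \<le> ?C * real (2 * q) * norm \<psi>" .
  have "cscale_l2 (of_real ?D) x = shift_l2 (int q) x + shift_l2 (- int q) x - y"
    by (simp add: y_def)
  then have "norm (cscale_l2 (of_real ?D) x) \<le> norm (shift_l2 (int q) x) + norm (shift_l2 (- int q) x) + norm y"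
    by (simp only:)
      (intro order.trans[OF norm_triangle_ineq4] add_mono order.trans[OF norm_triangle_ineq] order.refl)
  then have "\<bar>?D\<bar> * norm x \<le> 2 * norm x + norm y" by simp
  then show ?thesis using y unfolding \<psi>_def by (simp add: algebra_simps)
qed

text \<open>Gordon's argument: a decaying solution \<open>x\<close> nearly satisfies
  \<open>x (n + q) + x (n - q) = D * x n\<close> at \<open>n = n\<^sub>0\<close> and at \<open>n = n\<^sub>0 + q\<close>; the first forces \<open>D\<close> to be
  small, the second then forces \<open>x n\<^sub>0\<close> to be small.\<close>

lemma gordon:
  assumes approx: "\<And>k::nat. k0 \<le> k \<Longrightarrow> \<exists>q V X r. k \<le> q \<and> (\<forall>n. V (n + int q) = V n) \<and> (\<forall>n. \<bar>E - V n\<bar> \<le> X)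
      \<and> (\<forall>n. \<bar>c n - V n\<bar> \<le> r) \<and> 6 * (X + 2) ^ (2 * q) * real (2 * q) * r \<le> 1 / real k"
    and x: "x \<in> ell2" and eig: "\<And>n. jacobi c x n = of_real E * x n"
  shows "x = (\<lambda>_. 0)"
proof (rule ccontr)
  assume "x \<noteq> (\<lambda>_. 0)"
  then obtain n0 where n0: "x n0 \<noteq> 0" by auto
  define B where "B = norm (Abs_l2 x)"
  have B: "cmod (x n) \<le> B" for n
    using cmod_le_norm_l2[of "Abs_l2 x" n] by (simp add: B_def Abs_l2_inverse[OF x])
  have B0: "0 \<le> B" by (simp add: B_def)
  have "\<exists>q D. k \<le> q \<and> (\<forall>n. cmod (x (n + int q) + x (n - int q) - of_real D * x n) \<le> B / real k)" if k: "k0 \<le> k" for k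
  proof -
    obtain q V X r where q: "k \<le> q" and V: "\<forall>n. V (n + int q) = V n" and X: "\<forall>n. \<bar>E - V n\<bar> \<le> X"
      and r: "\<forall>n. \<bar>c n - V n\<bar> \<le> r" and C: "6 * (X + 2) ^ (2 * q) * real (2 * q) * r \<le> 1 / real k"
      using approx[OF k] by blast
    have X0: "0 \<le> X" using X[rule_format, of 0] by linarith
    have "cmod (x (n + int q) + x (n - int q) - of_real (tr2 (tm (\<lambda>i. E - V i) 0 q)) * x n) \<le> B / real k" for n
    proof -
      have "cmod (x (n + int q) + x (n - int q) - of_real (tr2 (tm (\<lambda>i. E - V i) 0 q)) * x n)
         \<le> 6 * (X + 2) ^ (2 * q) * (\<Sum>i<2 * q. cmod (x (n - int q + int i + 1) + x (n - int q + int i - 1)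
             - of_real (E - V (n - int q + int i)) * x (n - int q + int i)))"
        using periodic_difference_bound[of "\<lambda>n. E - V n" X q x n] X V by simp
      also have "\<dots> \<le> 6 * (X + 2) ^ (2 * q) * (\<Sum>i<2 * q. r * B)"
      proof (intro mult_left_mono sum_mono)
        fix i
        let ?m = "n - int q + int i"
        have "x (?m + 1) + x (?m - 1) - of_real (E - V ?m) * x ?m = of_real (V ?m - c ?m) * x ?m"
          using eig[of ?m] by (simp add: jacobi_def algebra_simps)
        then have "cmod (x (?m + 1) + x (?m - 1) - of_real (E - V ?m) * x ?m) = \<bar>c ?m - V ?m\<bar> * cmod (x ?m)"
          by (simp add: norm_mult abs_minus_commute del: of_real_diff)
        also have "\<dots> \<le> r * B" using r B B0 by (intro mult_mono) (auto intro: order.trans[OF abs_ge_zero])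
        finally show "cmod (x (?m + 1) + x (?m - 1) - of_real (E - V ?m) * x ?m) \<le> r * B" .
      qed (use X0 in auto)
      also have "\<dots> = (6 * (X + 2) ^ (2 * q) * real (2 * q) * r) * B" by simp
      also have "\<dots> \<le> (1 / real k) * B" using C B0 by (intro mult_right_mono)
      finally show ?thesis by simp
    qed
    then show ?thesis using q by blast
  qed
  then obtain q D where q: "\<And>k. k0 \<le> k \<Longrightarrow> k \<le> q k"
    and D: "\<And>k n. k0 \<le> k \<Longrightarrow> cmod (x (n + int (q k)) + x (n - int (q k)) - of_real (D k) * x n) \<le> B / real k"
    by metis
  define e where "e n k = x (n + int (q k)) + x (n - int (q k)) - of_real (D k) * x n" for n k
  have Bk: "(\<lambda>k. B / real k) \<longlonglongrightarrow> 0" by (rule lim_const_over_n)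
  have e: "(\<lambda>k. e (N k) k) \<longlonglongrightarrow> 0" for N
  proof (rule Lim_null_comparison[OF _ Bk])
    show "\<forall>\<^sub>F k in sequentially. norm (e (N k) k) \<le> B / real k"
      unfolding eventually_sequentially e_def using D by blast
  qed
  have lim: "(\<lambda>k. x (r k)) \<longlonglongrightarrow> 0" if "\<And>k. k0 \<le> k \<Longrightarrow> int (q k) - \<bar>n0\<bar> \<le> \<bar>r k\<bar>" for r
  proof -
    \<comment> \<open>\<open>K\<close> and \<open>r'\<close> are altered for small \<open>k\<close>,
      where nothing is known about \<open>r k\<close>, because \<open>ell2_tendsto_0\<close> wants
      its lower bound at every index.\<close>
    define K where "K k = (if k0 + nat \<bar>n0\<bar> \<le> k then k - nat \<bar>n0\<bar> else 0)" for k
    define r' where "r' k = (if k0 + nat \<bar>n0\<bar> \<le> k then r k else 0)" for k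
    have "filterlim K at_top sequentially"
      unfolding filterlim_at_top eventually_sequentially
    proof
      fix Z show "\<exists>N. \<forall>n\<ge>N. Z \<le> K n" by (intro exI[of _ "Z + k0 + nat \<bar>n0\<bar>"]) (auto simp: K_def)
    qed
    moreover have "\<bar>r' k\<bar> \<ge> int (K k)" for k
    proof (cases "k0 + nat \<bar>n0\<bar> \<le> k")
      case True
      then have "int (K k) = int k - \<bar>n0\<bar>" by (simp add: K_def of_nat_diff)
      also have "\<dots> \<le> int (q k) - \<bar>n0\<bar>" using q[of k] True by simp
      also have "\<dots> \<le> \<bar>r' k\<bar>" using that[of k] True by (simp add: r'_def)
      finally show ?thesis .
    qed (simp add: K_def)
    ultimately have "(\<lambda>k. x (r' k)) \<longlonglongrightarrow> 0" by (rule ell2_tendsto_0[OF x])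
    moreover have "\<forall>\<^sub>F k in sequentially. x (r' k) = x (r k)"
      unfolding eventually_sequentially by (intro exI[of _ "k0 + nat \<bar>n0\<bar>"]) (simp add: r'_def)
    ultimately show ?thesis by (rule Lim_transform_eventually)
  qed
  have "(\<lambda>k. (x (n0 + int (q k)) + x (n0 - int (q k)) - e n0 k) / x n0) \<longlonglongrightarrow> (0 + 0 - 0) / x n0"
    by (intro tendsto_intros lim e n0) auto
  moreover have "(x (n0 + int (q k)) + x (n0 - int (q k)) - e n0 k) / x n0 = of_real (D k)" for k
    using n0 by (simp add: e_def)
  ultimately have D0: "(\<lambda>k. complex_of_real (D k)) \<longlonglongrightarrow> 0" by simp
  have "(\<lambda>k. e (n0 + int (q k)) k + of_real (D k) * x (n0 + int (q k)) - x (n0 + 2 * int (q k))) \<longlonglongrightarrow> 0 + 0 * 0 - 0"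
    by (intro tendsto_intros lim e D0) auto
  moreover have "e (n0 + int (q k)) k + of_real (D k) * x (n0 + int (q k)) - x (n0 + 2 * int (q k)) = x n0" for k
    by (simp add: e_def algebra_simps)
  ultimately have "(\<lambda>k. x n0) \<longlonglongrightarrow> 0" by simp
  then show False using n0 LIMSEQ_unique[OF tendsto_const, of "x n0" 0] by blast
qed

subsection \<open>Spectral measures\<close>

lemma ell2_inner_summable:
  assumes "x \<in> ell2" "y \<in> ell2" shows "(\<lambda>i. cnj (x i) * y i) summable_on UNIV"
proof (rule Infinite_Sum.abs_summable_summable, rule Infinite_Sum.abs_summable_on_comparison_test')
  show "(\<lambda>i. (cmod (x i))\<^sup>2 + (cmod (y i))\<^sup>2) summable_on UNIV"
    using assms by (intro summable_on_add) (auto simp: ell2_def)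
  fix i
  show "norm (cnj (x i) * y i) \<le> (cmod (x i))\<^sup>2 + (cmod (y i))\<^sup>2"
    using zero_le_power2[of "cmod (x i) - cmod (y i)"] zero_le_power2[of "cmod (x i)"] zero_le_power2[of "cmod (y i)"]
    unfolding power2_diff norm_mult complex_mod_cnj by linarith
qed

lemma Im_ell2_inner: "Im (ell2_inner (Rep_l2 x) (Rep_l2 y)) = inner x (cscale_l2 (- \<i>) y)"
proof -
  have "Im (ell2_inner (Rep_l2 x) (Rep_l2 y)) = (\<Sum>\<^sub>\<infinity>i. Im (cnj (Rep_l2 x i) * Rep_l2 y i))"
    unfolding ell2_inner_def by (rule infsum_Im[symmetric]) (rule ell2_inner_summable[OF Rep_l2 Rep_l2])
  also have "\<dots> = inner x (cscale_l2 (- \<i>) y)"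
    unfolding inner_l2.rep_eq cscale_l2.rep_eq by (simp add: inner_complex_def algebra_simps)
  finally show ?thesis .
qed

lemma Im_cauchy_kernel:
  assumes "0 < \<eta>"
  shows "Im (1 / (complex_of_real t - Complex E \<eta>)) = \<eta> / ((t - E)\<^sup>2 + \<eta>\<^sup>2)"
proof -
  have "complex_of_real t - Complex E \<eta> = Complex (t - E) (- \<eta>)" by (simp add: complex_eq_iff)
  then show ?thesis by (simp add: Im_divide)
qed

context bounded_potential
begin

text \<open>The imaginary part of the Borel transform integrates the Poisson kernel, which is at
  least 1 / (2 \<eta>) on the interval. With \<open>\<phi>\<close> the resolvent at E + i \<eta>
  applied to \<open>\<psi>\<close>, the same imaginary part is \<eta> times the squared norm of
  \<open>\<phi>\<close>.\<close>

lemma spectral_measure_interval_bound: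
  assumes sm: "is_spectral_measure (jacobi c) \<psi> \<nu>" and \<psi>: "\<psi> \<in> ell2" and \<eta>: "0 < \<eta>"
  obtains \<phi> where "jacobi_l2 c (Complex E \<eta>) \<phi> = Abs_l2 \<psi>"
    "measure \<nu> {E - \<eta>..E + \<eta>} \<le> 2 * \<eta>\<^sup>2 * (norm \<phi>)\<^sup>2"
    "\<eta> * (norm \<phi>)\<^sup>2 = inner (Abs_l2 \<psi>) (cscale_l2 (- \<i>) \<phi>)"
proof -
  have sets: "sets \<nu> = sets borel" and fin: "finite_measure \<nu>"
    and F: "\<And>z R. Im z \<noteq> 0 \<Longrightarrow> is_resolvent (jacobi c) z R \<Longrightarrow>
       ell2_inner \<psi> (R \<psi>) = (\<integral>x. 1 / (complex_of_real x - z) \<partial>\<nu>)"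
    using sm unfolding is_spectral_measure_def by auto
  interpret finite_measure \<nu> by (rule fin)
  obtain R where R: "is_resolvent (jacobi c) (Complex E \<eta>) R" using resolvent_nonreal[OF \<eta>] by blast
  have R\<psi>: "R \<psi> \<in> ell2" and RR: "(\<lambda>n. jacobi c (R \<psi>) n - Complex E \<eta> * R \<psi> n) = \<psi>"
    using R \<psi> unfolding is_resolvent_def bounded_operator_def by auto
  define \<phi> where "\<phi> = Abs_l2 (R \<psi>)"
  have Rep\<phi>: "Rep_l2 \<phi> = R \<psi>" unfolding \<phi>_def by (rule Abs_l2_inverse[OF R\<psi>])
  have 1: "jacobi_l2 c (Complex E \<eta>) \<phi> = Abs_l2 \<psi>"
    unfolding jacobi_l2_def Rep\<phi> RR ..
  have z: "Complex E \<eta> = of_real E + Complex 0 \<eta>" by (simp add: complex_eq_iff)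
  have 3: "\<eta> * (norm \<phi>)\<^sup>2 = inner (Abs_l2 \<psi>) (cscale_l2 (- \<i>) \<phi>)"
  proof -
    have "Abs_l2 \<psi> = jacobi_l2 c (of_real E) \<phi> - cscale_l2 (Complex 0 \<eta>) \<phi>"
      using 1 unfolding z jacobi_l2_complex by simp
    then have "inner (Abs_l2 \<psi>) (cscale_l2 (- \<i>) \<phi>) = - inner (cscale_l2 (Complex 0 \<eta>) \<phi>) (cscale_l2 (- \<i>) \<phi>)"
      by (simp add: inner_diff_left inner_jacobi_imaginary)
    also have "cscale_l2 (Complex 0 \<eta>) \<phi> = (- \<eta>) *\<^sub>R cscale_l2 (- \<i>) \<phi>"
      by (rule l2_ext) (simp add: cscale_l2.rep_eq complex_eq_iff)
    also have "- inner ((- \<eta>) *\<^sub>R cscale_l2 (- \<i>) \<phi>) (cscale_l2 (- \<i>) \<phi>) = \<eta> * (norm (cscale_l2 (- \<i>) \<phi>))\<^sup>2"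
      by (simp only: power2_norm_eq_inner inner_scaleR_left minus_mult_left minus_minus)
    finally show ?thesis by simp
  qed
  let ?k = "\<lambda>t. 1 / (complex_of_real t - Complex E \<eta>)"
  have meas: "?k \<in> borel_measurable \<nu>"
    unfolding measurable_cong_sets[OF sets refl] by measurable
  have int: "integrable \<nu> ?k"
  proof (rule integrable_const_bound[where B = "1 / \<eta>"])
    show "AE t in \<nu>. norm (?k t) \<le> 1 / \<eta>"
    proof (rule AE_I2)
      fix t
      have "\<eta> \<le> cmod (complex_of_real t - Complex E \<eta>)"
        using abs_Im_le_cmod[of "complex_of_real t - Complex E \<eta>"] \<eta> by simp
      then show "norm (?k t) \<le> 1 / \<eta>" using \<eta> by (simp add: norm_divide frac_le)
    qed
  qed (rule meas)
  have Im_int: "Im (\<integral>t. ?k t \<partial>\<nu>) = (\<integral>t. \<eta> / ((t - E)\<^sup>2 + \<eta>\<^sup>2) \<partial>\<nu>)"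
    using integral_bounded_linear[OF bounded_linear_Im int] by (simp only: Im_cauchy_kernel[OF \<eta>])
  have int2: "integrable \<nu> (\<lambda>t. \<eta> / ((t - E)\<^sup>2 + \<eta>\<^sup>2))"
    using integrable_bounded_linear[OF bounded_linear_Im int] by (simp only: Im_cauchy_kernel[OF \<eta>])
  have "measure \<nu> {E - \<eta>..E + \<eta>} / (2 * \<eta>) = (\<integral>t. indicator {E - \<eta>..E + \<eta>} t / (2 * \<eta>) \<partial>\<nu>)"
    using sets sets_eq_imp_space_eq[OF sets] by simp
  also have "\<dots> \<le> (\<integral>t. \<eta> / ((t - E)\<^sup>2 + \<eta>\<^sup>2) \<partial>\<nu>)"
  proof (rule integral_mono[OF _ int2])
    have "{E - \<eta>..E + \<eta>} \<in> sets \<nu>" unfolding sets by simp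
    then show "integrable \<nu> (\<lambda>t. indicator {E - \<eta>..E + \<eta>} t / (2 * \<eta>) :: real)"
      by (intro integrable_divide_zero integrable_real_indicator) (auto simp: emeasure_finite less_top[symmetric])
    fix t
    show "indicator {E - \<eta>..E + \<eta>} t / (2 * \<eta>) \<le> \<eta> / ((t - E)\<^sup>2 + \<eta>\<^sup>2)"
    proof (cases "t \<in> {E - \<eta>..E + \<eta>}")
      case True
      then have "(t - E)\<^sup>2 \<le> \<eta>\<^sup>2" using \<eta> by (intro abs_le_square_iff[THEN iffD1]) (auto simp: abs_le_iff)
      then have "\<eta> / (2 * \<eta>\<^sup>2) \<le> \<eta> / ((t - E)\<^sup>2 + \<eta>\<^sup>2)"
        using \<eta> by (intro divide_left_mono) (auto simp: add_nonneg_pos)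
      then show ?thesis using True \<eta> by (simp add: power2_eq_square)
    qed (use \<eta> in simp)
  qed
  also have "\<dots> = Im (ell2_inner \<psi> (R \<psi>))"
    unfolding Im_int[symmetric] using F[OF _ R] \<eta> by simp
  also have "\<dots> = \<eta> * (norm \<phi>)\<^sup>2"
    unfolding 3 Im_ell2_inner[symmetric] Rep\<phi> Abs_l2_inverse[OF \<psi>] ..
  finally have "measure \<nu> {E - \<eta>..E + \<eta>} \<le> 2 * \<eta>\<^sup>2 * (norm \<phi>)\<^sup>2"
    using \<eta> by (simp add: field_simps power2_eq_square)
  with 1 3 show ?thesis using that by blast
qed

text \<open>The lower bound keeps \<open>\<phi>\<close> bounded as \<eta> tends to 0, so an interval
  of radius \<eta> has measure of order \<eta>^2. Cutting [a, b] into n pieces gives a total of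
  order 1/n.\<close>

lemma spectral_measure_null_interval:
  assumes sm: "is_spectral_measure (jacobi c) \<psi> \<nu>" and \<psi>: "\<psi> \<in> ell2" and ab: "a \<le> b" and \<delta>: "0 < \<delta>"
    and bb: "\<And>E x. a \<le> E \<Longrightarrow> E \<le> b \<Longrightarrow> \<delta> * norm x \<le> norm (jacobi_l2 c (of_real E) x)"
  shows "measure \<nu> {a..b} = 0"
proof -
  have sets: "sets \<nu> = sets borel" and fin: "finite_measure \<nu>"
    using sm unfolding is_spectral_measure_def by auto
  interpret finite_measure \<nu> by (rule fin)
  define C where "C = (norm (Abs_l2 \<psi>) / \<delta>)\<^sup>2"
  have small: "measure \<nu> {E - \<eta>..E + \<eta>} \<le> 2 * \<eta>\<^sup>2 * C" if E: "a \<le> E" "E \<le> b" and \<eta>: "0 < \<eta>" for E \<eta>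
  proof -
    obtain \<phi> where \<phi>: "jacobi_l2 c (Complex E \<eta>) \<phi> = Abs_l2 \<psi>"
      "measure \<nu> {E - \<eta>..E + \<eta>} \<le> 2 * \<eta>\<^sup>2 * (norm \<phi>)\<^sup>2"
      using spectral_measure_interval_bound[OF sm \<psi> \<eta>] by blast
    have "Complex E \<eta> = of_real E + Complex 0 \<eta>" by (simp add: complex_eq_iff)
    then have "(norm (jacobi_l2 c (of_real E) \<phi>))\<^sup>2 \<le> (norm (Abs_l2 \<psi>))\<^sup>2"
      using norm_jacobi_l2_complex[of "Complex 0 \<eta>" E \<phi>] \<phi>(1) by simp
    then have "norm (jacobi_l2 c (of_real E) \<phi>) \<le> norm (Abs_l2 \<psi>)" by (rule power2_le_imp_le) simp
    then have "\<delta> * norm \<phi> \<le> norm (Abs_l2 \<psi>)" using bb[OF E, of \<phi>] by simp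
    then have "norm \<phi> \<le> norm (Abs_l2 \<psi>) / \<delta>" using \<delta> by (simp add: field_simps)
    then have "(norm \<phi>)\<^sup>2 \<le> C" unfolding C_def by (intro power_mono) auto
    then have "2 * \<eta>\<^sup>2 * (norm \<phi>)\<^sup>2 \<le> 2 * \<eta>\<^sup>2 * C" by (intro mult_left_mono) auto
    then show ?thesis using \<phi>(2) by simp
  qed
  have step: "measure \<nu> {a..a + real n * h} \<le> real n * (h\<^sup>2 / 2 * C) + measure \<nu> {a}"
    if h: "0 < h" "a + real n * h \<le> b" for h n
    using h(2)
  proof (induction n)
    case (Suc n)
    have le: "a + real n * h \<le> b" using Suc.prems h by (simp add: algebra_simps)
    let ?E = "a + real n * h + h / 2"
    have "{a..a + real (Suc n) * h} = {a..a + real n * h} \<union> {?E - h / 2..?E + h / 2}"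
    proof -
      have *: "{a..p + h} = {a..p} \<union> {p + h / 2 - h / 2..p + h / 2 + h / 2}" if "a \<le> p" for p
        using h(1) that by auto
      have "0 \<le> real n * h" using h by simp
      then show ?thesis using *[of "a + real n * h"] by (simp add: algebra_simps)
    qed
    then have "measure \<nu> {a..a + real (Suc n) * h} \<le> measure \<nu> {a..a + real n * h} + measure \<nu> {?E - h / 2..?E + h / 2}"
      by (simp only:) (rule measure_Un_le; simp add: sets)
    also have "\<dots> \<le> (real n * (h\<^sup>2 / 2 * C) + measure \<nu> {a}) + 2 * (h / 2)\<^sup>2 * C"
    proof (intro add_mono Suc.IH le small)
      show "a \<le> ?E" using h by simp
      show "?E \<le> b" using Suc.prems h by (simp add: algebra_simps)
    qed (use h in simp)
    also have "\<dots> = real (Suc n) * (h\<^sup>2 / 2 * C) + measure \<nu> {a}" by (simp add: field_simps power2_eq_square)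
    finally show ?case .
  qed simp
  have atom: "measure \<nu> {a} = 0"
  proof -
    have "measure \<nu> {a} \<le> 2 * (1 / real (Suc n))\<^sup>2 * C" for n
    proof -
      have "measure \<nu> {a} \<le> measure \<nu> {a - 1 / real (Suc n)..a + 1 / real (Suc n)}"
        by (intro finite_measure_mono) (auto simp: sets)
      also have "\<dots> \<le> 2 * (1 / real (Suc n))\<^sup>2 * C" using ab by (intro small) auto
      finally show ?thesis .
    qed
    moreover have "(\<lambda>n. 2 * (1 / real (Suc n))\<^sup>2 * C) \<longlonglongrightarrow> 2 * 0\<^sup>2 * C"
      by (intro tendsto_intros LIMSEQ_inverse_real_of_nat[unfolded inverse_eq_divide])
    ultimately have "measure \<nu> {a} \<le> 2 * 0\<^sup>2 * C" by (intro LIMSEQ_le_const) auto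
    then show ?thesis using measure_nonneg[of \<nu> "{a}"] by simp
  qed
  show ?thesis
  proof (cases "a = b")
    case False
    with ab have "a < b" by simp
    have "measure \<nu> {a..b} \<le> (b - a)\<^sup>2 * C / 2 * (1 / real (Suc n))" for n
    proof -
      define h where "h = (b - a) / real (Suc n)"
      have "0 < h" using \<open>a < b\<close> by (simp add: h_def)
      moreover have "a + real (Suc n) * h = b" by (simp add: h_def)
      ultimately have "measure \<nu> {a..b} \<le> real (Suc n) * (h\<^sup>2 / 2 * C)"
        using step[of h "Suc n"] atom by simp
      also have "\<dots> = (b - a)\<^sup>2 * C / 2 * (1 / real (Suc n))"
        unfolding h_def power_divide by (simp add: power2_eq_square mult.assoc mult.commute del: of_nat_Suc)
      finally show ?thesis .
    qed
    moreover have "(\<lambda>n. (b - a)\<^sup>2 * C / 2 * (1 / real (Suc n))) \<longlonglongrightarrow> (b - a)\<^sup>2 * C / 2 * 0"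
      by (intro tendsto_intros LIMSEQ_inverse_real_of_nat[unfolded inverse_eq_divide])
    ultimately have "measure \<nu> {a..b} \<le> (b - a)\<^sup>2 * C / 2 * 0" by (intro LIMSEQ_le_const) auto
    then show ?thesis using measure_nonneg[of \<nu> "{a..b}"] by simp
  qed (use atom in simp)
qed

end

text \<open>Bounded and pointwise null sequences are weakly null: \<open>\<psi>\<close> is truncated
  to finitely many sites, and the rest is estimated by Cauchy-Schwarz.\<close>

lemma inner_l2_tendsto_0:
  assumes b: "\<And>k. norm (\<xi> k) \<le> B" and pt: "\<And>n. (\<lambda>k. Rep_l2 (\<xi> k) n) \<longlonglongrightarrow> 0"
  shows "(\<lambda>k. inner \<psi> (\<xi> k)) \<longlonglongrightarrow> (0::real)"
proof (rule tendstoI)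
  fix e :: real assume e: "0 < e"
  have B: "0 \<le> B" using b[of 0] norm_ge_zero order_trans by blast
  define d where "d = e / (2 * (B + 1))"
  have d: "0 < d" using e B by (simp add: d_def)
  let ?f = "\<lambda>n. (cmod (Rep_l2 \<psi> n))\<^sup>2"
  obtain F where F: "finite F" "(norm \<psi>)\<^sup>2 - d\<^sup>2 < sum ?f F"
  proof (rule ccontr)
    assume "\<not> thesis"
    then have "\<And>F. finite F \<Longrightarrow> sum ?f F \<le> (norm \<psi>)\<^sup>2 - d\<^sup>2" using that by force
    then have "(\<Sum>\<^sub>\<infinity>n. ?f n) \<le> (norm \<psi>)\<^sup>2 - d\<^sup>2" by (rule ell2I_bounded(2))
    then show False using d by (simp add: power2_norm_l2)
  qed
  define t where "t = (\<lambda>n. if n \<in> F then Rep_l2 \<psi> n else 0)"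
  have tl: "t \<in> ell2" by (rule ell2_comparison[OF Rep_l2[of \<psi>]]) (simp add: t_def)
  define \<psi>' where "\<psi>' = Abs_l2 t"
  have Rep': "Rep_l2 \<psi>' = t" unfolding \<psi>'_def by (rule Abs_l2_inverse[OF tl])
  have nd: "norm (\<psi> - \<psi>') \<le> d"
  proof (rule norm_l2_le)
    fix G :: "int set" assume G: "finite G"
    have "(\<Sum>n\<in>G. (cmod (Rep_l2 (\<psi> - \<psi>') n))\<^sup>2) = (\<Sum>n\<in>G - F. ?f n)"
      using G by (intro sum.mono_neutral_cong_right) (auto simp: Rep' t_def)
    also have "\<dots> = sum ?f (G \<union> F) - sum ?f F"
      using G F by (subst sum_diff[symmetric]) (auto intro!: sum.cong)
    also have "\<dots> \<le> d\<^sup>2" using sum_le_norm_l2[of "G \<union> F" \<psi>] G F by simp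
    finally show "(\<Sum>n\<in>G. (cmod (Rep_l2 (\<psi> - \<psi>') n))\<^sup>2) \<le> d\<^sup>2" .
  qed (use d in simp)
  have fin: "inner \<psi>' (\<xi> k) = (\<Sum>n\<in>F. inner (Rep_l2 \<psi> n) (Rep_l2 (\<xi> k) n))" for k
  proof -
    have "inner \<psi>' (\<xi> k) = (\<Sum>\<^sub>\<infinity>n\<in>F. inner (Rep_l2 \<psi> n) (Rep_l2 (\<xi> k) n))"
      unfolding inner_l2.rep_eq Rep' by (rule infsum_cong_neutral) (auto simp: t_def)
    then show ?thesis using F(1) by simp
  qed
  have "(\<lambda>k. \<Sum>n\<in>F. inner (Rep_l2 \<psi> n) (Rep_l2 (\<xi> k) n)) \<longlonglongrightarrow> (\<Sum>n\<in>F. inner (Rep_l2 \<psi> n) 0)"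
    by (intro tendsto_intros pt)
  then have "(\<lambda>k. inner \<psi>' (\<xi> k)) \<longlonglongrightarrow> 0" unfolding fin by simp
  then have "\<forall>\<^sub>F k in sequentially. dist (inner \<psi>' (\<xi> k)) 0 < e / 2" using e by (intro tendstoD) auto
  then show "\<forall>\<^sub>F k in sequentially. dist (inner \<psi> (\<xi> k)) 0 < e"
  proof eventually_elim
    case (elim k)
    have "\<bar>inner (\<psi> - \<psi>') (\<xi> k)\<bar> \<le> norm (\<psi> - \<psi>') * norm (\<xi> k)" by (rule Cauchy_Schwarz_ineq2)
    also have "\<dots> \<le> d * (B + 1)" using nd b[of k] d by (intro mult_mono) auto
    also have "\<dots> = e / 2" using B by (simp add: d_def field_simps)
    finally have "\<bar>inner (\<psi> - \<psi>') (\<xi> k)\<bar> \<le> e / 2" .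
    moreover have "\<bar>inner \<psi>' (\<xi> k)\<bar> < e / 2" using elim by (simp add: dist_real_def)
    ultimately have "\<bar>inner (\<psi> - \<psi>') (\<xi> k)\<bar> + \<bar>inner \<psi>' (\<xi> k)\<bar> < e / 2 + e / 2" by (rule add_le_less_mono)
    moreover have "inner \<psi> (\<xi> k) = inner (\<psi> - \<psi>') (\<xi> k) + inner \<psi>' (\<xi> k)" by (simp add: inner_diff_left)
    ultimately show ?case
      using abs_triangle_ineq[of "inner (\<psi> - \<psi>') (\<xi> k)" "inner \<psi>' (\<xi> k)"] by (simp add: dist_real_def)
  qed
qed

context bounded_potential
begin

text \<open>The spectrum itself is the null set that carries the measure. Its complement is locally
  null, hence null by the Lindelof property.\<close>

lemma spectral_measure_singular:
  assumes sm: "is_spectral_measure (jacobi c) \<psi> \<nu>" and \<psi>: "\<psi> \<in> ell2"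
    and null: "emeasure lborel {E. complex_of_real E \<in> spectrum (jacobi c)} = 0"
  shows "singular_measure \<nu>"
proof -
  let ?S = "{E. complex_of_real E \<in> spectrum (jacobi c)}"
  have sets: "sets \<nu> = sets borel" and fin: "finite_measure \<nu>"
    using sm unfolding is_spectral_measure_def by auto
  interpret finite_measure \<nu> by (rule fin)
  define \<F> where "\<F> = {U :: real set. open U \<and> U \<in> null_sets \<nu>}"
  have "- ?S \<subseteq> \<Union>\<F>"
  proof
    fix E assume "E \<in> - ?S"
    then obtain \<delta> where \<delta>: "0 < \<delta>" "\<And>x. \<delta> * norm x \<le> norm (jacobi_l2 c (of_real E) x)"
      unfolding Compl_iff mem_Collect_eq spectrum_iff by blast
    define d where "d = \<delta> / 2"
    have d: "0 < d" using \<delta> by (simp add: d_def)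
    have bb: "d * norm x \<le> norm (jacobi_l2 c (of_real E') x)"
      if "E - d \<le> E'" "E' \<le> E + d" for E' x
    proof -
      have "\<bar>E - E'\<bar> \<le> d" using that by (auto simp: abs_le_iff)
      then have "\<bar>E - E'\<bar> * norm x \<le> d * norm x" by (intro mult_right_mono) auto
      moreover have "\<delta> * norm x = d * norm x + d * norm x" by (simp add: d_def)
      ultimately show ?thesis using \<delta>(2)[of x] jacobi_l2_energy[of E x E'] by linarith
    qed
    have "measure \<nu> {E - d..E + d} = 0"
      by (rule spectral_measure_null_interval[OF sm \<psi>, where \<delta> = d]) (use d bb in auto)
    then have "emeasure \<nu> {E - d..E + d} = 0" by (simp add: emeasure_eq_measure)
    then have "{E - d..E + d} \<in> null_sets \<nu>" by (simp add: null_sets_def sets)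
    then have "{E - d<..<E + d} \<in> null_sets \<nu>"
      by (rule null_sets_subset) (auto simp: sets)
    then have "{E - d<..<E + d} \<in> \<F>" by (simp add: \<F>_def)
    moreover have "E \<in> {E - d<..<E + d}" using d by simp
    ultimately show "E \<in> \<Union>\<F>" by blast
  qed
  moreover obtain \<F>' where \<F>': "\<F>' \<subseteq> \<F>" "countable \<F>'" "\<Union>\<F>' = \<Union>\<F>"
    using Lindelof[of \<F>] by (auto simp: \<F>_def)
  moreover have "\<Union>\<F>' \<in> null_sets \<nu>"
    using null_sets_UN'[OF \<F>'(2), of "\<lambda>U. U" \<nu>] \<F>'(1) by (auto simp: \<F>_def)
  moreover have S: "?S \<in> sets borel" using closed_spectrum by (rule borel_closed)
  ultimately have "- ?S \<in> null_sets \<nu>"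
    by (intro null_sets_subset[of "\<Union>\<F>'" \<nu> "- ?S"]) (auto simp: sets)
  then show ?thesis unfolding singular_measure_def using S null by (intro bexI[of _ ?S]) auto
qed

text \<open>If the spectral measure has an atom at \<open>E\<close>, then \<open>\<eta> (H - E - \<i>\<eta>)\<^sup>-\<^sup>1 \<psi>\<close> has a subsequence, as
  \<open>\<eta>\<close> tends to \<open>0\<close>, whose pointwise limit is an eigenfunction: the recursion spreads convergence
  from the sites \<open>0\<close> and \<open>1\<close> to all sites.\<close>

lemma spectral_measure_no_atom:
  assumes sm: "is_spectral_measure (jacobi c) \<psi> \<nu>" and \<psi>: "\<psi> \<in> ell2"
    and noeig: "\<And>u. u \<in> ell2 \<Longrightarrow> (\<And>n. jacobi c u n = of_real E * u n) \<Longrightarrow> u = (\<lambda>_. 0)"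
  shows "emeasure \<nu> {E} = 0"
proof -
  have sets: "sets \<nu> = sets borel" and fin: "finite_measure \<nu>"
    using sm unfolding is_spectral_measure_def by auto
  interpret finite_measure \<nu> by (rule fin)
  define \<eta> where "\<eta> k = 1 / real (Suc k)" for k
  have \<eta>0: "0 < \<eta> k" for k by (simp add: \<eta>_def)
  have \<eta>lim: "\<eta> \<longlonglongrightarrow> 0" unfolding \<eta>_def[abs_def] by (rule LIMSEQ_inverse_real_of_nat[unfolded inverse_eq_divide])
  have "\<exists>\<phi>. jacobi_l2 c (Complex E (\<eta> k)) \<phi> = Abs_l2 \<psi> \<and>
    measure \<nu> {E - \<eta> k..E + \<eta> k} \<le> 2 * (\<eta> k)\<^sup>2 * (norm \<phi>)\<^sup>2 \<and>
    \<eta> k * (norm \<phi>)\<^sup>2 = inner (Abs_l2 \<psi>) (cscale_l2 (- \<i>) \<phi>)" for k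
    using spectral_measure_interval_bound[OF sm \<psi> \<eta>0, of E k] by blast
  then obtain \<phi> where \<phi>: "\<And>k. jacobi_l2 c (Complex E (\<eta> k)) (\<phi> k) = Abs_l2 \<psi>"
    "\<And>k. measure \<nu> {E - \<eta> k..E + \<eta> k} \<le> 2 * (\<eta> k)\<^sup>2 * (norm (\<phi> k))\<^sup>2"
    "\<And>k. \<eta> k * (norm (\<phi> k))\<^sup>2 = inner (Abs_l2 \<psi>) (cscale_l2 (- \<i>) (\<phi> k))"
    by metis
  define \<xi> where "\<xi> k = \<eta> k *\<^sub>R \<phi> k" for k
  define B where "B = norm (Abs_l2 \<psi>)"
  have \<xi>B: "norm (\<xi> k) \<le> B" for k
  proof (rule power2_le_imp_le)
    have "Complex E (\<eta> k) = of_real E + Complex 0 (\<eta> k)" by (simp add: complex_eq_iff)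
    then have "(norm (Abs_l2 \<psi>))\<^sup>2 = (norm (jacobi_l2 c (of_real E) (\<phi> k)))\<^sup>2 + (\<eta> k * norm (\<phi> k))\<^sup>2"
      using norm_jacobi_l2_complex[of "Complex 0 (\<eta> k)" E "\<phi> k"] \<phi>(1)[of k] \<eta>0[of k] by (simp add: cmod_def)
    then show "(norm (\<xi> k))\<^sup>2 \<le> B\<^sup>2" using \<eta>0[of k] by (simp add: B_def \<xi>_def)
  qed (simp add: B_def)
  have pt: "cmod (Rep_l2 (\<xi> k) n) \<le> B" for k n using cmod_le_norm_l2 \<xi>B order_trans by blast
  have "compact (cball (0::complex) B \<times> cball (0::complex) B)" by (intro compact_Times compact_cball)
  then obtain l r where lr: "strict_mono (r :: nat \<Rightarrow> nat)"
     "((\<lambda>k. (Rep_l2 (\<xi> k) 0, Rep_l2 (\<xi> k) 1)) \<circ> r) \<longlonglongrightarrow> l"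
    using pt unfolding compact_eq_seq_compact_metric seq_compact_def
    by (metis (no_types, lifting) SigmaI dist_0_norm mem_cball)
  define w where "w k n = Rep_l2 (\<xi> (r k)) n" for k n
  have l0: "(\<lambda>k. w k 0) \<longlonglongrightarrow> fst l" and l1: "(\<lambda>k. w k 1) \<longlonglongrightarrow> snd l"
    using tendsto_fst[OF lr(2)] tendsto_snd[OF lr(2)] by (simp_all add: w_def o_def)
  define z where "z k = Complex E (\<eta> (r k))" for k
  have \<eta>r: "(\<lambda>k. \<eta> (r k)) \<longlonglongrightarrow> 0"
    using LIMSEQ_subseq_LIMSEQ[OF \<eta>lim lr(1)] by (simp add: o_def)
  have z: "z \<longlonglongrightarrow> of_real E"
  proof -
    have "z = (\<lambda>k. of_real E + \<i> * of_real (\<eta> (r k)))" by (simp add: fun_eq_iff z_def complex_eq_iff)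
    moreover have "(\<lambda>k. of_real E + \<i> * of_real (\<eta> (r k))) \<longlonglongrightarrow> of_real E + \<i> * of_real 0"
      by (intro tendsto_intros \<eta>r)
    ultimately show ?thesis by simp
  qed
  have rec: "w k (n + 1) + w k (n - 1) + of_real (c n) * w k n - z k * w k n = of_real (\<eta> (r k)) * \<psi> n" for k n
  proof -
    have "Rep_l2 (jacobi_l2 c (z k) (\<phi> (r k))) n = \<psi> n"
      unfolding z_def \<phi>(1) by (simp add: Abs_l2_inverse[OF \<psi>])
    then have "of_real (\<eta> (r k)) * (jacobi c (Rep_l2 (\<phi> (r k))) n - z k * Rep_l2 (\<phi> (r k)) n) = of_real (\<eta> (r k)) * \<psi> n"
      by (simp add: Rep_jacobi_l2)
    then show ?thesis by (simp add: w_def \<xi>_def jacobi_def scaleR_conv_of_real algebra_simps)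
  qed
  have "convergent (\<lambda>k. w k n) \<and> convergent (\<lambda>k. w k (n + 1))" for n
  proof (induction n rule: int_induct[where k = 0])
    case base
    show ?case using l0 l1 by (auto intro: convergentI)
  next
    case (step1 n)
    then obtain a b where ab: "(\<lambda>k. w k n) \<longlonglongrightarrow> a" "(\<lambda>k. w k (n + 1)) \<longlonglongrightarrow> b" by (auto simp: convergent_def)
    have "w k (n + 1 + 1) = of_real (\<eta> (r k)) * \<psi> (n + 1) - w k n - of_real (c (n + 1)) * w k (n + 1) + z k * w k (n + 1)" for k
      using rec[of k "n + 1"] by (simp add: algebra_simps)
    moreover have "(\<lambda>k. of_real (\<eta> (r k)) * \<psi> (n + 1) - w k n - of_real (c (n + 1)) * w k (n + 1) + z k * w k (n + 1))
        \<longlonglongrightarrow> of_real 0 * \<psi> (n + 1) - a - of_real (c (n + 1)) * b + of_real E * b"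
      by (intro tendsto_intros ab z \<eta>r)
    ultimately show ?case using step1 by (auto intro: convergentI)
  next
    case (step2 n)
    then obtain a b where ab: "(\<lambda>k. w k n) \<longlonglongrightarrow> a" "(\<lambda>k. w k (n + 1)) \<longlonglongrightarrow> b" by (auto simp: convergent_def)
    have "w k (n - 1) = of_real (\<eta> (r k)) * \<psi> n - w k (n + 1) - of_real (c n) * w k n + z k * w k n" for k
      using rec[of k n] by (simp add: algebra_simps)
    moreover have "(\<lambda>k. of_real (\<eta> (r k)) * \<psi> n - w k (n + 1) - of_real (c n) * w k n + z k * w k n)
        \<longlonglongrightarrow> of_real 0 * \<psi> n - b - of_real (c n) * a + of_real E * a"
      by (intro tendsto_intros ab z \<eta>r)
    ultimately show ?case using step2 by (auto intro: convergentI)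
  qed
  then obtain u where u: "\<And>n. (\<lambda>k. w k n) \<longlonglongrightarrow> u n" unfolding convergent_def by metis
  have "u \<in> ell2"
  proof (rule ell2I_bounded(1)[where C = "B\<^sup>2"])
    fix F :: "int set" assume F: "finite F"
    have "(\<lambda>k. \<Sum>n\<in>F. (cmod (w k n))\<^sup>2) \<longlonglongrightarrow> (\<Sum>n\<in>F. (cmod (u n))\<^sup>2)" by (intro tendsto_intros u)
    moreover have "(\<Sum>n\<in>F. (cmod (w k n))\<^sup>2) \<le> B\<^sup>2" for k
      unfolding w_def using sum_le_norm_l2[OF F, of "\<xi> (r k)"] power_mono[OF \<xi>B[of "r k"] norm_ge_zero, of 2] by simp
    ultimately show "(\<Sum>n\<in>F. (cmod (u n))\<^sup>2) \<le> B\<^sup>2" by (intro LIMSEQ_le_const2) auto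
  qed
  moreover have "jacobi c u n = of_real E * u n" for n
  proof -
    have "(\<lambda>k. w k (n + 1) + w k (n - 1) + of_real (c n) * w k n - z k * w k n)
       \<longlonglongrightarrow> u (n + 1) + u (n - 1) + of_real (c n) * u n - of_real E * u n"
      by (intro tendsto_intros u z)
    moreover have "(\<lambda>k. of_real (\<eta> (r k)) * \<psi> n) \<longlonglongrightarrow> of_real 0 * \<psi> n" by (intro tendsto_intros \<eta>r)
    ultimately have "u (n + 1) + u (n - 1) + of_real (c n) * u n - of_real E * u n = of_real 0 * \<psi> n"
      unfolding rec by (rule LIMSEQ_unique)
    then show ?thesis by (simp add: jacobi_def)
  qed
  ultimately have u0: "u = (\<lambda>_. 0)" by (rule noeig)
  have lim: "(\<lambda>k. inner (Abs_l2 \<psi>) (cscale_l2 (- \<i>) (\<xi> (r k)))) \<longlonglongrightarrow> 0"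
  proof (rule inner_l2_tendsto_0)
    show "norm (cscale_l2 (- \<i>) (\<xi> (r k))) \<le> B" for k using \<xi>B by simp
    fix n
    have "(\<lambda>k. - \<i> * w k n) \<longlonglongrightarrow> - \<i> * 0" using u[of n] u0 by (intro tendsto_intros) simp
    then show "(\<lambda>k. Rep_l2 (cscale_l2 (- \<i>) (\<xi> (r k))) n) \<longlonglongrightarrow> 0" by (simp add: cscale_l2.rep_eq w_def)
  qed
  \<comment> \<open>Bounding the atom by a pairing linear in \<open>\<xi>\<close> makes weak
    convergence enough; the norm of \<open>\<xi>\<close> need not tend to 0.\<close>
  have "measure \<nu> {E} \<le> 2 * inner (Abs_l2 \<psi>) (cscale_l2 (- \<i>) (\<xi> k))" for k
  proof -
    have "measure \<nu> {E} \<le> measure \<nu> {E - \<eta> k..E + \<eta> k}"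
      using \<eta>0[of k] by (intro finite_measure_mono) (auto simp: sets)
    also have "\<dots> \<le> 2 * \<eta> k * (\<eta> k * (norm (\<phi> k))\<^sup>2)" using \<phi>(2)[of k] by (simp add: power2_eq_square)
    also have "\<dots> = 2 * inner (Abs_l2 \<psi>) (\<eta> k *\<^sub>R cscale_l2 (- \<i>) (\<phi> k))" unfolding \<phi>(3) by simp
    also have "\<eta> k *\<^sub>R cscale_l2 (- \<i>) (\<phi> k) = cscale_l2 (- \<i>) (\<xi> k)"
      by (rule l2_ext) (simp add: \<xi>_def cscale_l2.rep_eq)
    finally show ?thesis .
  qed
  then have "measure \<nu> {E} \<le> 2 * 0" by (intro LIMSEQ_le_const[OF tendsto_mult_left[OF lim]]) auto
  then have "measure \<nu> {E} = 0" using measure_nonneg[of \<nu> "{E}"] by simp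
  then show ?thesis by (simp add: emeasure_eq_measure)
qed

end

subsection \<open>Good periodic approximants\<close>

text \<open>Squaring sends the trace t to t^2 - 2, so an excess s <= 1 over 2 becomes at most 4 s +
  s^2 <= 5 s. While |t| <= 3 the norm plus 1 at most triples. Hence 2^m periods cost only the factor
  3^m, polynomial in their number.\<close>

lemma nm2_power_doubling:
  assumes det: "det2 M = 1" and tr: "\<bar>tr2 M\<bar> \<le> 2 + \<eta>" and \<eta>: "0 \<le> \<eta>" "\<eta> \<le> 1 / 5 ^ m"
  shows "nm2 (M ^ 2 ^ m) + 1 \<le> 3 ^ m * (nm2 M + 1)"
proof -
  have "\<bar>tr2 (M ^ 2 ^ i)\<bar> \<le> 2 + 5 ^ i * \<eta> \<and> nm2 (M ^ 2 ^ i) + 1 \<le> 3 ^ i * (nm2 M + 1)" if "i \<le> m" for i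
    using that
  proof (induction i)
    case 0
    then show ?case using tr by simp
  next
    case (Suc i)
    let ?A = "M ^ 2 ^ i"
    have sq: "M ^ 2 ^ Suc i = ?A * ?A" by (simp add: power_add[symmetric] mult_2)
    have dA: "det2 ?A = 1" using det by (simp add: det2_power)
    have IH: "\<bar>tr2 ?A\<bar> \<le> 2 + 5 ^ i * \<eta>" "nm2 ?A + 1 \<le> 3 ^ i * (nm2 M + 1)" using Suc by auto
    have "5 ^ i * \<eta> \<le> 5 ^ m * (1 / 5 ^ m)" using Suc.prems \<eta> by (intro mult_mono power_increasing) auto
    then have s1: "5 ^ i * \<eta> \<le> 1" by simp
    have s0: "0 \<le> 5 ^ i * \<eta>" using \<eta> by simp
    have "(tr2 ?A)\<^sup>2 \<le> (2 + 5 ^ i * \<eta>)\<^sup>2" using power_mono[OF IH(1) abs_ge_zero, of 2] by simp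
    also have "\<dots> = 4 + 4 * (5 ^ i * \<eta>) + (5 ^ i * \<eta>) * (5 ^ i * \<eta>)" by (simp add: power2_eq_square algebra_simps)
    also have "\<dots> \<le> 4 + 4 * (5 ^ i * \<eta>) + 1 * (5 ^ i * \<eta>)" using s0 s1 by (intro add_left_mono mult_right_mono)
    also have "\<dots> = 4 + 5 * (5 ^ i * \<eta>)" by simp
    finally have "(tr2 ?A)\<^sup>2 \<le> 4 + 5 * (5 ^ i * \<eta>)" .
    then have "\<bar>tr2 (?A * ?A)\<bar> \<le> 2 + 5 * (5 ^ i * \<eta>)"
      unfolding tr2_square[OF dA] using s0 zero_le_power2[of "tr2 ?A"] by (intro abs_leI) linarith+
    then have t: "\<bar>tr2 (?A * ?A)\<bar> \<le> 2 + 5 ^ Suc i * \<eta>" by (simp only: power_Suc mult.assoc)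
    have "nm2 (?A * ?A) \<le> \<bar>tr2 ?A\<bar> * nm2 ?A + 2" by (rule nm2_square_le[OF dA])
    also have "\<dots> \<le> 3 * nm2 ?A + 2" using IH(1) s1 by (intro add_right_mono mult_right_mono) auto
    finally have "nm2 (?A * ?A) + 1 \<le> 3 * (nm2 ?A + 1)" by simp
    also have "\<dots> \<le> 3 * (3 ^ i * (nm2 M + 1))" using IH(2) by simp
    finally show ?case using t unfolding sq by simp
  qed
  then show ?thesis by blast
qed

lemma closed_bands:
  fixes V :: "int \<Rightarrow> real"
  shows "closed {E. \<bar>E\<bar> \<le> R \<and> \<bar>tr2 (tm (\<lambda>i. E - l * V i) 0 q)\<bar> \<le> C}"
proof -
  have "continuous_on UNIV ((\<lambda>z. tr2 (tm (\<lambda>i. snd z - fst z * V i) 0 q)) \<circ> (\<lambda>E. (l, E)))"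
    by (intro continuous_on_compose continuous_on_subset[OF continuous_tr2_tm] continuous_intros) auto
  then have "continuous_on UNIV (\<lambda>E. tr2 (tm (\<lambda>i. E - l * V i) 0 q))" by (simp add: o_def)
  then show ?thesis by (intro closed_Collect_conj closed_Collect_le continuous_intros)
qed

text \<open>A \<open>q\<close>-periodic sequence \<open>V\<close> that is good at level \<open>k\<close>: its bands are short for all couplings in
  \<open>[1/k, k]\<close>, and \<open>r\<close> is so small that whatever stays within \<open>2 * r\<close> of \<open>V\<close> inherits, up to errors
  of order \<open>1/k\<close>, its spectrum, the growth of its transfer matrices over \<open>2 ^ m\<close> periods, and its
  repetitions.\<close>

definition good_period ::
  "nat \<Rightarrow> nat \<Rightarrow> (int \<Rightarrow> real) \<Rightarrow> real \<Rightarrow> real \<Rightarrow> nat \<Rightarrow> real \<Rightarrow> bool" where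
  "good_period k q V \<eta> X m r \<longleftrightarrow> 0 < k \<and> k \<le> q \<and> (\<forall>n. V (n + int q) = V n) \<and> 0 < \<eta> \<and> \<eta> \<le> 1 / 5 ^ m \<and> 0 < r \<and>
    (\<forall>n. real k + real k * (\<bar>V n\<bar> + 2 * r) \<le> X) \<and>
    (\<forall>l. 1 / real k \<le> \<bar>l\<bar> \<longrightarrow> \<bar>l\<bar> \<le> real k \<longrightarrow>
       emeasure lborel {E. \<bar>E\<bar> \<le> real k \<and> \<bar>tr2 (tm (\<lambda>i. E - l * V i) 0 q)\<bar> \<le> 2 + \<eta>} \<le> ennreal (1 / real k)) \<and>
    6 * (X + 2) ^ (2 * q) * real (2 * q) * (real k * (2 * r)) \<le> min (\<eta> / 2) (1 / real k) \<and>
    3 ^ m * (2 * (X + 2) ^ q + 1) \<le> exp (real (2 ^ m * q) / real k) \<and>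
    2 * real (2 ^ m * q) * (X + 2) ^ (2 ^ m * q) * (real k * (2 * r)) \<le> 1"

lemma good_period_shift:
  assumes "good_period k q V \<eta> X m r" shows "good_period k q (\<lambda>n. V (n + s)) \<eta> X m r"
proof -
  have per: "V (n + int q) = V n" for n using assms by (simp add: good_period_def)
  have "tr2 (tm (\<lambda>i. E - l * V (i + s)) 0 q) = tr2 (tm (\<lambda>i. E - l * V i) 0 q)" for E l
  proof -
    have "tm (\<lambda>i. E - l * V (i + s)) 0 q = tm (\<lambda>i. E - l * V i) s q"
      using tm_translate[of "\<lambda>i. E - l * V i" s 0 q] by simp
    then show ?thesis using tr2_tm_shift[of "\<lambda>i. E - l * V i" q s] per by simp
  qed
  moreover have "V (n + int q + s) = V (n + s)" for n using per[of "n + s"] by (simp add: algebra_simps)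
  ultimately show ?thesis using assms unfolding good_period_def by simp
qed

context
  fixes k q V \<eta> X m r and a :: "int \<Rightarrow> real" and l :: real
  assumes good: "good_period k q V \<eta> X m r" and a: "\<And>n. \<bar>a n - V n\<bar> \<le> 2 * r"
    and l: "\<bar>l\<bar> \<le> real k"
begin

private lemma good_facts:
  "0 < k" "k \<le> q" "V (n + int q) = V n" "0 < \<eta>" "\<eta> \<le> 1 / 5 ^ m" "0 < r"
  "6 * (X + 2) ^ (2 * q) * real (2 * q) * (real k * (2 * r)) \<le> min (\<eta> / 2) (1 / real k)"
  "3 ^ m * (2 * (X + 2) ^ q + 1) \<le> exp (real (2 ^ m * q) / real k)"
  "2 * real (2 ^ m * q) * (X + 2) ^ (2 ^ m * q) * (real k * (2 * r)) \<le> 1"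
  using good by (simp_all add: good_period_def)

private lemma lV_le: "\<bar>l * V n\<bar> \<le> real k * (\<bar>V n\<bar> + 2 * r)" "\<bar>l * a n\<bar> \<le> real k * (\<bar>V n\<bar> + 2 * r)"
proof -
  have "\<bar>V n\<bar> \<le> \<bar>V n\<bar> + 2 * r" "\<bar>a n\<bar> \<le> \<bar>V n\<bar> + 2 * r" using good_facts(6) a[of n] by auto
  then show "\<bar>l * V n\<bar> \<le> real k * (\<bar>V n\<bar> + 2 * r)" "\<bar>l * a n\<bar> \<le> real k * (\<bar>V n\<bar> + 2 * r)"
    unfolding abs_mult using l by (auto intro!: mult_mono)
qed

private lemma X_bound: "real k + real k * (\<bar>V n\<bar> + 2 * r) \<le> X"
  using good by (simp add: good_period_def)

private lemma X_nonneg: "0 \<le> X"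
  using X_bound[of 0] good_facts(6) by (meson add_nonneg_nonneg abs_ge_zero mult_nonneg_nonneg of_nat_0_le_iff
    order.trans less_imp_le zero_le_numeral)

private lemma pot_V: "bounded_potential (\<lambda>n. l * V n) X"
proof
  show "\<bar>l * V n\<bar> \<le> X" for n using lV_le(1)[of n] X_bound[of n] of_nat_0_le_iff[of k] by linarith
qed

private lemma pot_a: "bounded_potential (\<lambda>n. l * a n) X"
proof
  show "\<bar>l * a n\<bar> \<le> X" for n using lV_le(2)[of n] X_bound[of n] of_nat_0_le_iff[of k] by linarith
qed

private lemma energy_bound:
  assumes "\<bar>E\<bar> \<le> real k" shows "\<bar>E - l * V n\<bar> \<le> X" "\<bar>E - l * a n\<bar> \<le> X"
  using assms lV_le[of n] X_bound[of n] by linarith+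

private lemma la_close: "\<bar>l * a n - l * V n\<bar> \<le> real k * (2 * r)"
proof -
  have "\<bar>l * a n - l * V n\<bar> = \<bar>l\<bar> * \<bar>a n - V n\<bar>" by (simp add: right_diff_distrib[symmetric] abs_mult)
  also have "\<dots> \<le> real k * (2 * r)" using a[of n] l by (intro mult_mono) auto
  finally show ?thesis .
qed

text \<open>Outside these bands the periodic operator is bounded below by more than \<eta> / C, and
  replacing its potential costs at most \<eta> / (2 C).\<close>

lemma good_spectrum:
  assumes E: "\<bar>E\<bar> \<le> real k" "complex_of_real E \<in> spectrum (jacobi (\<lambda>n. l * a n))"
  shows "\<bar>tr2 (tm (\<lambda>i. E - l * V i) 0 q)\<bar> \<le> 2 + \<eta>"
proof (rule ccontr)
  assume neg: "\<not> ?thesis"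
  interpret A: bounded_potential "\<lambda>n. l * a n" X by (rule pot_a)
  interpret V: bounded_potential "\<lambda>n. l * V n" X by (rule pot_V)
  define C where "C = 6 * (X + 2) ^ (2 * q) * real (2 * q)"
  have C: "0 < C" using X_nonneg good_facts(1,2) by (simp add: C_def)
  have "\<eta> / (2 * C) * norm x \<le> norm (jacobi_l2 (\<lambda>n. l * a n) (of_real E) x)" for x
  proof -
    let ?A = "norm (jacobi_l2 (\<lambda>n. l * a n) (of_real E) x)"
    have "\<eta> * norm x \<le> (\<bar>tr2 (tm (\<lambda>i. E - l * V i) 0 q)\<bar> - 2) * norm x"
      using neg by (intro mult_right_mono) auto
    also have "\<dots> \<le> C * norm (jacobi_l2 (\<lambda>n. l * V n) (of_real E) x)"
      unfolding C_def
      by (rule periodic_bounded_below[OF pot_V]) (use good_facts(3) energy_bound[OF E(1)] in auto)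
    also have "\<dots> \<le> C * (?A + real k * (2 * r) * norm x)"
      using C la_close by (intro mult_left_mono V.jacobi_l2_perturbation[OF pot_a]) (auto simp: abs_minus_commute)
    also have "\<dots> = C * ?A + C * (real k * (2 * r)) * norm x" by (simp add: algebra_simps)
    also have "\<dots> \<le> C * ?A + \<eta> / 2 * norm x"
      using good_facts(7) by (intro add_left_mono mult_right_mono) (auto simp: C_def)
    finally have "\<eta> / 2 * norm x \<le> C * ?A" by (simp add: field_simps)
    then show ?thesis using C by (simp add: field_simps)
  qed
  moreover have "0 < \<eta> / (2 * C)" using C good_facts(4) by simp
  ultimately show False using E(2) unfolding A.spectrum_iff by blast
qed

text \<open>Repeated squaring controls the periodic product. The actual product differs from it by
  at most 1, which the summand 1 in the doubling estimate absorbs.\<close>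

lemma good_growth:
  assumes E: "\<bar>E\<bar> \<le> real k" "complex_of_real E \<in> spectrum (jacobi (\<lambda>n. l * a n))"
  shows "nm2 (tm (\<lambda>i. E - l * a i) j (2 ^ m * q)) \<le> exp (real (2 ^ m * q) / real k)"
proof -
  let ?b = "\<lambda>i. E - l * V i"
  define M where "M = tm ?b j q"
  have per: "?b (n + int q) = ?b n" for n using good_facts(3) by simp
  have tr: "\<bar>tr2 M\<bar> \<le> 2 + \<eta>"
    using good_spectrum[OF E] tr2_tm_shift[of ?b q j] per by (simp add: M_def)
  have "nm2 (M ^ 2 ^ m) + 1 \<le> 3 ^ m * (nm2 M + 1)"
    by (rule nm2_power_doubling[OF _ tr]) (use good_facts in \<open>auto simp: M_def\<close>)
  also have "\<dots> \<le> 3 ^ m * (2 * (X + 2) ^ q + 1)"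
    using nm2_tm_le[of ?b X j q] energy_bound(1)[OF E(1)] by (intro mult_left_mono) (auto simp: M_def)
  finally have 1: "nm2 (M ^ 2 ^ m) + 1 \<le> exp (real (2 ^ m * q) / real k)" using good_facts(8) by simp
  have pw: "tm ?b j (2 ^ m * q) = M ^ 2 ^ m" unfolding M_def by (rule tm_power) (rule per)
  have "diff2 (tm (\<lambda>i. E - l * a i) j (2 ^ m * q)) (tm ?b j (2 ^ m * q))
     \<le> 2 * real (2 ^ m * q) * (X + 2) ^ (2 ^ m * q) * (real k * (2 * r))"
    by (rule diff2_tm_le) (use energy_bound[OF E(1)] la_close in \<open>auto simp: abs_minus_commute\<close>)
  also have "\<dots> \<le> 1" by (rule good_facts(9))
  finally have "diff2 (tm (\<lambda>i. E - l * a i) j (2 ^ m * q)) (M ^ 2 ^ m) \<le> 1" unfolding pw .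
  then show ?thesis using 1 nm2_le_diff2[of "tm (\<lambda>i. E - l * a i) j (2 ^ m * q)" "M ^ 2 ^ m"] by linarith
qed

lemma good_repetition:
  assumes E: "\<bar>E\<bar> \<le> real k"
  shows "\<exists>q V X r. k \<le> q \<and> (\<forall>n. V (n + int q) = V n) \<and> (\<forall>n. \<bar>E - V n\<bar> \<le> X)
      \<and> (\<forall>n. \<bar>l * a n - V n\<bar> \<le> r) \<and> 6 * (X + 2) ^ (2 * q) * real (2 * q) * r \<le> 1 / real k"
  by (rule exI[of _ q], rule exI[of _ "\<lambda>n. l * V n"], rule exI[of _ X], rule exI[of _ "real k * (2 * r)"])
    (use good_facts energy_bound[OF E] la_close in auto)

lemma good_bands:
  assumes "1 / real k \<le> \<bar>l\<bar>"
  shows "emeasure lborel {E. \<bar>E\<bar> \<le> real k \<and> complex_of_real E \<in> spectrum (jacobi (\<lambda>n. l * a n))} \<le> ennreal (1 / real k)"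
proof -
  let ?W = "{E. \<bar>E\<bar> \<le> real k \<and> \<bar>tr2 (tm (\<lambda>i. E - l * V i) 0 q)\<bar> \<le> 2 + \<eta>}"
  have "?W \<in> sets lborel" by (simp add: borel_closed closed_bands)
  then have "emeasure lborel {E. \<bar>E\<bar> \<le> real k \<and> complex_of_real E \<in> spectrum (jacobi (\<lambda>n. l * a n))} \<le> emeasure lborel ?W"
    using good_spectrum by (intro emeasure_mono) auto
  also have "\<dots> \<le> ennreal (1 / real k)" using good assms l by (simp add: good_period_def)
  finally show ?thesis .
qed

end

section \<open>Spectral consequences of periodic approximation\<close>

text \<open>One \<open>r\<close> of the margin is for the distance of the function from a periodic
  one, the other for replacing the orbit of a base point by a shift of the orbit of 0.\<close>

definition approximable :: "(int \<Rightarrow> real) \<Rightarrow> bool" where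
  "approximable a \<longleftrightarrow> (\<forall>k>0. \<exists>q V \<eta> X m r. good_period k q V \<eta> X m r \<and> (\<forall>n. \<bar>a n - V n\<bar> \<le> 2 * r))"

text \<open>For large \<open>k\<close> the window |E| <= k contains the whole spectrum and the
  coupling lies in the range of stage \<open>k\<close>, so the measure is at most 1/k.\<close>

lemma approximable_spectrum_null:
  assumes a: "approximable a" and M: "\<And>n. \<bar>a n\<bar> \<le> M" and l: "l \<noteq> 0"
  shows "emeasure lborel {E. complex_of_real E \<in> spectrum (jacobi (\<lambda>n. l * a n))} = 0"
proof -
  let ?S = "{E. complex_of_real E \<in> spectrum (jacobi (\<lambda>n. l * a n))}"
  interpret bounded_potential "\<lambda>n. l * a n" "\<bar>l\<bar> * M"
    by standard (simp add: abs_mult M mult_left_mono)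
  obtain k0 :: nat where k0: "max (max \<bar>l\<bar> (1 / \<bar>l\<bar>)) (2 + \<bar>l\<bar> * M) < real k0" using reals_Archimedean2 by blast
  have "emeasure lborel ?S \<le> ennreal (1 / real (Suc (k0 + j)))" for j
  proof -
    let ?k = "Suc (k0 + j)"
    obtain q V \<eta> X m r where g: "good_period ?k q V \<eta> X m r" "\<And>n. \<bar>a n - V n\<bar> \<le> 2 * r"
      using a unfolding approximable_def by blast
    have lk: "\<bar>l\<bar> \<le> real ?k" "1 / \<bar>l\<bar> \<le> real ?k" using k0 by auto
    then have "1 / real ?k \<le> \<bar>l\<bar>" using l by (simp add: field_simps)
    then have "emeasure lborel {E. \<bar>E\<bar> \<le> real ?k \<and> complex_of_real E \<in> spectrum (jacobi (\<lambda>n. l * a n))} \<le> ennreal (1 / real ?k)"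
      by (rule good_bands[OF g lk(1)])
    moreover have "{E. \<bar>E\<bar> \<le> real ?k \<and> complex_of_real E \<in> spectrum (jacobi (\<lambda>n. l * a n))} = ?S"
      using spectrum_bounded k0 by force
    ultimately show ?thesis by simp
  qed
  moreover have "(\<lambda>j. ennreal (1 / real (Suc (k0 + j)))) \<longlonglongrightarrow> ennreal 0"
  proof (rule tendsto_ennrealI)
    show "(\<lambda>j. 1 / real (Suc (k0 + j))) \<longlonglongrightarrow> 0"
      using LIMSEQ_ignore_initial_segment[OF LIMSEQ_inverse_real_of_nat, of k0]
      by (simp add: inverse_eq_divide add.commute)
  qed
  ultimately have "emeasure lborel ?S \<le> ennreal 0" by (intro LIMSEQ_le_const) auto
  then show ?thesis by simp
qed

lemma approximable_no_eigenfunction: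
  assumes a: "approximable a" and u: "u \<in> ell2" "\<And>n. jacobi (\<lambda>n. l * a n) u n = of_real E * u n"
  shows "u = (\<lambda>_. 0)"
proof -
  obtain k0 :: nat where k0: "max \<bar>l\<bar> \<bar>E\<bar> < real k0" using reals_Archimedean2 by blast
  show ?thesis
  proof (rule gordon[OF _ u])
    fix k :: nat assume k: "k0 \<le> k"
    then have "0 < k" using k0 by (metis abs_ge_zero max.strict_coboundedI1 max_def not_gr_zero of_nat_0 le_zero_eq not_le
      order.strict_trans1)
    then obtain q V \<eta> X m r where g: "good_period k q V \<eta> X m r" "\<And>n. \<bar>a n - V n\<bar> \<le> 2 * r"
      using a unfolding approximable_def by blast
    have "\<bar>l\<bar> \<le> real k" "\<bar>E\<bar> \<le> real k" using k0 k by auto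
    then show "\<exists>q V X r. k \<le> q \<and> (\<forall>n. V (n + int q) = V n) \<and> (\<forall>n. \<bar>E - V n\<bar> \<le> X)
      \<and> (\<forall>n. \<bar>l * a n - V n\<bar> \<le> r) \<and> 6 * (X + 2) ^ (2 * q) * real (2 * q) * r \<le> 1 / real k"
      by (rule good_repetition[OF g])
  qed
qed

lemma approximable_singular_continuous:
  assumes a: "approximable a" and M: "\<And>n. \<bar>a n\<bar> \<le> M" and l: "l \<noteq> 0"
  shows "purely_singular_continuous (jacobi (\<lambda>n. l * a n))"
proof -
  interpret bounded_potential "\<lambda>n. l * a n" "\<bar>l\<bar> * M"
    by standard (simp add: abs_mult M mult_left_mono)
  show ?thesis
    unfolding purely_singular_continuous_def continuous_measure_def
    using spectral_measure_no_atom approximable_no_eigenfunction[OF a]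
      spectral_measure_singular[OF _ _ approximable_spectrum_null[OF a M l]] by blast
qed

text \<open>Split off blocks of length \<open>N\<close>; the prefactor pays for a last piece shorter
  than \<open>N\<close>.\<close>

lemma tm_growth:
  assumes X: "\<And>i. \<bar>b i\<bar> \<le> X" and N: "0 < N" and k: "0 < k"
    and block: "\<And>j. nm2 (tm b j N) \<le> exp (real N / k)"
  shows "nm2 (tm b j n) \<le> 2 * (X + 2) ^ N * exp (real n / k)"
proof (induction n arbitrary: j rule: less_induct)
  case (less n)
  have X0: "0 \<le> X" using X[of 0] by linarith
  show ?case
  proof (cases "n < N")
    case True
    have "nm2 (tm b j n) \<le> 2 * (X + 2) ^ n" by (rule nm2_tm_le[OF X])
    also have "\<dots> \<le> 2 * (X + 2) ^ N" using True X0 by (intro mult_left_mono power_increasing) auto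
    also have "\<dots> \<le> 2 * (X + 2) ^ N * exp (real n / k)"
      using X0 k by (simp add: mult_le_cancel_left1 one_le_exp_iff)
    finally show ?thesis .
  next
    case False
    then obtain i where i: "n = N + i" using le_Suc_ex not_le by blast
    have "nm2 (tm b j n) \<le> nm2 (tm b (j + int N) i) * nm2 (tm b j N)"
      unfolding i tm_add by (rule nm2_mult_le)
    also have "\<dots> \<le> (2 * (X + 2) ^ N * exp (real i / k)) * exp (real N / k)"
      using less[of i "j + int N"] block[of j] i N X0 by (intro mult_mono) auto
    also have "\<dots> = 2 * (X + 2) ^ N * exp (real n / k)"
      by (simp add: i exp_add add_divide_distrib)
    finally show ?thesis .
  qed
qed

text \<open>The determinant is at most the product of the lengths of the two columns, each of which
  is at most the operator norm.\<close>

lemma one_le_onorm: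
  fixes A :: "real^2^2"
  assumes "A $ 1 $ 1 * A $ 2 $ 2 - A $ 1 $ 2 * A $ 2 $ 1 = 1"
  shows "1 \<le> onorm ((*v) A)"
proof -
  let ?a = "A $ 1 $ 1" and ?b = "A $ 1 $ 2" and ?c = "A $ 2 $ 1" and ?d = "A $ 2 $ 2"
  have bl: "bounded_linear ((*v) A)" by (rule matrix_vector_mul_bounded_linear)
  have n0: "0 \<le> onorm ((*v) A)" by (rule onorm_pos_le[OF bl])
  have col: "(norm (A *v axis j 1))\<^sup>2 \<le> (onorm ((*v) A))\<^sup>2" for j
    using onorm[OF bl, of "axis j 1"] by (intro power_mono) (auto simp: norm_axis_1)
  have n1: "?a\<^sup>2 + ?c\<^sup>2 \<le> (onorm ((*v) A))\<^sup>2" and n2: "?b\<^sup>2 + ?d\<^sup>2 \<le> (onorm ((*v) A))\<^sup>2"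
    using col[of 1] col[of 2]
    unfolding power2_norm_eq_inner inner_vec_def sum_2 matrix_vector_mul_component inner_axis
    by (simp_all add: power2_eq_square axis_def)
  have "1 = (?a * ?d - ?b * ?c)\<^sup>2" using assms by simp
  also have "\<dots> \<le> (?a\<^sup>2 + ?c\<^sup>2) * (?b\<^sup>2 + ?d\<^sup>2)"
    using zero_le_power2[of "?a * ?b + ?c * ?d"] by (simp add: power2_eq_square algebra_simps)
  also have "\<dots> \<le> (onorm ((*v) A))\<^sup>2 * (onorm ((*v) A))\<^sup>2"
    using n1 n2 by (intro mult_mono) auto
  also have "\<dots> = onorm ((*v) A) ^ Suc 3" by (simp add: power2_eq_square numeral_eq_Suc)
  finally have "1 ^ Suc 3 \<le> onorm ((*v) A) ^ Suc 3" by simp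
  then show ?thesis using n0 by (rule power_le_imp_le_base)
qed

text \<open>The product in the definition of the Lyapunov exponent begins with the potential at T
  \<omega>, so \<open>tm\<close> starts at site 1 here.\<close>

lemma transfer_matrix_entries:
  fixes T :: "'a \<Rightarrow> 'a" and g :: "'a \<Rightarrow> real" and E :: real
  defines "M \<equiv> \<lambda>n \<omega>. tm (\<lambda>i. E - g (int_iter T i \<omega>)) 1 n"
  shows "transfer_matrix E T g \<omega> n $ 1 $ 1 = m11 (M n \<omega>) \<and> transfer_matrix E T g \<omega> n $ 1 $ 2 = m12 (M n \<omega>) \<and>
    transfer_matrix E T g \<omega> n $ 2 $ 1 = m21 (M n \<omega>) \<and> transfer_matrix E T g \<omega> n $ 2 $ 2 = m22 (M n \<omega>)"
proof (induction n)
  case 0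
  show ?case by (simp add: M_def mat_def)
next
  case (Suc n)
  have "int_iter T (1 + int n) \<omega> = (T ^^ Suc n) \<omega>"
    using int_iter_of_nat[of T "Suc n" \<omega>] by simp
  then show ?case using Suc
    by (simp add: M_def matrix_matrix_mult_def sum_2 transfer_step_def vector_2 del: funpow.simps)
qed

text \<open>The logarithm of the norm is nonnegative by unimodularity and at most C + n/k uniformly
  in \<omega>, for every large \<open>k\<close>; dividing by n leaves 1/k.\<close>

lemma lyapunov_exponent_eq_0:
  fixes \<mu> :: "'a measure" and g :: "'a \<Rightarrow> real"
  assumes \<mu>: "emeasure \<mu> (space \<mu>) = 1" and X: "\<And>\<omega>. \<bar>E - g \<omega>\<bar> \<le> X"
    and growth: "\<And>k::nat. k0 \<le> k \<Longrightarrow> \<exists>N>0. \<forall>\<omega> j. nm2 (tm (\<lambda>i. E - g (int_iter T i \<omega>)) j N) \<le> exp (real N / real k)"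
  shows "lyapunov_exponent \<mu> E T g = 0"
proof -
  interpret finite_measure \<mu> by standard (simp add: \<mu>)
  have total: "measure \<mu> (space \<mu>) = 1" using \<mu> by (simp add: measure_def)
  define L where "L n \<omega> = ln (onorm ((*v) (transfer_matrix E T g \<omega> n)))" for n \<omega>
  have L: "0 \<le> L n \<omega>" "L n \<omega> \<le> ln (nm2 (tm (\<lambda>i. E - g (int_iter T i \<omega>)) 1 n))" for n \<omega>
  proof -
    let ?A = "transfer_matrix E T g \<omega> n" and ?M = "tm (\<lambda>i. E - g (int_iter T i \<omega>)) 1 n"
    have 1: "1 \<le> onorm ((*v) ?A)"
      using transfer_matrix_entries[of E T g \<omega> n] det2_tm[of "\<lambda>i. E - g (int_iter T i \<omega>)" 1 n]
      by (intro one_le_onorm) (simp add: det2_def)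
    have 2: "onorm ((*v) ?A) \<le> nm2 ?M"
      using onorm_le_matrix_component_sum[of ?A] transfer_matrix_entries[of E T g \<omega> n]
      by (simp add: sum_2 nm2_def)
    show "0 \<le> L n \<omega>" using 1 by (simp add: L_def)
    show "L n \<omega> \<le> ln (nm2 ?M)" unfolding L_def using 1 2 by (intro ln_mono) auto
  qed
  have X0: "0 \<le> X" using X[of undefined] abs_ge_zero order_trans by blast
  have bound: "\<exists>C. \<forall>n \<omega>. L n \<omega> \<le> C + real n / real k" if k: "k0 \<le> k" "0 < k" for k
  proof -
    obtain N where N: "0 < N" "\<And>\<omega> j. nm2 (tm (\<lambda>i. E - g (int_iter T i \<omega>)) j N) \<le> exp (real N / real k)"
      using growth[OF k(1)] by blast
    have "L n \<omega> \<le> ln (2 * (X + 2) ^ N) + real n / real k" for n \<omega>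
    proof -
      let ?M = "tm (\<lambda>i. E - g (int_iter T i \<omega>)) 1 n"
      have "nm2 ?M \<le> 2 * (X + 2) ^ N * exp (real n / real k)"
        by (rule tm_growth) (use X N k in auto)
      moreover have "0 < nm2 ?M"
      proof -
        have "nm2 ?M \<noteq> 0"
        proof
          assume "nm2 ?M = 0"
          then have "m11 ?M = 0" "m12 ?M = 0" using abs_entry_le_nm2(1,2)[of ?M] by simp_all
          then have "det2 ?M = 0" by (simp add: det2_def)
          then show False by simp
        qed
        then show ?thesis using nm2_nonneg[of ?M] by linarith
      qed
      ultimately have "ln (nm2 ?M) \<le> ln (2 * (X + 2) ^ N * exp (real n / real k))" by (intro ln_mono) auto
      also have "\<dots> = ln (2 * (X + 2) ^ N) + real n / real k"
        using X0 by (subst ln_mult) auto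
      finally show ?thesis using L(2)[of n \<omega>] by simp
    qed
    then show ?thesis by blast
  qed
  \<comment> \<open>The maximum with 0 covers the case of a non-integrable function, whose integral
    has the value 0 by convention.\<close>
  have int_le: "0 \<le> (\<integral>\<omega>. L n \<omega> \<partial>\<mu>) \<and> (\<integral>\<omega>. L n \<omega> \<partial>\<mu>) \<le> max 0 c" if "\<And>\<omega>. L n \<omega> \<le> c" for n c
  proof
    show "0 \<le> (\<integral>\<omega>. L n \<omega> \<partial>\<mu>)" using L(1) by (intro integral_nonneg_AE) auto
    show "(\<integral>\<omega>. L n \<omega> \<partial>\<mu>) \<le> max 0 c"
    proof (cases "integrable \<mu> (L n)")
      case True
      then have "(\<integral>\<omega>. L n \<omega> \<partial>\<mu>) \<le> (\<integral>\<omega>. max 0 c \<partial>\<mu>)"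
        using that by (intro integral_mono) (auto intro: le_max_iff_disj[THEN iffD2])
      then show ?thesis by (simp add: total)
    qed (simp add: not_integrable_integral_eq)
  qed
  have "(\<lambda>n. 1 / real n * (\<integral>\<omega>. L n \<omega> \<partial>\<mu>)) \<longlonglongrightarrow> 0"
  proof (rule tendstoI)
    fix e :: real assume e: "0 < e"
    obtain k1 :: nat where k1: "2 / e < real k1" using reals_Archimedean2 by blast
    define k where "k = max k0 (Suc k1)"
    have k: "k0 \<le> k" "0 < k" "2 / e < real k" using k1 by (auto simp: k_def)
    obtain C where C: "\<And>n \<omega>. L n \<omega> \<le> C + real n / real k" using bound[OF k(1,2)] by blast
    define C' where "C' = max 0 C"
    obtain n0 :: nat where n0: "2 * C' / e < real n0" using reals_Archimedean2 by blast
    have "dist (1 / real n * (\<integral>\<omega>. L n \<omega> \<partial>\<mu>)) 0 < e" if n: "Suc n0 \<le> n" for n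
    proof -
      have np: "0 < real n" using n by simp
      have "0 \<le> C' + real n / real k" by (simp add: C'_def)
      moreover have "L n \<omega> \<le> C' + real n / real k" for \<omega> using C[of n \<omega>] by (simp add: C'_def)
      ultimately have I: "0 \<le> (\<integral>\<omega>. L n \<omega> \<partial>\<mu>)" "(\<integral>\<omega>. L n \<omega> \<partial>\<mu>) \<le> C' + real n / real k"
        using int_le[of n "C' + real n / real k"] by auto
      have "1 / real n * (\<integral>\<omega>. L n \<omega> \<partial>\<mu>) \<le> 1 / real n * (C' + real n / real k)"
        using I np by (intro mult_left_mono) auto
      also have "\<dots> = C' / real n + 1 / real k" using np by (simp add: field_simps)
      also have "\<dots> < e / 2 + e / 2"
      proof (intro add_le_less_mono)
        have "2 * C' / e \<le> real n" using n0 n by linarith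
        then show "C' / real n \<le> e / 2" using e np by (simp add: field_simps)
        show "1 / real k < e / 2" using k e by (simp add: field_simps)
      qed
      finally show ?thesis using I(1) np by (simp add: dist_real_def abs_of_nonneg)
    qed
    then show "\<forall>\<^sub>F n in sequentially. dist (1 / real n * (\<integral>\<omega>. L n \<omega> \<partial>\<mu>)) 0 < e"
      unfolding eventually_sequentially by blast
  qed
  then show ?thesis unfolding lyapunov_exponent_def L_def by (rule limI)
qed

text \<open>The order of choices matters: \<open>X\<close> first, using r <= 1 in advance; then
  \<open>m\<close>, since 3^m is beaten by an exponential of 2^m; then \<eta>, which depends on
  \<open>m\<close>; and \<open>r\<close> last, below all resulting thresholds.\<close>

lemma exists_good_period:
  fixes a :: "int \<Rightarrow> real"
  assumes k: "0 < k" "k \<le> q" and per: "\<And>n. a (n + int q) = a n" and A: "\<And>n. \<bar>a n\<bar> \<le> A" and \<eta>0: "0 < \<eta>0"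
    and bands: "\<And>l. 1 / real k \<le> \<bar>l\<bar> \<Longrightarrow> \<bar>l\<bar> \<le> real k \<Longrightarrow>
       emeasure lborel {E. \<bar>E\<bar> \<le> real k \<and> \<bar>tr2 (tm (\<lambda>i. E - l * a i) 0 q)\<bar> \<le> 2 + \<eta>0} \<le> ennreal (1 / real k)"
  shows "\<exists>\<eta> X m r. good_period k q a \<eta> X m r"
proof -
  have A0: "0 \<le> A" using A[of 0] by linarith
  define X where "X = real k + real k * (A + 2)"
  have X0: "0 \<le> X" using A0 by (simp add: X_def)
  define Y where "Y = 2 * (X + 2) ^ q + 1"
  have Y: "0 < Y" using X0 by (simp add: Y_def add_nonneg_pos)
  have kq: "0 < real k" "0 < real q" using k by auto
  obtain m where m: "ln 3 * real k / real q * real m + ln Y * real k / real q \<le> 1 * (1 + 1) ^ m"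
    using linear_le_exponential[of 1 1 "ln 3 * real k / real q" "ln Y * real k / real q"] by auto
  have "real m * ln 3 + ln Y = (ln 3 * real k / real q * real m + ln Y * real k / real q) * (real q / real k)"
    using kq by (simp add: field_simps)
  also have "\<dots> \<le> 2 ^ m * (real q / real k)" using m kq by (intro mult_right_mono) auto
  finally have "exp (real m * ln 3 + ln Y) \<le> exp (2 ^ m * (real q / real k))" by simp
  moreover have "exp (real m * ln 3 + ln Y) = 3 ^ m * Y"
    using Y by (simp add: exp_add exp_of_nat_mult)
  ultimately have mY: "3 ^ m * Y \<le> exp (real (2 ^ m * q) / real k)" by simp
  define \<eta> where "\<eta> = min \<eta>0 (1 / 5 ^ m)"
  have \<eta>: "0 < \<eta>" "\<eta> \<le> \<eta>0" "\<eta> \<le> 1 / 5 ^ m" using \<eta>0 by (auto simp: \<eta>_def)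
  define c1 where "c1 = 6 * (X + 2) ^ (2 * q) * real (2 * q) * (real k * 2)"
  define c2 where "c2 = 2 * real (2 ^ m * q) * (X + 2) ^ (2 ^ m * q) * (real k * 2)"
  have c: "0 < c1" "0 < c2" using X0 kq by (auto simp: c1_def c2_def)
  define b where "b = min (\<eta> / 2) (1 / real k)"
  have b: "0 < b" using \<eta> kq by (simp add: b_def)
  define r where "r = min 1 (min (b / c1) (1 / c2))"
  have r: "0 < r" "r \<le> 1" "r \<le> b / c1" "r \<le> 1 / c2" using b c by (auto simp: r_def)
  have r1: "c1 * r \<le> b" using r(3) c by (simp add: field_simps)
  have r2: "c2 * r \<le> 1" using r(4) c by (simp add: field_simps)
  have Xn: "real k + real k * (\<bar>a n\<bar> + 2 * r) \<le> X" for n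
    unfolding X_def using A[of n] r(2) by (intro add_left_mono mult_left_mono add_mono) auto
  have bd: "emeasure lborel {E. \<bar>E\<bar> \<le> real k \<and> \<bar>tr2 (tm (\<lambda>i. E - l * a i) 0 q)\<bar> \<le> 2 + \<eta>} \<le> ennreal (1 / real k)"
    if l: "1 / real k \<le> \<bar>l\<bar>" "\<bar>l\<bar> \<le> real k" for l
  proof -
    have "emeasure lborel {E. \<bar>E\<bar> \<le> real k \<and> \<bar>tr2 (tm (\<lambda>i. E - l * a i) 0 q)\<bar> \<le> 2 + \<eta>}
      \<le> emeasure lborel {E. \<bar>E\<bar> \<le> real k \<and> \<bar>tr2 (tm (\<lambda>i. E - l * a i) 0 q)\<bar> \<le> 2 + \<eta>0}"
      using \<eta>(2) by (intro emeasure_mono) (auto simp: closed_bands borel_closed)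
    also note bands[OF l]
    finally show ?thesis .
  qed
  have "6 * (X + 2) ^ (2 * q) * real (2 * q) * (real k * (2 * r)) = c1 * r"
    "2 * real (2 ^ m * q) * (X + 2) ^ (2 ^ m * q) * (real k * (2 * r)) = c2 * r"
    by (simp_all add: c1_def c2_def)
  then have "good_period k q a \<eta> X m r"
    unfolding good_period_def using k per \<eta> r(1) Xn bd r1 r2 mY by (simp only: b_def Y_def) simp
  then show ?thesis by blast
qed

subsection \<open>Genericity\<close>

text \<open>The library proves completeness only over metric domains, but procyclic groups need not be
  metrizable.\<close>

lemma complete_bcontfun: "complete (UNIV :: ('a::topological_space \<Rightarrow>\<^sub>C 'b::complete_space) set)"
  unfolding complete_def
proof (intro allI impI)
  fix F :: "nat \<Rightarrow> 'a \<Rightarrow>\<^sub>C 'b" assume "(\<forall>n. F n \<in> UNIV) \<and> Cauchy F"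
  then have cau: "Cauchy F" by simp
  have "Cauchy (\<lambda>n. apply_bcontfun (F n) x)" for x
    unfolding Cauchy_def
  proof (intro allI impI)
    fix e :: real assume "0 < e"
    then obtain M where "\<And>m n. M \<le> m \<Longrightarrow> M \<le> n \<Longrightarrow> dist (F m) (F n) < e"
      using cau unfolding Cauchy_def by blast
    then show "\<exists>M. \<forall>m\<ge>M. \<forall>n\<ge>M. dist (apply_bcontfun (F m) x) (apply_bcontfun (F n) x) < e"
      using dist_bounded[of "F _" x "F _"] le_less_trans by blast
  qed
  then have "convergent (\<lambda>n. apply_bcontfun (F n) x)" for x by (rule Cauchy_convergent)
  then obtain g where g: "\<And>x. (\<lambda>n. apply_bcontfun (F n) x) \<longlonglongrightarrow> g x" unfolding convergent_def by metis
  have close: "\<exists>M. \<forall>n\<ge>M. \<forall>x. dist (apply_bcontfun (F n) x) (g x) \<le> e" if "0 < e" for e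
  proof -
    obtain M where M: "\<And>m n. M \<le> m \<Longrightarrow> M \<le> n \<Longrightarrow> dist (F m) (F n) < e"
      using cau \<open>0 < e\<close> unfolding Cauchy_def by blast
    have "dist (apply_bcontfun (F n) x) (g x) \<le> e" if "M \<le> n" for n x
    proof (rule LIMSEQ_le_const2[OF tendsto_dist[OF tendsto_const g]])
      have "dist (apply_bcontfun (F n) x) (apply_bcontfun (F m) x) \<le> e" if "M \<le> m" for m
        using dist_bounded[of "F n" x "F m"] M[OF \<open>M \<le> n\<close> that] by linarith
      then show "\<exists>N. \<forall>m\<ge>N. dist (apply_bcontfun (F n) x) (apply_bcontfun (F m) x) \<le> e" by blast
    qed
    then show ?thesis by blast
  qed
  have "uniform_limit UNIV (\<lambda>n. apply_bcontfun (F n)) g sequentially"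
  proof (rule uniform_limitI)
    fix e :: real assume "0 < e"
    then obtain M where M: "\<And>n x. M \<le> n \<Longrightarrow> dist (apply_bcontfun (F n) x) (g x) \<le> e / 2" using close[of "e / 2"] by auto
    have "dist (apply_bcontfun (F n) x) (g x) < e" if "M \<le> n" for n x
      using M[OF that, of x] \<open>0 < e\<close> by simp
    then show "\<forall>\<^sub>F n in sequentially. \<forall>x\<in>UNIV. dist (apply_bcontfun (F n) x) (g x) < e"
      unfolding eventually_sequentially by blast
  qed
  moreover have "continuous_on UNIV (apply_bcontfun (F n))" for n
    using apply_bcontfun[of "F n"] by (simp add: bcontfun_def)
  ultimately have cont: "continuous_on UNIV g" by (intro uniform_limit_theorem[of _ _ sequentially]) auto
  obtain M where M: "\<And>n x. M \<le> n \<Longrightarrow> dist (apply_bcontfun (F n) x) (g x) \<le> 1" using close[of 1] by auto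
  have "bounded (range (apply_bcontfun (F M)))" using apply_bcontfun[of "F M"] by (simp add: bcontfun_def)
  then obtain y B where B: "\<And>x. dist y (apply_bcontfun (F M) x) \<le> B" unfolding bounded_def by auto
  have "dist y (g x) \<le> B + 1" for x
    using dist_triangle[of y "g x" "apply_bcontfun (F M) x"] B[of x] M[of M x] by simp
  then have "bounded (range g)" unfolding bounded_def by blast
  then have "g \<in> bcontfun" using cont by (simp add: bcontfun_def)
  then have G: "apply_bcontfun (Bcontfun g) = g" by (rule Bcontfun_inverse)
  have "F \<longlonglongrightarrow> Bcontfun g"
  proof (rule metric_LIMSEQ_I)
    fix e :: real assume e: "0 < e"
    then obtain M where M: "\<And>n x. M \<le> n \<Longrightarrow> dist (apply_bcontfun (F n) x) (g x) \<le> e / 2" using close[of "e / 2"] by auto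
    have "dist (F n) (Bcontfun g) < e" if "M \<le> n" for n
    proof -
      have "dist (F n) (Bcontfun g) \<le> e / 2" by (rule dist_bound) (simp only: G M[OF that])
      then show ?thesis using e by simp
    qed
    then show "\<exists>M. \<forall>n\<ge>M. dist (F n) (Bcontfun g) < e" by blast
  qed
  then show "\<exists>l\<in>UNIV. F \<longlonglongrightarrow> l" by blast
qed

context minimal_translation
begin

abbreviation potential :: "('a \<Rightarrow>\<^sub>C real) \<Rightarrow> 'a \<Rightarrow> int \<Rightarrow> real" where
  "potential f \<omega> \<equiv> \<lambda>n. apply_bcontfun f (int_iter T n \<omega>)"

lemma continuous_bcontfun: "continuous_on UNIV (apply_bcontfun (f :: 'a \<Rightarrow>\<^sub>C real))"
  using apply_bcontfun[of f] by (simp add: bcontfun_def)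

lemma potential_bounded: "\<bar>potential f \<omega> n\<bar> \<le> norm f"
  using norm_bounded[of f "int_iter T n \<omega>"] by simp

lemma bounded_potential_potential: "bounded_potential (\<lambda>n. l * potential f \<omega> n) (\<bar>l\<bar> * norm f)"
  by standard (simp add: abs_mult potential_bounded mult_left_mono)

text \<open>Both potentials are uniformly close to shifts of the sequence along the orbit of 0, so
  one is close to a shift of the other, and half of the lower bound survives.\<close>

lemma spectrum_independent:
  assumes E: "complex_of_real E \<in> spectrum (jacobi (\<lambda>n. l * potential f \<omega> n))"
  shows "complex_of_real E \<in> spectrum (jacobi (\<lambda>n. l * potential f \<omega>' n))"
proof (rule ccontr)
  interpret A: bounded_potential "\<lambda>n. l * potential f \<omega> n" "\<bar>l\<bar> * norm f" by (rule bounded_potential_potential)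
  interpret B: bounded_potential "\<lambda>n. l * potential f \<omega>' n" "\<bar>l\<bar> * norm f" by (rule bounded_potential_potential)
  assume "\<not> ?thesis"
  then obtain \<delta> where \<delta>: "0 < \<delta>" "\<And>x. \<delta> * norm x \<le> norm (jacobi_l2 (\<lambda>n. l * potential f \<omega>' n) (of_real E) x)"
    unfolding B.spectrum_iff by blast
  \<comment> \<open>Two approximation errors, multiplied by |l|, must stay within \<delta> / 2; the
    added 1 avoids a division by zero.\<close>
  define e where "e = \<delta> / (4 * (\<bar>l\<bar> + 1))"
  have e: "0 < e" using \<delta> by (simp add: e_def add_nonneg_pos)
  obtain s where s: "\<And>n. \<bar>potential f \<omega> n - apply_bcontfun f (\<tau> (n + s))\<bar> < e"
    using orbit_approximation[OF continuous_bcontfun e, of f \<omega>] by blast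
  obtain s' where s': "\<And>n. \<bar>potential f \<omega>' n - apply_bcontfun f (\<tau> (n + s'))\<bar> < e"
    using orbit_approximation[OF continuous_bcontfun e, of f \<omega>'] by blast
  define t where "t = s - s'"
  let ?c = "\<lambda>n. l * potential f \<omega>' (n + t)"
  have C: "bounded_potential ?c (\<bar>l\<bar> * norm f)" by standard (rule B.bounded)
  interpret C: bounded_potential ?c "\<bar>l\<bar> * norm f" by (rule C)
  have close: "\<bar>?c n - l * potential f \<omega> n\<bar> \<le> \<delta> / 2" for n
  proof -
    have "\<bar>potential f \<omega>' (n + t) - potential f \<omega> n\<bar> \<le> 2 * e"
      using s[of n] s'[of "n + t"] by (simp add: t_def abs_less_iff abs_le_iff)
    then have "\<bar>l\<bar> * \<bar>potential f \<omega>' (n + t) - potential f \<omega> n\<bar> \<le> (\<bar>l\<bar> + 1) * (2 * e)"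
      by (intro mult_mono) auto
    also have "\<dots> = \<delta> / 2" by (simp add: e_def field_simps add_nonneg_eq_0_iff)
    finally show ?thesis by (simp add: abs_mult[symmetric] right_diff_distrib)
  qed
  have "\<delta> / 2 * norm x \<le> norm (jacobi_l2 (\<lambda>n. l * potential f \<omega> n) (of_real E) x)" for x
  proof -
    have x: "shift_l2 t (shift_l2 (- t) x) = x" by (rule l2_ext) (simp add: shift_l2.rep_eq)
    have "\<delta> * norm x \<le> norm (jacobi_l2 (\<lambda>n. l * potential f \<omega>' n) (of_real E) (shift_l2 (- t) x))"
      using \<delta>(2)[of "shift_l2 (- t) x"] by simp
    also have "\<dots> = norm (jacobi_l2 ?c (of_real E) x)"
      using jacobi_l2_shift[OF B.bounded_potential_axioms, of t "of_real E" "shift_l2 (- t) x"] by (simp add: x)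
    also have "\<dots> \<le> norm (jacobi_l2 (\<lambda>n. l * potential f \<omega> n) (of_real E) x) + \<delta> / 2 * norm x"
      by (rule C.jacobi_l2_perturbation[OF A.bounded_potential_axioms close])
    finally show ?thesis by (simp add: field_simps)
  qed
  then show False using E \<delta>(1) unfolding A.spectrum_iff by (metis half_gt_zero)
qed

text \<open>Independence of the base point gives the definite description a unique solution.\<close>

lemma Sigma_spec_eq:
  "Sigma_spec T (\<lambda>\<omega>. l * apply_bcontfun f \<omega>) = {E. complex_of_real E \<in> spectrum (jacobi (\<lambda>n. l * potential f \<omega> n))}"
  unfolding Sigma_spec_def schrodinger_eq_jacobi
  by (rule the_equality) (use spectrum_independent in blast)+

text \<open>A union of open balls around extensions of good periodic sequences, each with the
  tolerance of its own centre as radius.\<close>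

definition level :: "nat \<Rightarrow> ('a \<Rightarrow>\<^sub>C real) set" where
  "level k = {f. \<exists>q V \<eta> X m r g. good_period k q V \<eta> X m r \<and> (\<forall>n. apply_bcontfun g (\<tau> n) = V n) \<and> dist f g < r}"

lemma open_level: "open (level k)"
  unfolding open_dist
proof
  fix f assume "f \<in> level k"
  then obtain q V \<eta> X m r g where g: "good_period k q V \<eta> X m r" "\<forall>n. apply_bcontfun g (\<tau> n) = V n" "dist f g < r"
    unfolding level_def by blast
  have "f' \<in> level k" if "dist f' f < r - dist f g" for f'
  proof -
    have "dist f' g < r" using that dist_triangle[of f' g f] by linarith
    then show ?thesis unfolding level_def using g by blast
  qed
  then show "\<exists>e>0. \<forall>f'. dist f' f < e \<longrightarrow> f' \<in> level k"
    using g(3) by (intro exI[of _ "r - dist f g"]) auto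
qed

text \<open>Approximate by a periodic sequence along the orbit, perturb it to one with short bands
  and a realizable period, and extend that back to the group. The result is itself the centre of a
  ball of the level.\<close>

lemma level_dense:
  assumes k: "0 < k" shows "closure (level k) = UNIV"
proof -
  have "\<exists>f\<in>level k. dist f h < \<epsilon>" if \<epsilon>: "0 < \<epsilon>" for h \<epsilon>
  proof -
    define \<epsilon>' where "\<epsilon>' = \<epsilon> / 3"
    have \<epsilon>': "0 < \<epsilon>'" "\<epsilon>' + \<epsilon>' < \<epsilon>" using \<epsilon> by (auto simp: \<epsilon>'_def)
    obtain p V0 where p: "p \<in> admissible" "\<And>n. V0 (n + int p) = V0 n"
      "\<And>n. \<bar>apply_bcontfun h (\<tau> n) - V0 n\<bar> < \<epsilon>'"
      using periodic_approximation[OF continuous_bcontfun \<epsilon>'(1), of h] by blast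
    have "\<exists>q\<in>admissible. k \<le> q \<and> (\<exists>a' \<eta>. (\<forall>i. a' (i + int q) = a' i) \<and> (\<forall>i. \<bar>a' i - V0 i\<bar> \<le> \<epsilon>') \<and> 0 < \<eta> \<and>
       (\<forall>l. 1 / real k \<le> \<bar>l\<bar> \<longrightarrow> \<bar>l\<bar> \<le> real k \<longrightarrow>
        emeasure lborel {E. \<bar>E\<bar> \<le> real k \<and> \<bar>tr2 (tm (\<lambda>i. E - l * a' i) 0 q)\<bar> \<le> 2 + \<eta>} \<le> ennreal (1 / real k)))"
      by (rule small_bands_perturbation[OF _ _ p(1)]) (use admissible_pos admissible_multiple p(2) \<epsilon>' k in auto)
    then obtain q a' \<eta> where q: "q \<in> admissible" "k \<le> q" "\<And>i. a' (i + int q) = a' i" "\<And>i. \<bar>a' i - V0 i\<bar> \<le> \<epsilon>'" "0 < \<eta>"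
       "\<And>l. 1 / real k \<le> \<bar>l\<bar> \<Longrightarrow> \<bar>l\<bar> \<le> real k \<Longrightarrow>
        emeasure lborel {E. \<bar>E\<bar> \<le> real k \<and> \<bar>tr2 (tm (\<lambda>i. E - l * a' i) 0 q)\<bar> \<le> 2 + \<eta>} \<le> ennreal (1 / real k)"
      by blast
    have near: "\<bar>a' n - apply_bcontfun h (\<tau> n)\<bar> \<le> \<epsilon>' + \<epsilon>'" for n
      using p(3)[of n] q(4)[of n] by (simp add: abs_less_iff abs_le_iff)
    have "\<bar>a' n\<bar> \<le> norm h + (\<epsilon>' + \<epsilon>')" for n
      using near[of n] norm_bounded[of h "\<tau> n"] by (simp add: abs_le_iff)
    then obtain \<eta>1 X m r where good: "good_period k q a' \<eta>1 X m r"
      using exists_good_period[OF k q(2,3) _ q(5,6)] by blast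
    obtain g :: "'a \<Rightarrow>\<^sub>C real" where g: "\<And>n. apply_bcontfun g (\<tau> n) = a' n"
      using periodic_extension[of q a', OF q(1,3)] by blast
    have "dist g h \<le> \<epsilon>' + \<epsilon>'" by (rule dist_le_of_orbit) (simp only: g near)
    moreover have "dist g g < r" using good by (simp add: good_period_def)
    then have "g \<in> level k" unfolding level_def using good g by blast
    ultimately show ?thesis using \<epsilon>' by (intro bexI[of _ g]) auto
  qed
  then show ?thesis by (auto simp: closure_approachable)
qed

lemma level_good:
  assumes "f \<in> level k"
  obtains q V \<eta> X m r where "good_period k q V \<eta> X m r"
    "\<And>\<omega>. \<exists>s. \<forall>n. \<bar>potential f \<omega> n - V (n + s)\<bar> \<le> 2 * r"
proof -
  obtain q V \<eta> X m r g where g: "good_period k q V \<eta> X m r" "\<And>n. apply_bcontfun g (\<tau> n) = V n" "dist f g < r"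
    using assms unfolding level_def by blast
  have r: "0 < r" using g(1) by (simp add: good_period_def)
  have "\<exists>s. \<forall>n. \<bar>potential f \<omega> n - V (n + s)\<bar> \<le> 2 * r" for \<omega>
  proof -
    obtain s where s: "\<And>n. \<bar>potential f \<omega> n - apply_bcontfun f (\<tau> (n + s))\<bar> < r"
      using orbit_approximation[OF continuous_bcontfun r, of f \<omega>] by blast
    have "\<bar>potential f \<omega> n - V (n + s)\<bar> \<le> 2 * r" for n
    proof -
      have "\<bar>apply_bcontfun f (\<tau> (n + s)) - V (n + s)\<bar> < r"
        using dist_bounded[of f "\<tau> (n + s)" g] g(2,3) by (simp add: dist_real_def)
      then show ?thesis using s[of n] by linarith
    qed
    then show ?thesis by blast
  qed
  then show ?thesis using that g(1) by blast
qed

lemma levels_approximable: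
  assumes "\<And>k. 0 < k \<Longrightarrow> f \<in> level k" shows "approximable (potential f \<omega>)"
  unfolding approximable_def
proof (intro allI impI)
  fix k :: nat assume "0 < k"
  then obtain q V \<eta> X m r where V: "good_period k q V \<eta> X m r"
    "\<And>\<omega>. \<exists>s. \<forall>n. \<bar>potential f \<omega> n - V (n + s)\<bar> \<le> 2 * r"
    using level_good[OF assms] by metis
  obtain s where "\<forall>n. \<bar>potential f \<omega> n - V (n + s)\<bar> \<le> 2 * r" using V(2) by blast
  then show "\<exists>q V \<eta> X m r. good_period k q V \<eta> X m r \<and> (\<forall>n. \<bar>potential f \<omega> n - V n\<bar> \<le> 2 * r)"
    using good_period_shift[OF V(1)] by blast
qed

lemma levels_growth:
  assumes f: "\<And>k. 0 < k \<Longrightarrow> f \<in> level k" and l: "l \<noteq> 0"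
    and E: "E \<in> Sigma_spec T (\<lambda>\<omega>. l * apply_bcontfun f \<omega>)"
  shows "\<exists>k0. \<forall>k\<ge>k0. \<exists>N>0. \<forall>\<omega> j. nm2 (tm (\<lambda>i. E - l * potential f \<omega> i) j N) \<le> exp (real N / real k)"
proof -
  obtain k0 :: nat where k0: "max \<bar>l\<bar> \<bar>E\<bar> < real k0" using reals_Archimedean2 by blast
  have "\<exists>N>0. \<forall>\<omega> j. nm2 (tm (\<lambda>i. E - l * potential f \<omega> i) j N) \<le> exp (real N / real k)" if k: "k0 \<le> k" for k
  proof -
    have lE: "\<bar>l\<bar> \<le> real k" "\<bar>E\<bar> \<le> real k" using k0 k by auto
    then have k_pos: "0 < k" using l by (cases k) auto
    obtain q V \<eta> X m r where V: "good_period k q V \<eta> X m r"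
      "\<And>\<omega>. \<exists>s. \<forall>n. \<bar>potential f \<omega> n - V (n + s)\<bar> \<le> 2 * r"
      using level_good[OF f[OF k_pos]] by metis
    have "nm2 (tm (\<lambda>i. E - l * potential f \<omega> i) j (2 ^ m * q)) \<le> exp (real (2 ^ m * q) / real k)" for \<omega> j
    proof -
      obtain s where s: "\<And>n. \<bar>potential f \<omega> n - V (n + s)\<bar> \<le> 2 * r" using V(2) by blast
      show ?thesis
        by (rule good_growth[OF good_period_shift[OF V(1)] s lE]) (use E in \<open>simp add: Sigma_spec_eq[where \<omega> = \<omega>]\<close>)
    qed
    moreover have "0 < 2 ^ m * q" using V(1) by (auto simp: good_period_def)
    ultimately show ?thesis by blast
  qed
  then show ?thesis by blast
qed

text \<open>The intersection starts at level 1, because \<open>good_period\<close> demands k > 0 and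
  level 0 is empty.\<close>

lemma generic_set_dense: "closure (\<Inter>k. level (Suc k)) = UNIV"
proof -
  have "Met_TC.mtopology closure_of (\<Inter>(range (\<lambda>k. level (Suc k)))) = UNIV"
    by (rule Met_TC.metric_Baire_category) (use complete_bcontfun open_level level_dense in auto)
  then show ?thesis by simp
qed

end

theorem theorem2p18:
  fixes T :: "'a::{topological_group_add, t2_space} \<Rightarrow> 'a"
    and \<mu> :: "'a measure"
  assumes "procyclic TYPE('a) TYPE('i) TYPE('g)"
    and "infinite (UNIV :: 'a set)"
    and "translation T"
    and "minimal T"
    and "normalized_haar \<mu>"
  shows "\<exists>F :: ('a \<Rightarrow>\<^sub>C real) set. gdelta F \<and> closure F = UNIV \<and>
    (\<forall>f\<in>F. \<forall>l::real. l \<noteq> 0 \<longrightarrow>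
       Sigma_spec T (\<lambda>\<omega>. l * apply_bcontfun f \<omega>) \<in> null_sets lebesgue \<and>
       (\<forall>\<omega>. purely_singular_continuous (schrodinger T (\<lambda>\<omega>. l * apply_bcontfun f \<omega>) \<omega>)) \<and>
       (\<forall>E\<in>Sigma_spec T (\<lambda>\<omega>. l * apply_bcontfun f \<omega>).
          lyapunov_exponent \<mu> E T (\<lambda>\<omega>. l * apply_bcontfun f \<omega>) = 0))"
proof -
  obtain \<omega>\<^sub>0 where T: "\<And>\<omega>. T \<omega> = \<omega> + \<omega>\<^sub>0" using assms(3) unfolding translation_def by blast
  interpret minimal_translation T \<omega>\<^sub>0
  proof
    show "compact (UNIV :: 'a set)" using assms(1) by (simp add: procyclic_def)
    show "\<exists>K::'a set. open_subgroup K \<and> K \<subseteq> U" if "open U" "0 \<in> U" for U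
      by (rule procyclic_open_subgroup_base[OF assms(1) that])
  qed (use T assms in auto)
  have \<mu>: "emeasure \<mu> (space \<mu>) = 1"
    using assms(5) sets_eq_imp_space_eq[of \<mu> borel] by (simp add: normalized_haar_def)
  let ?F = "\<Inter>k. level (Suc k)"
  have gd: "gdelta ?F" by (intro gdelta.intros) (rule open_level)
  have main: "Sigma_spec T (\<lambda>\<omega>. l * apply_bcontfun f \<omega>) \<in> null_sets lebesgue \<and>
       (\<forall>\<omega>. purely_singular_continuous (schrodinger T (\<lambda>\<omega>. l * apply_bcontfun f \<omega>) \<omega>)) \<and>
       (\<forall>E\<in>Sigma_spec T (\<lambda>\<omega>. l * apply_bcontfun f \<omega>).
          lyapunov_exponent \<mu> E T (\<lambda>\<omega>. l * apply_bcontfun f \<omega>) = 0)"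
    if f: "f \<in> ?F" and l: "l \<noteq> 0" for f l
  proof (intro conjI allI ballI)
    have lev: "f \<in> level k" if "0 < k" for k using f that by (cases k) auto
    have app: "approximable (potential f \<omega>)" for \<omega> by (rule levels_approximable[OF lev])
    let ?S = "Sigma_spec T (\<lambda>\<omega>. l * apply_bcontfun f \<omega>)"
    interpret P: bounded_potential "\<lambda>n. l * potential f 0 n" "\<bar>l\<bar> * norm f" by (rule bounded_potential_potential)
    have S: "?S = {E. complex_of_real E \<in> spectrum (jacobi (\<lambda>n. l * potential f 0 n))}" by (rule Sigma_spec_eq)
    have "emeasure lborel ?S = 0" unfolding S
      by (rule approximable_spectrum_null[OF app potential_bounded l])
    moreover have "?S \<in> sets lborel" unfolding S using P.closed_spectrum by (simp add: borel_closed)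
    ultimately have "?S \<in> null_sets lborel" by (simp add: null_sets_def)
    then show "?S \<in> null_sets lebesgue" by (rule null_sets_completionI)
    show "purely_singular_continuous (schrodinger T (\<lambda>\<omega>. l * apply_bcontfun f \<omega>) \<omega>)" for \<omega>
      unfolding schrodinger_eq_jacobi by (rule approximable_singular_continuous[OF app potential_bounded l])
    fix E assume E: "E \<in> ?S"
    obtain k0 where k0: "\<And>k. k0 \<le> k \<Longrightarrow> \<exists>N>0. \<forall>\<omega> j. nm2 (tm (\<lambda>i. E - l * potential f \<omega> i) j N) \<le> exp (real N / real k)"
      using levels_growth[OF lev l E] by blast
    show "lyapunov_exponent \<mu> E T (\<lambda>\<omega>. l * apply_bcontfun f \<omega>) = 0"
    proof (rule lyapunov_exponent_eq_0[OF \<mu> _ k0])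
      fix \<omega>
      have "\<bar>l * apply_bcontfun f \<omega>\<bar> \<le> \<bar>l\<bar> * norm f"
        using norm_bounded[of f \<omega>] by (simp add: abs_mult mult_left_mono)
      then show "\<bar>E - l * apply_bcontfun f \<omega>\<bar> \<le> \<bar>E\<bar> + \<bar>l\<bar> * norm f" by linarith
    qed
  qed
  show ?thesis
  proof (rule exI[of _ ?F], intro conjI)
    show "\<forall>f\<in>?F. \<forall>l. l \<noteq> 0 \<longrightarrow>
       Sigma_spec T (\<lambda>\<omega>. l * apply_bcontfun f \<omega>) \<in> null_sets lebesgue \<and>
       (\<forall>\<omega>. purely_singular_continuous (schrodinger T (\<lambda>\<omega>. l * apply_bcontfun f \<omega>) \<omega>)) \<and>
       (\<forall>E\<in>Sigma_spec T (\<lambda>\<omega>. l * apply_bcontfun f \<omega>).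
          lyapunov_exponent \<mu> E T (\<lambda>\<omega>. l * apply_bcontfun f \<omega>) = 0)"
      by (intro ballI allI impI) (rule main)
  qed (rule gd, rule generic_set_dense)
qed

end
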